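(* Let $\lambda=(\lambda_1,\dots,\lambda_k)\vdash n-1$. For each $s$ such that $\lambda(s^+)$ is a partition, let $w_s\in S_n$ be the permutation whose diagram moves the last strand of row $s$ of $\lambda(s^+)$ (the strand in position $\lambda_1+\cdots+\lambda_s+1$) to position $n$, keeping the order of the other strands, and define in $\mathcal H$ $$\iota_s=(e_\lambda\otimes\mathsf 1_{\mathsf P})\circ w_s\circ h_{\lambda_s+1}\circ e_{\lambda(s^+)}:\mathsf P^{\lambda(s^+)}\to\mathsf P^\lambda\mathsf P,\qquad \rho_s=e_{\lambda(s^+)}\circ w_s^{-1}\circ\big((h_{\lambda_s}\circ e_\lambda)\otimes\mathsf 1_{\mathsf P}\big):\mathsf P^\lambda\mathsf P\to\mathsf P^{\lambda(s^+)},$$ where $h_{\lambda_s+1}$ (resp. $h_{\lambda_s}$) is the symmetrizer on the strands of row $s$ of $\lambda(s^+)$ (resp. of $\lambda$). Then $$\rho_s\circ\iota_r=\delta_{s,r}\,\mathsf 1_{\mathsf P^{\lambda(s^+)}}\qquad\text{and}\qquad\mathsf 1_{\mathsf P^\lambda\mathsf P}=\sum_{s}\iota_s\circ\rho_s,$$ the sum being over all $s$ such that $\lambda(s^+)$ is a partition. Thus $\mathsf P^\lambda\mathsf P\cong\bigoplus_{\mu=\lambda+\square}\mathsf P^\mu$ in $\mathcal H$.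
   Context: Let $k$ be a field of characteristic zero. Khovanov's Heisenberg category: $\mathcal H'$ is the additive $k$-linear monoidal category generated by two objects $Q_+,Q_-$. Its morphisms are $k$-linear combinations of oriented planar string diagrams up to isotopy rel boundary (read bottom to top; $Q_+$ is an upward strand, $Q_-$ a downward strand), generated by the crossing of two upward strands and the four oriented cups and caps (so $Q_+,Q_-$ are biadjoint), modulo: (i) the double crossing of two upward strands is the identity; (ii) the braid relation for three upward strands; (iii) the double crossing $Q_+Q_-\to Q_-Q_+\to Q_+Q_-$ is the identity; (iv) the double crossing $Q_-Q_+\to Q_+Q_-\to Q_-Q_+$ is the identity minus the composite of the cap $Q_-Q_+\to\mathsf 1$ followed by the cup $\mathsf 1\to Q_-Q_+$; (v) a counterclockwise circle equals $1$; (vi) an upward strand with a curl on its left is zero. $\mathcal H$ is the Karoubi envelope of $\mathcal H'$. Write $\mathsf P=Q_+$, $\mathsf Q=Q_-$, juxtaposition for $\otimes$, and $\mathsf 1_{\mathsf X}$ for the identity of $\mathsf X$. Relations (i),(ii) give an algebra map $k[S_r]\to\mathrm{End}(\mathsf P^{\otimes r})$. For $\lambda\vdash r$ let $e_\lambda\in k[S_r]$ be the Young idempotent of the row-ordered standard tableau of shape $\lambda$: $e_\lambda=\alpha_\lambda\cdot(\text{row symmetrizer})\cdot(\text{column antisymmetrizer})$ with $\alpha_\lambda$ the scalar making it idempotent (strands labelled $1,\dots,r$ from left to right, so the strands of row $s$ are the $s$-th consecutive block, of size $\lambda_s$); $\mathsf P^\lambda$ is its image in $\mathsf P^{\otimes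 r}$. Symmetrizers are normalized to be idempotent. $\lambda(s^+)$ denotes the result of adding a box at the end of row $s$ of $\lambda$ (with $\lambda_{k+1}=0$, $1\le s\le k+1$), and $\mu=\lambda+\square$ means that $\mu$ is obtained from $\lambda$ by adding one box. *)

theory Defs
  imports
    "HOL-Combinatorics.Permutations"
    "HOL-Library.Poly_Mapping"
    "Jordan_Normal_Form.Matrix"
begin

section \<open>Planar string diagrams\<close>

text \<open>
  A diagram in generic position is a bottom-to-top sequence of slices, each containing exactly one
  generator with vertical strands on both sides. Planar isotopy is imposed below as the strict
  pivotal relations: height exchange of distant pieces, the four zigzags, and
  invariance of the crossing under full rotation.
\<close>

datatype sign = Up | Down

type_synonym word = "sign list"

text \<open>The names of cups and caps list the orientations of their two ends from left to right.\<close>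

datatype gen = Cross | CupUD | CupDU | CapUD | CapDU

fun gdom :: "gen \<Rightarrow> word" where
  "gdom Cross = [Up, Up]"
| "gdom CupUD = []"
| "gdom CupDU = []"
| "gdom CapUD = [Up, Down]"
| "gdom CapDU = [Down, Up]"

fun gcod :: "gen \<Rightarrow> word" where
  "gcod Cross = [Up, Up]"
| "gcod CupUD = [Up, Down]"
| "gcod CupDU = [Down, Up]"
| "gcod CapUD = []"
| "gcod CapDU = []"

type_synonym slice = "word \<times> gen \<times> word"

fun sdom :: "slice \<Rightarrow> word" where "sdom (u, g, v) = u @ gdom g @ v"
fun scod :: "slice \<Rightarrow> word" where "scod (u, g, v) = u @ gcod g @ v"

fun is_path :: "word \<Rightarrow> slice list \<Rightarrow> bool" where
  "is_path a [] \<longleftrightarrow> True"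
| "is_path a (l # ls) \<longleftrightarrow> sdom l = a \<and> is_path (scod l) ls"

fun path_end :: "word \<Rightarrow> slice list \<Rightarrow> word" where
  "path_end a [] = a"
| "path_end a (l # ls) = path_end (scod l) ls"

fun widen :: "word \<Rightarrow> word \<Rightarrow> slice \<Rightarrow> slice" where
  "widen p q (u, g, v) = (p @ u, g, v @ q)"

lemma sdom_widen [simp]: "sdom (widen p q l) = p @ sdom l @ q"
  by (cases l) simp

lemma scod_widen [simp]: "scod (widen p q l) = p @ scod l @ q"
  by (cases l) simp

lemma is_path_append [simp]:
  "is_path a (ls @ ls') \<longleftrightarrow> is_path a ls \<and> is_path (path_end a ls) ls'"
  by (induction ls arbitrary: a) auto

lemma path_end_append [simp]: "path_end a (ls @ ls') = path_end (path_end a ls) ls'"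
  by (induction ls arbitrary: a) auto

lemma is_path_widen [simp]:
  "is_path a ls \<Longrightarrow> is_path (p @ a @ q) (map (widen p q) ls)"
  by (induction ls arbitrary: a) auto

lemma path_end_widen [simp]:
  "path_end (p @ a @ q) (map (widen p q) ls) = p @ path_end a ls @ q"
  by (induction ls arbitrary: a) auto

lemmas widen_left = is_path_widen [where p = "[]", simplified] path_end_widen [where p = "[]", simplified]
lemmas widen_right = is_path_widen [where q = "[]", simplified] path_end_widen [where q = "[]", simplified]

typedef diagram = "{(a, ls). is_path a ls}"
  by (rule exI [of _ "([], [])"]) simp

setup_lifting type_definition_diagram

lift_definition ddom :: "diagram \<Rightarrow> word" is fst .
lift_definition dcod :: "diagram \<Rightarrow> word" is "\<lambda>(a, ls). path_end a ls" .

lift_definition did :: "word \<Rightarrow> diagram" is "\<lambda>a. (a, [])" by simp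
lift_definition dgen :: "gen \<Rightarrow> diagram" is "\<lambda>g. (gdom g, [([], g, [])])" by simp

text \<open>
  \<open>dcomp e d\<close> stacks \<open>e\<close> on top of \<open>d\<close>; its value is irrelevant unless the boundaries match.
\<close>

lift_definition dcomp :: "diagram \<Rightarrow> diagram \<Rightarrow> diagram" is
  "\<lambda>(b, ms) (a, ls). if path_end a ls = b then (a, ls @ ms) else (a, ls)"
  by (auto split: if_splits)

text \<open>
  Both put \<open>d\<close> to the left of \<open>e\<close>; the slices of \<open>d\<close> are the lower ones in \<open>dtens\<close> and
  the upper ones in \<open>dtens'\<close>.
\<close>

lift_definition dtens :: "diagram \<Rightarrow> diagram \<Rightarrow> diagram" is
  "\<lambda>(a, ls) (b, ms). (a @ b, map (widen [] b) ls @ map (widen (path_end a ls) []) ms)"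
  by (auto simp: widen_left widen_right)

lift_definition dtens' :: "diagram \<Rightarrow> diagram \<Rightarrow> diagram" is
  "\<lambda>(a, ls) (b, ms). (a @ b, map (widen a []) ms @ map (widen [] (path_end b ms)) ls)"
  by (auto simp: widen_left widen_right)

lemma ddom_dcomp: "dcod d = ddom e \<Longrightarrow> ddom (dcomp e d) = ddom d"
  by transfer auto

lemma dcod_dcomp: "dcod d = ddom e \<Longrightarrow> dcod (dcomp e d) = dcod e"
  by transfer auto

lemma dcomp_assoc:
  "dcod d = ddom e \<Longrightarrow> dcod e = ddom f \<Longrightarrow> dcomp (dcomp f e) d = dcomp f (dcomp e d)"
  by transfer auto

section \<open>Linear combinations of diagrams\<close>

type_synonym 'k lincomb = "diagram \<Rightarrow>\<^sub>0 'k"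

definition vscale :: "'k::field \<Rightarrow> 'k lincomb \<Rightarrow> 'k lincomb" where
  "vscale c x = Poly_Mapping.map ((*) c) x"

definition bilin ::
  "(diagram \<Rightarrow> diagram \<Rightarrow> 'k lincomb) \<Rightarrow> 'k::field lincomb \<Rightarrow> 'k lincomb \<Rightarrow> 'k lincomb" where
  "bilin b x y =
     (\<Sum>d\<in>Poly_Mapping.keys x. \<Sum>e\<in>Poly_Mapping.keys y. vscale (Poly_Mapping.lookup x d * Poly_Mapping.lookup y e) (b d e))"

text \<open>
  All hom-spaces are collected in one space, as in the algebra of a category: composites of
  diagrams whose boundaries do not match are zero.
\<close>

definition vcomp :: "'k::field lincomb \<Rightarrow> 'k lincomb \<Rightarrow> 'k lincomb" (infixr \<open>\<boxdot>\<close> 70) where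
  "vcomp = bilin (\<lambda>e d. if dcod d = ddom e then Poly_Mapping.single (dcomp e d) 1 else 0)"

definition vtens :: "'k::field lincomb \<Rightarrow> 'k lincomb \<Rightarrow> 'k lincomb" (infixr \<open>\<boxtimes>\<close> 75) where
  "vtens = bilin (\<lambda>d e. Poly_Mapping.single (dtens d e) 1)"

definition vdiag :: "diagram \<Rightarrow> 'k::field lincomb" where
  "vdiag d = Poly_Mapping.single d 1"

abbreviation vid :: "word \<Rightarrow> 'k::field lincomb" where "vid a \<equiv> vdiag (did a)"
abbreviation vgen :: "gen \<Rightarrow> 'k::field lincomb" where "vgen g \<equiv> vdiag (dgen g)"

lemma lookup_vscale: "Poly_Mapping.lookup (vscale c x) d = c * Poly_Mapping.lookup x d"
  unfolding vscale_def by transfer (simp add: when_def)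

lemma vscale_add_right: "vscale c (x + y) = vscale c x + vscale c y"
  by (rule poly_mapping_eqI) (simp add: lookup_vscale lookup_add algebra_simps)

lemma vscale_add_left: "vscale (c + c') x = vscale c x + vscale c' x"
  by (rule poly_mapping_eqI) (simp add: lookup_vscale lookup_add algebra_simps)

lemma vscale_0 [simp]: "vscale 0 x = 0" "vscale c 0 = 0"
  by (rule poly_mapping_eqI, simp add: lookup_vscale)+

lemma vscale_vscale: "vscale c (vscale c' x) = vscale (c * c') x"
  by (rule poly_mapping_eqI) (simp add: lookup_vscale algebra_simps)

lemma vscale_diff_right: "vscale c (x - y) = vscale c x - vscale c y"
  by (rule poly_mapping_eqI) (simp add: lookup_vscale lookup_minus algebra_simps)

lemma bilin_superset:
  assumes "finite A" "Poly_Mapping.keys x \<subseteq> A" "finite B" "Poly_Mapping.keys y \<subseteq> B"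
  shows "bilin b x y = (\<Sum>d\<in>A. \<Sum>e\<in>B. vscale (Poly_Mapping.lookup x d * Poly_Mapping.lookup y e) (b d e))"
proof -
  have "(\<Sum>e\<in>Poly_Mapping.keys y. vscale (Poly_Mapping.lookup x d * Poly_Mapping.lookup y e) (b d e)) =
        (\<Sum>e\<in>B. vscale (Poly_Mapping.lookup x d * Poly_Mapping.lookup y e) (b d e))" for d
    by (rule sum.mono_neutral_left) (use assms in \<open>auto simp: in_keys_iff\<close>)
  moreover have "(\<Sum>d\<in>Poly_Mapping.keys x. \<Sum>e\<in>B. vscale (Poly_Mapping.lookup x d * Poly_Mapping.lookup y e) (b d e)) =
        (\<Sum>d\<in>A. \<Sum>e\<in>B. vscale (Poly_Mapping.lookup x d * Poly_Mapping.lookup y e) (b d e))"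
    by (rule sum.mono_neutral_left) (use assms in \<open>auto simp: in_keys_iff\<close>)
  ultimately show ?thesis by (simp add: bilin_def)
qed

lemma bilin_add_left: "bilin b (x + x') y = bilin b x y + bilin b x' y"
proof -
  let ?A = "Poly_Mapping.keys x \<union> Poly_Mapping.keys x'"
  have k: "Poly_Mapping.keys (x + x') \<subseteq> ?A" by (rule keys_add)
  show ?thesis
    by (subst (1 2 3) bilin_superset [where A = ?A and B = "Poly_Mapping.keys y"])
       (use k in \<open>auto simp: lookup_add algebra_simps vscale_add_left sum.distrib\<close>)
qed

lemma bilin_add_right: "bilin b x (y + y') = bilin b x y + bilin b x y'"
proof -
  let ?B = "Poly_Mapping.keys y \<union> Poly_Mapping.keys y'"
  have k: "Poly_Mapping.keys (y + y') \<subseteq> ?B" by (rule keys_add)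
  show ?thesis
    by (subst (1 2 3) bilin_superset [where A = "Poly_Mapping.keys x" and B = ?B])
       (use k in \<open>auto simp: lookup_add algebra_simps vscale_add_left sum.distrib\<close>)
qed

lemma bilin_single:
  "bilin b (Poly_Mapping.single d c) (Poly_Mapping.single e c') = vscale (c * c') (b d e)"
  by (subst bilin_superset [where A = "{d}" and B = "{e}"]) auto

lemma bilin_0 [simp]: "bilin b 0 y = 0" "bilin b x 0 = 0"
  by (simp_all add: bilin_def)

lemma bilin_diff_left: "bilin b (x - x') y = bilin b x y - bilin b x' y"
  using bilin_add_left [of b "x - x'" x' y] by (simp add: algebra_simps)

lemma bilin_diff_right: "bilin b x (y - y') = bilin b x y - bilin b x y'"
  using bilin_add_right [of b x "y - y'" y'] by (simp add: algebra_simps)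

lemma lincomb_eq_sum:
  fixes x :: "'k::field lincomb"
  shows "x = (\<Sum>d\<in>Poly_Mapping.keys x. Poly_Mapping.single d (Poly_Mapping.lookup x d))"
  by (rule poly_mapping_eqI)
     (auto simp: lookup_sum lookup_single when_def in_keys_iff)

lemma lincomb_induct [case_names zero single add]:
  fixes x :: "'k::field lincomb"
  assumes z: "P 0" and s: "\<And>d c. P (Poly_Mapping.single d c)"
    and a: "\<And>x y. P x \<Longrightarrow> P y \<Longrightarrow> P (x + y)"
  shows "P x"
proof -
  have "finite A \<Longrightarrow> P (\<Sum>d\<in>A. Poly_Mapping.single d (Poly_Mapping.lookup x d))" for A
    by (induction A rule: finite_induct) (use z s a in auto)
  from this [OF finite_keys [of x]] show ?thesis
    by (subst lincomb_eq_sum)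
qed

lemma vscale_single: "vscale c (Poly_Mapping.single d c') = Poly_Mapping.single d (c * c')"
  by (rule poly_mapping_eqI) (simp add: lookup_vscale lookup_single when_def)

lemma vcomp_single:
  "Poly_Mapping.single e c \<boxdot> Poly_Mapping.single d c' =
     (if dcod d = ddom e then Poly_Mapping.single (dcomp e d) (c * c') else 0)"
  by (simp add: vcomp_def bilin_single vscale_single)

lemma vcomp_add: "(x + x') \<boxdot> y = x \<boxdot> y + x' \<boxdot> y" "x \<boxdot> (y + y') = x \<boxdot> y + x \<boxdot> y'"
  by (simp_all add: vcomp_def bilin_add_left bilin_add_right)

lemma vcomp_diff: "(x - x') \<boxdot> y = x \<boxdot> y - x' \<boxdot> y" "x \<boxdot> (y - y') = x \<boxdot> y - x \<boxdot> y'"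
  by (simp_all add: vcomp_def bilin_diff_left bilin_diff_right)

lemma vcomp_0 [simp]: "0 \<boxdot> y = 0" "x \<boxdot> 0 = 0"
  by (simp_all add: vcomp_def)

lemma vtens_diff: "(x - x') \<boxtimes> y = x \<boxtimes> y - x' \<boxtimes> y" "x \<boxtimes> (y - y') = x \<boxtimes> y - x \<boxtimes> y'"
  by (simp_all add: vtens_def bilin_diff_left bilin_diff_right)

lemma vcomp_assoc: "(x \<boxdot> y) \<boxdot> z = x \<boxdot> (y \<boxdot> z)"
proof (induction x rule: lincomb_induct)
  case x: (single f c)
  show ?case
  proof (induction y rule: lincomb_induct)
    case y: (single e c')
    show ?case
    proof (induction z rule: lincomb_induct)
      case z: (single d c'')
      show ?case
        by (auto simp: vcomp_single ddom_dcomp dcod_dcomp dcomp_assoc mult.assoc)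
    qed (simp_all add: vcomp_add)
  qed (simp_all add: vcomp_add)
qed (simp_all add: vcomp_add)

section \<open>The relations of the Heisenberg category\<close>

text \<open>Sideways crossings are rotations of the upward crossing.\<close>

definition right_cross :: "'k::field lincomb" where
  "right_cross =
     (vid [Down, Up] \<boxtimes> vgen CapUD) \<boxdot> (vid [Down] \<boxtimes> vgen Cross \<boxtimes> vid [Down])
       \<boxdot> (vgen CupDU \<boxtimes> vid [Up, Down])"

definition left_cross :: "'k::field lincomb" where
  "left_cross =
     (vgen CapDU \<boxtimes> vid [Up, Down]) \<boxdot> (vid [Down] \<boxtimes> vgen Cross \<boxtimes> vid [Down])
       \<boxdot> (vid [Down, Up] \<boxtimes> vgen CupUD)"

inductive heis_rel :: "'k::field lincomb \<Rightarrow> 'k lincomb \<Rightarrow> bool" where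
  exchange: "heis_rel (vdiag (dtens d e)) (vdiag (dtens' d e))"
| zigzag1: "heis_rel ((vgen CapUD \<boxtimes> vid [Up]) \<boxdot> (vid [Up] \<boxtimes> vgen CupDU)) (vid [Up])"
| zigzag2: "heis_rel ((vid [Up] \<boxtimes> vgen CapDU) \<boxdot> (vgen CupUD \<boxtimes> vid [Up])) (vid [Up])"
| zigzag3: "heis_rel ((vid [Down] \<boxtimes> vgen CapUD) \<boxdot> (vgen CupDU \<boxtimes> vid [Down])) (vid [Down])"
| zigzag4: "heis_rel ((vgen CapDU \<boxtimes> vid [Down]) \<boxdot> (vid [Down] \<boxtimes> vgen CupUD)) (vid [Down])"
| rotation: "heis_rel
    (((vgen CapDU \<boxdot> (vid [Down] \<boxtimes> vgen CapDU \<boxtimes> vid [Up])) \<boxtimes> vid [Down, Down])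
      \<boxdot> (vid [Down, Down] \<boxtimes> vgen Cross \<boxtimes> vid [Down, Down])
      \<boxdot> (vid [Down, Down] \<boxtimes> ((vid [Up] \<boxtimes> vgen CupUD \<boxtimes> vid [Down]) \<boxdot> vgen CupUD)))
    ((vid [Down, Down] \<boxtimes> (vgen CapUD \<boxdot> (vid [Up] \<boxtimes> vgen CapUD \<boxtimes> vid [Down])))
      \<boxdot> (vid [Down, Down] \<boxtimes> vgen Cross \<boxtimes> vid [Down, Down])
      \<boxdot> (((vid [Down] \<boxtimes> vgen CupDU \<boxtimes> vid [Up]) \<boxdot> vgen CupDU) \<boxtimes> vid [Down, Down]))"
| involution: "heis_rel (vgen Cross \<boxdot> vgen Cross) (vid [Up, Up])"
| braid: "heis_rel
    ((vgen Cross \<boxtimes> vid [Up]) \<boxdot> (vid [Up] \<boxtimes> vgen Cross) \<boxdot> (vgen Cross \<boxtimes> vid [Up]))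
    ((vid [Up] \<boxtimes> vgen Cross) \<boxdot> (vgen Cross \<boxtimes> vid [Up]) \<boxdot> (vid [Up] \<boxtimes> vgen Cross))"
| double_UD: "heis_rel (left_cross \<boxdot> right_cross) (vid [Up, Down])"
| double_DU: "heis_rel (right_cross \<boxdot> left_cross) (vid [Down, Up] - vgen CupDU \<boxdot> vgen CapDU)"
| circle: "heis_rel (vgen CapDU \<boxdot> vgen CupDU) (vid [])"
| curl: "heis_rel
    ((vgen CapDU \<boxtimes> vid [Up]) \<boxdot> (vid [Down] \<boxtimes> vgen Cross) \<boxdot> (vgen CupDU \<boxtimes> vid [Up])) 0"

text \<open>The tensor ideal generated by the relations.\<close>

inductive_set heis_ideal :: "'k::field lincomb set" where
  rel: "heis_rel x y \<Longrightarrow> x - y \<in> heis_ideal"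
| zero: "0 \<in> heis_ideal"
| add: "x \<in> heis_ideal \<Longrightarrow> y \<in> heis_ideal \<Longrightarrow> x + y \<in> heis_ideal"
| scale: "x \<in> heis_ideal \<Longrightarrow> vscale c x \<in> heis_ideal"
| comp_left: "x \<in> heis_ideal \<Longrightarrow> y \<boxdot> x \<in> heis_ideal"
| comp_right: "x \<in> heis_ideal \<Longrightarrow> x \<boxdot> y \<in> heis_ideal"
| tens_left: "x \<in> heis_ideal \<Longrightarrow> y \<boxtimes> x \<in> heis_ideal"
| tens_right: "x \<in> heis_ideal \<Longrightarrow> x \<boxtimes> y \<in> heis_ideal"

lemma heis_ideal_uminus: "x \<in> heis_ideal \<Longrightarrow> - x \<in> heis_ideal"
proof -
  assume "x \<in> heis_ideal"
  then have "vscale (- 1) x \<in> heis_ideal" by (rule heis_ideal.scale)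
  moreover have "vscale (- 1) x = - x"
    by (rule poly_mapping_eqI) (simp add: lookup_vscale)
  ultimately show ?thesis by simp
qed

definition heis_eq :: "'k::field lincomb \<Rightarrow> 'k lincomb \<Rightarrow> bool" where
  "heis_eq x y \<longleftrightarrow> x - y \<in> heis_ideal"

lemma equivp_heis_eq: "equivp heis_eq"
proof (rule equivpI)
  show "reflp heis_eq"
    by (auto intro!: reflpI simp: heis_eq_def heis_ideal.zero)
  show "symp heis_eq"
    by (rule sympI) (use heis_ideal_uminus in \<open>force simp: heis_eq_def\<close>)
  show "transp heis_eq"
    by (rule transpI) (use heis_ideal.add in \<open>force simp: heis_eq_def\<close>)
qed

quotient_type (overloaded) 'k hmor = "'k::field lincomb" / heis_eq
  by (rule equivp_heis_eq)

text \<open>Multiplication in \<open>hmor\<close> is composition, \<open>g * f\<close> being \<open>g\<close> after \<open>f\<close>.\<close>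

instantiation hmor :: (field) ring
begin

lift_definition zero_hmor :: "'a hmor" is 0 .

lift_definition plus_hmor :: "'a hmor \<Rightarrow> 'a hmor \<Rightarrow> 'a hmor" is "(+)"
  by (metis (no_types, lifting) add_diff_add heis_eq_def heis_ideal.add)

lift_definition uminus_hmor :: "'a hmor \<Rightarrow> 'a hmor" is uminus
  by (metis heis_eq_def heis_ideal_uminus minus_diff_minus)

lift_definition minus_hmor :: "'a hmor \<Rightarrow> 'a hmor \<Rightarrow> 'a hmor" is "(-)"
proof -
  fix x x' y y' :: "'a lincomb"
  assume "heis_eq x x'" "heis_eq y y'"
  then have "(x - x') + - (y - y') \<in> heis_ideal"
    unfolding heis_eq_def by (intro heis_ideal.add heis_ideal_uminus)
  then show "heis_eq (x - y) (x' - y')"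
    by (simp add: heis_eq_def algebra_simps)
qed

lift_definition times_hmor :: "'a hmor \<Rightarrow> 'a hmor \<Rightarrow> 'a hmor" is vcomp
proof -
  fix x x' y y' :: "'a lincomb"
  assume "heis_eq x x'" "heis_eq y y'"
  then have "(x - x') \<boxdot> y + x' \<boxdot> (y - y') \<in> heis_ideal"
    unfolding heis_eq_def
    by (intro heis_ideal.add heis_ideal.comp_left heis_ideal.comp_right)
  then show "heis_eq (x \<boxdot> y) (x' \<boxdot> y')"
    by (simp add: heis_eq_def vcomp_diff)
qed

instance
proof
  fix a b c :: "'a hmor"
  have refl: "heis_eq x x" for x :: "'a lincomb"
    by (simp add: heis_eq_def heis_ideal.zero)
  show "a + b + c = a + (b + c)" by transfer (simp add: add.assoc refl)
  show "a + b = b + a" by transfer (simp add: add.commute refl)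
  show "0 + a = a" by transfer (simp add: refl)
  show "- a + a = 0" by transfer (simp add: refl)
  show "a - b = a + - b" by transfer (simp add: refl)
  show "a * b * c = a * (b * c)" by transfer (simp add: vcomp_assoc refl)
  show "(a + b) * c = a * c + b * c" by transfer (simp add: vcomp_add refl)
  show "a * (b + c) = a * b + a * c" by transfer (simp add: vcomp_add refl)
qed

end

lift_definition hscale :: "'k::field \<Rightarrow> 'k hmor \<Rightarrow> 'k hmor" is vscale
  by (metis heis_eq_def heis_ideal.scale vscale_diff_right)

lift_definition htens :: "'k::field hmor \<Rightarrow> 'k hmor \<Rightarrow> 'k hmor" is vtens
proof -
  fix x x' y y' :: "'k lincomb"
  assume "heis_eq x x'" "heis_eq y y'"
  then have "(x - x') \<boxtimes> y + x' \<boxtimes> (y - y') \<in> heis_ideal"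
    unfolding heis_eq_def
    by (intro heis_ideal.add heis_ideal.tens_left heis_ideal.tens_right)
  then show "heis_eq (x \<boxtimes> y) (x' \<boxtimes> y')"
    by (simp add: heis_eq_def vtens_diff)
qed

lift_definition hdiag :: "diagram \<Rightarrow> 'k::field hmor" is vdiag .

text \<open>
  The zero morphisms of all hom-spaces are identified; otherwise the source and target of a
  morphism are determined by it, since the relations are homogeneous.
\<close>

definition hom_set :: "word \<Rightarrow> word \<Rightarrow> 'k::field hmor set" where
  "hom_set a b = abs_hmor ` {x. \<forall>d\<in>Poly_Mapping.keys x. ddom d = a \<and> dcod d = b}"

section \<open>The additive category H'\<close>

text \<open>
  Objects of H' are finite formal direct sums of words. A morphism from \<open>X\<close> to \<open>Y\<close>
  is a matrix with rows indexed by the summands of \<open>Y\<close> and columns by those of \<open>X\<close>, and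
  composition is matrix multiplication.
\<close>

type_synonym obj = "word list"

definition Hom :: "obj \<Rightarrow> obj \<Rightarrow> 'k::field hmor mat set" where
  "Hom X Y = {M \<in> carrier_mat (length Y) (length X).
     \<forall>j<length Y. \<forall>i<length X. M $$ (j, i) \<in> hom_set (X ! i) (Y ! j)}"

definition Idm :: "obj \<Rightarrow> 'k::field hmor mat" where
  "Idm X = mat (length X) (length X) (\<lambda>(j, i). if j = i then hdiag (did (X ! i)) else 0)"

definition tens_obj :: "obj \<Rightarrow> obj \<Rightarrow> obj" where
  "tens_obj X Y = [x @ y. x \<leftarrow> X, y \<leftarrow> Y]"

definition tens_mor :: "'k::field hmor mat \<Rightarrow> 'k hmor mat \<Rightarrow> 'k hmor mat" where
  "tens_mor M N = mat (dim_row M * dim_row N) (dim_col M * dim_col N)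
     (\<lambda>(j, i). htens (M $$ (j div dim_row N, i div dim_col N))
                     (N $$ (j mod dim_row N, i mod dim_col N)))"

definition sum_mor :: "obj \<Rightarrow> obj \<Rightarrow> ('i \<Rightarrow> 'k::field hmor mat) \<Rightarrow> 'i set \<Rightarrow> 'k hmor mat" where
  "sum_mor X Y f S = mat (length Y) (length X) (\<lambda>ji. \<Sum>s\<in>S. f s $$ ji)"

section \<open>The Karoubi envelope H\<close>

type_synonym 'k kobj = "obj \<times> 'k hmor mat"

definition is_kobj :: "'k::field kobj \<Rightarrow> bool" where
  "is_kobj A \<longleftrightarrow> snd A \<in> Hom (fst A) (fst A) \<and> snd A * snd A = snd A"

definition KHom :: "'k::field kobj \<Rightarrow> 'k kobj \<Rightarrow> 'k hmor mat set" where
  "KHom A B = {g \<in> Hom (fst A) (fst B). snd B * g = g \<and> g * snd A = g}"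

definition KId :: "'k::field kobj \<Rightarrow> 'k hmor mat" where
  "KId A = snd A"

definition Kzero :: "'k::field kobj \<Rightarrow> 'k kobj \<Rightarrow> 'k hmor mat" where
  "Kzero A B = 0\<^sub>m (length (fst B)) (length (fst A))"

definition Ksum :: "'k::field kobj \<Rightarrow> 'k kobj \<Rightarrow> ('i \<Rightarrow> 'k hmor mat) \<Rightarrow> 'i set \<Rightarrow> 'k hmor mat" where
  "Ksum A B f S = sum_mor (fst A) (fst B) f S"

definition Kincl :: "obj \<Rightarrow> 'k::field kobj" where
  "Kincl X = (X, Idm X)"

definition Ktens :: "'k::field kobj \<Rightarrow> 'k kobj \<Rightarrow> 'k kobj" where
  "Ktens A B = (tens_obj (fst A) (fst B), tens_mor (snd A) (snd B))"

definition Kdsum :: "'k::field kobj list \<Rightarrow> 'k kobj" where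
  "Kdsum As = (concat (map fst As), diag_block_mat (map snd As))"

definition Kiso :: "'k::field kobj \<Rightarrow> 'k kobj \<Rightarrow> bool" where
  "Kiso A B \<longleftrightarrow> is_kobj A \<and> is_kobj B \<and>
     (\<exists>f\<in>KHom A B. \<exists>g\<in>KHom B A. g * f = KId A \<and> f * g = KId B)"

section \<open>The group algebra of the symmetric group and its action on strands\<close>

text \<open>Elements of \<open>k[S\<^sub>r]\<close> are functions vanishing outside the permutations of \<open>{1..r}\<close>.
  Inverses are written with \<open>inv_into UNIV\<close> since HOL-Algebra occupies \<open>inv\<close>.\<close>

type_synonym 'k galg = "(nat \<Rightarrow> nat) \<Rightarrow> 'k"

definition galg_mult :: "nat \<Rightarrow> 'k::field galg \<Rightarrow> 'k galg \<Rightarrow> 'k galg" where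
  "galg_mult r x y = (\<lambda>\<sigma>. if \<sigma> permutes {1..r}
     then \<Sum>\<tau> | \<tau> permutes {1..r}. x \<tau> * y (inv_into UNIV \<tau> \<circ> \<sigma>) else 0)"

definition galg_scale :: "'k::field \<Rightarrow> 'k galg \<Rightarrow> 'k galg" where
  "galg_scale c x = (\<lambda>\<sigma>. c * x \<sigma>)"

definition symmetrizer :: "(nat \<Rightarrow> nat) set \<Rightarrow> 'k::field galg" where
  "symmetrizer G = (\<lambda>\<sigma>. if \<sigma> \<in> G then 1 / of_nat (card G) else 0)"

definition antisymmetrizer :: "(nat \<Rightarrow> nat) set \<Rightarrow> 'k::field galg" where
  "antisymmetrizer G = (\<lambda>\<sigma>. if \<sigma> \<in> G then of_int (sign \<sigma>) / of_nat (card G) else 0)"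

text \<open>
  The crossing of strands \<open>i\<close> and \<open>i + 1\<close> represents the transposition \<open>(i i+1)\<close>. A list
  \<open>ws\<close> of such crossings, read from bottom to top, connects the bottom point \<open>i\<close> to the top
  point \<open>word_perm ws i\<close>.
\<close>

definition word_perm :: "nat list \<Rightarrow> nat \<Rightarrow> nat" where
  "word_perm ws = fold (\<lambda>i \<sigma>. transpose i (i + 1) \<circ> \<sigma>) ws id"

definition cross_slice :: "nat \<Rightarrow> nat \<Rightarrow> slice" where
  "cross_slice r i = (replicate (i - 1) Up, Cross, replicate (r - i - 1) Up)"

definition word_diag :: "nat \<Rightarrow> nat list \<Rightarrow> diagram" where
  "word_diag r ws = Abs_diagram (replicate r Up, map (cross_slice r) ws)"

text \<open>
  By the involution and braid relations the choice of the word does not matter in \<open>hmor\<close>.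
\<close>

definition perm_diag :: "nat \<Rightarrow> (nat \<Rightarrow> nat) \<Rightarrow> diagram" where
  "perm_diag r \<sigma> = word_diag r (SOME ws. set ws \<subseteq> {1..<r} \<and> word_perm ws = \<sigma>)"

definition galg_map :: "nat \<Rightarrow> 'k::field galg \<Rightarrow> 'k hmor" where
  "galg_map r x = (\<Sum>\<sigma> | \<sigma> permutes {1..r}. hscale (x \<sigma>) (hdiag (perm_diag r \<sigma>)))"

definition Upow :: "nat \<Rightarrow> obj" where
  "Upow r = [replicate r Up]"

definition mor1 :: "'k::field hmor \<Rightarrow> 'k hmor mat" where
  "mor1 f = mat 1 1 (\<lambda>_. f)"

definition galg_mor :: "nat \<Rightarrow> 'k::field galg \<Rightarrow> 'k hmor mat" where
  "galg_mor r x = mor1 (galg_map r x)"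

definition perm_mor :: "nat \<Rightarrow> (nat \<Rightarrow> nat) \<Rightarrow> 'k::field hmor mat" where
  "perm_mor r \<sigma> = mor1 (hdiag (perm_diag r \<sigma>))"

section \<open>Partitions and Young idempotents\<close>

definition is_partition :: "nat list \<Rightarrow> nat \<Rightarrow> bool" where
  "is_partition lam r \<longleftrightarrow> sorted_wrt (\<ge>) lam \<and> 0 \<notin> set lam \<and> sum_list lam = r"

text \<open>Rows are numbered from 1; parts beyond the length are zero.\<close>

definition part :: "nat list \<Rightarrow> nat \<Rightarrow> nat" where
  "part lam s = (if 1 \<le> s \<and> s \<le> length lam then lam ! (s - 1) else 0)"

definition offset :: "nat list \<Rightarrow> nat \<Rightarrow> nat" where
  "offset lam s = (\<Sum>i = 1..<s. part lam i)"

definition row_strands :: "nat list \<Rightarrow> nat \<Rightarrow> nat set" where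
  "row_strands lam s = {offset lam s + c | c. 1 \<le> c \<and> c \<le> part lam s}"

definition col_strands :: "nat list \<Rightarrow> nat \<Rightarrow> nat set" where
  "col_strands lam c = {offset lam s + c | s. 1 \<le> s \<and> 1 \<le> c \<and> c \<le> part lam s}"

definition row_group :: "nat list \<Rightarrow> (nat \<Rightarrow> nat) set" where
  "row_group lam = {\<sigma>. \<sigma> permutes {1..sum_list lam} \<and>
     (\<forall>s\<ge>1. \<sigma> ` row_strands lam s = row_strands lam s)}"

definition col_group :: "nat list \<Rightarrow> (nat \<Rightarrow> nat) set" where
  "col_group lam = {\<sigma>. \<sigma> permutes {1..sum_list lam} \<and>
     (\<forall>c\<ge>1. \<sigma> ` col_strands lam c = col_strands lam c)}"

definition young_product :: "nat list \<Rightarrow> 'k::field galg" where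
  "young_product lam = galg_mult (sum_list lam)
     (symmetrizer (row_group lam)) (antisymmetrizer (col_group lam))"

text \<open>The condition \<open>c \<noteq> 0\<close> excludes the trivial idempotent.\<close>

definition young_scalar :: "nat list \<Rightarrow> 'k::field" where
  "young_scalar lam = (THE c. c \<noteq> 0 \<and>
     (let e = galg_scale c (young_product lam) in galg_mult (sum_list lam) e e = e))"

definition young_idem :: "nat list \<Rightarrow> 'k::field galg" where
  "young_idem lam = galg_scale (young_scalar lam) (young_product lam)"

definition young_mor :: "nat list \<Rightarrow> 'k::field hmor mat" where
  "young_mor lam = galg_mor (sum_list lam) (young_idem lam)"

definition schur_obj :: "nat list \<Rightarrow> 'k::field kobj" where
  "schur_obj lam = (Upow (sum_list lam), young_mor lam)"

definition row_sym :: "nat list \<Rightarrow> nat \<Rightarrow> 'k::field hmor mat" where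
  "row_sym lam s = galg_mor (sum_list lam) (symmetrizer {\<sigma>. \<sigma> permutes row_strands lam s})"

section \<open>Adding a box\<close>

definition add_box :: "nat list \<Rightarrow> nat \<Rightarrow> nat list" where
  "add_box lam s = (if s \<le> length lam then lam[s - 1 := lam ! (s - 1) + 1] else lam @ [1])"

definition addable :: "nat list \<Rightarrow> nat set" where
  "addable lam = {s. 1 \<le> s \<and> s \<le> length lam + 1 \<and>
     is_partition (add_box lam s) (sum_list lam + 1)}"

definition covers :: "nat list \<Rightarrow> nat list set" where
  "covers lam = {add_box lam s | s. s \<in> addable lam}"

definition w_perm :: "nat list \<Rightarrow> nat \<Rightarrow> nat \<Rightarrow> nat" where
  "w_perm lam s = (let p = offset lam s + part lam s + 1; n = sum_list lam + 1 in
     (\<lambda>i. if i = p then n else if p < i \<and> i \<le> n then i - 1 else i))"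

definition P_tens_P :: "nat list \<Rightarrow> 'k::field kobj" where
  "P_tens_P lam = Ktens (schur_obj lam) (Kincl (Upow 1))"

definition iota :: "nat list \<Rightarrow> nat \<Rightarrow> 'k::field hmor mat" where
  "iota lam s = tens_mor (young_mor lam) (Idm (Upow 1)) * perm_mor (sum_list lam + 1) (w_perm lam s)
     * row_sym (add_box lam s) s * young_mor (add_box lam s)"

definition rho :: "nat list \<Rightarrow> nat \<Rightarrow> 'k::field hmor mat" where
  "rho lam s = young_mor (add_box lam s) * perm_mor (sum_list lam + 1) (inv_into UNIV (w_perm lam s))
     * tens_mor (row_sym lam s * young_mor lam) (Idm (Upow 1))"

end

theory Submission
  imports Defs
begin

text \<open>
  Crossings act through \<open>k[S\<^sub>n]\<close>, so the claim is the branching rule in explicit form. The row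
  symmetrizers are absorbed by the Young idempotents, which leaves \<open>\<iota> = e\<^sub>\<lambda> w e\<^sub>\<mu>\<close> and
  \<open>\<rho> = e\<^sub>\<mu> w\<inverse> e\<^sub>\<lambda>\<close>. By the dominance argument \<open>e\<^sub>\<mu> x e\<^sub>\<nu> = 0\<close> for \<open>\<mu> \<noteq> \<nu>\<close>, and
  \<open>e\<^sub>\<mu> x e\<^sub>\<mu>\<close> is the multiple of \<open>e\<^sub>\<mu>\<close> determined by the trace \<open>x \<mapsto> x(1)\<close>. The coefficients of
  \<open>e\<^sub>\<mu>\<close> on \<open>w\<inverse> S\<^sub>n\<^sub>-\<^sub>1 w\<close> are proportional to those of \<open>w\<inverse> e\<^sub>\<lambda> w\<close>, which makes the multiple for
  \<open>\<rho> \<iota>\<close> equal to \<open>1\<close> without any knowledge of hook lengths.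

  For completeness, average the idempotents \<open>\<iota> \<rho>\<close> over conjugation by \<open>S\<^sub>n\<^sub>-\<^sub>1\<close>. This gives one
  element of the centralizer of \<open>S\<^sub>n\<^sub>-\<^sub>1\<close> in \<open>k[S\<^sub>n]\<close> for each pair of a partition of \<open>n - 1\<close>
  and an addable row, and these elements are linearly independent. There are at most as many
  \<open>S\<^sub>n\<^sub>-\<^sub>1\<close>-conjugacy classes in \<open>S\<^sub>n\<close> as such pairs, so the elements span the centralizer, and
  multiplying the resulting expression of \<open>1\<close> by \<open>e\<^sub>\<lambda>\<close> on both sides gives
  \<open>e\<^sub>\<lambda> = \<Sum> \<iota> \<rho>\<close>.
\<close>

section \<open>The group algebra of finitely supported permutations\<close>

text \<open>Every identity is proved in k[S_n] and pushed forward along the homomorphism from k[S_n]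
  to the endomorphisms of n upward strands; that this map depends only on the permutation rests on
  the involution, braid and height exchange relations. The obstacle is completeness. Orthogonality
  of the elements \<iota>\<rho> only shows that their sum is an idempotent below the Young
  idempotent of \<lambda>, and equality would usually come from counting standard tableaux. The
  centralizer of S_(n-1) offers a count with both sides visible: compressing by a Young idempotent
  isolates \<lambda>, multiplying by a single \<iota>\<rho> isolates the row, which gives
  independence; and the orbits under conjugation are recorded by a cycle type with one marked cycle,
  which gives the upper bound. The proportionality behind \<rho>\<iota> = 1 holds because a Young
  idempotent takes at pq, for p in the row group and q in the column group, the value sgn(q) times
  its value at 1, and vanishes elsewhere. Since k carries no order, the nonvanishing of the scalar
  in (ab)^2 = m ab is obtained over the rationals, where all coefficients lie.\<close>

text \<open>The group is written additively, so that convolution of finitely supported functions is the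
  multiplication of its group algebra.\<close>

typedef sperm = "{\<sigma> :: nat \<Rightarrow> nat. \<exists>r. \<sigma> permutes {1..r}}"
  morphisms pfun Perm
  by (rule exI [of _ id]) (auto intro: permutes_id)

setup_lifting type_definition_sperm

lemma permutes_interval_mono: "\<sigma> permutes {1..r} \<Longrightarrow> r \<le> r' \<Longrightarrow> \<sigma> permutes {1..r'}" for r r' :: nat
  by (erule permutes_subset) auto

lemma permutes_fix_last:
  assumes "\<sigma> permutes {1..Suc r}" "\<sigma> (Suc r) = Suc r"
  shows "\<sigma> permutes {1..r}"
proof -
  have "\<sigma> permutes ({1..Suc r} - {Suc r})"
    using assms(1) by (rule permutes_superset) (use assms(2) in \<open>metis DiffE DiffI insertI1 singletonD\<close>)
  moreover have "{1..Suc r} - {Suc r} = {1..r}" by auto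
  ultimately show ?thesis by simp
qed

instantiation sperm :: group_add
begin

lift_definition zero_sperm :: sperm is id
  by (auto intro: permutes_id)

lift_definition plus_sperm :: "sperm \<Rightarrow> sperm \<Rightarrow> sperm" is "(\<circ>)"
proof -
  fix \<sigma> \<tau> :: "nat \<Rightarrow> nat"
  assume "\<exists>r. \<sigma> permutes {1..r}" "\<exists>r. \<tau> permutes {1..r}"
  then obtain r s where "\<sigma> permutes {1..r}" "\<tau> permutes {1..s}" by auto
  then have "\<sigma> permutes {1..max r s}" "\<tau> permutes {1..max r s}"
    using permutes_interval_mono by (meson max.cobounded1 max.cobounded2)+
  then show "\<exists>r. \<sigma> \<circ> \<tau> permutes {1..r}"
    using permutes_compose by blast
qed

lift_definition uminus_sperm :: "sperm \<Rightarrow> sperm" is "inv_into UNIV"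
  using permutes_inv by blast

definition minus_sperm :: "sperm \<Rightarrow> sperm \<Rightarrow> sperm" where
  "minus_sperm g h = g + - h"

instance
proof
  fix a b c :: sperm
  show "a + b + c = a + (b + c)" by transfer (simp add: o_assoc)
  show "0 + a = a" by transfer simp
  show "a + 0 = a" by transfer simp
  show "- a + a = 0" by transfer (auto dest: permutes_inv_o)
  show "a + - b = a - b" by (simp add: minus_sperm_def)
qed

end

lemma pfun_zero [simp]: "pfun 0 = id"
  by transfer simp

lemma pfun_plus: "pfun (g + h) = pfun g \<circ> pfun h"
  by transfer simp

lemma pfun_uminus: "pfun (- g) = inv_into UNIV (pfun g)"
  by transfer simp

text \<open>All S_r sit in one group as the permutations supported on {1..r}, so the inclusion of
  S_(n-1) in S_n, and of their group algebras, is mere inclusion of supports.\<close>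

definition symg :: "nat \<Rightarrow> sperm set" where
  "symg r = {g. pfun g permutes {1..r}}"

lemma symg_iff: "pfun g permutes {1..r} \<longleftrightarrow> g \<in> symg r"
  by (simp add: symg_def)

lemma symg_closed [simp]:
  "0 \<in> symg r" "g \<in> symg r \<Longrightarrow> h \<in> symg r \<Longrightarrow> g + h \<in> symg r"
  "- g \<in> symg r \<longleftrightarrow> g \<in> symg r"
  "g \<in> symg r \<Longrightarrow> h \<in> symg r \<Longrightarrow> g - h \<in> symg r"
proof -
  have u: "- g \<in> symg r" if "g \<in> symg r" for g
    using that by (auto simp: symg_def pfun_uminus intro: permutes_inv)
  then show "- g \<in> symg r \<longleftrightarrow> g \<in> symg r" by force
  show p: "g + h \<in> symg r" if "g \<in> symg r" "h \<in> symg r" for g h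
    using that by (auto simp: symg_def pfun_plus intro: permutes_compose)
  show "g \<in> symg r \<Longrightarrow> h \<in> symg r \<Longrightarrow> g - h \<in> symg r"
    using u p by (metis add_uminus_conv_diff)
qed (simp add: symg_def permutes_id)

lemma symg_mono: "r \<le> r' \<Longrightarrow> symg r \<subseteq> symg r'"
  by (auto simp: symg_def simp del: One_nat_def intro: permutes_interval_mono)

lemma pfun_Perm: "\<sigma> permutes {1..r} \<Longrightarrow> pfun (Perm \<sigma>) = \<sigma>"
  by (rule Perm_inverse) auto

lemma Perm_in_symg: "\<sigma> permutes {1..r} \<Longrightarrow> Perm \<sigma> \<in> symg r"
  by (simp add: symg_def pfun_Perm)

lemma bij_betw_pfun_symg: "bij_betw pfun (symg r) {\<sigma>. \<sigma> permutes {1..r}}"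
  by (rule bij_betwI [where g = Perm]) (auto simp: symg_def pfun_Perm pfun_inverse)

lemma finite_symg [simp]: "finite (symg r)"
  using bij_betw_finite [OF bij_betw_pfun_symg] finite_permutations [of "{1..r}"] by auto

lemma sum_permutes_eq_symg: "(\<Sum>\<sigma> | \<sigma> permutes {1..r}. f \<sigma>) = (\<Sum>g\<in>symg r. f (pfun g))"
  by (rule sum.reindex_bij_betw [OF bij_betw_pfun_symg, symmetric])

lemma sum_symg_translate:
  assumes "h \<in> symg r"
  shows "(\<Sum>g\<in>symg r. f (h + g)) = (\<Sum>g\<in>symg r. f g)"
    "(\<Sum>g\<in>symg r. f (g + h)) = (\<Sum>g\<in>symg r. f g)"
  by (rule sum.reindex_bij_witness [where i = "\<lambda>g. - h + g" and j = "\<lambda>g. h + g"];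
      use assms in \<open>simp add: add.assoc [symmetric]\<close>)
     (rule sum.reindex_bij_witness [where i = "\<lambda>g. g - h" and j = "\<lambda>g. g + h"];
      use assms in \<open>simp add: add.assoc\<close>)

section \<open>Convolution over k and the trace at the identity\<close>

type_synonym 'k sga = "sperm \<Rightarrow>\<^sub>0 'k"

abbreviation coeff :: "'k::zero sga \<Rightarrow> sperm \<Rightarrow> 'k" where "coeff \<equiv> Poly_Mapping.lookup"
abbreviation supp :: "'k::zero sga \<Rightarrow> sperm set" where "supp \<equiv> Poly_Mapping.keys"
abbreviation perm_elt :: "sperm \<Rightarrow> 'k::field sga" where "perm_elt g \<equiv> Poly_Mapping.single g 1"

text \<open>Scalars act through the identity element, written \<open>0\<close>, so that the module
  laws become ring laws.\<close>

definition smul :: "'k::field \<Rightarrow> 'k sga \<Rightarrow> 'k sga" (infixr \<open>\<cdot>\<close> 75) where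
  "c \<cdot> x = Poly_Mapping.single 0 c * x"

lemma coeff_single_mult: "coeff (Poly_Mapping.single g c * x) h = c * coeff x (- g + h)"
  for x :: "'k::field sga"
proof -
  have *: "(h = g + q) \<longleftrightarrow> (q = - g + h)" for q
    by (metis add.assoc add_minus_cancel minus_add_cancel)
  have "coeff (Poly_Mapping.single g c * x) h =
      (\<Sum>l. (c * coeff x (- l + h)) when l = g)"
    unfolding lookup_mult
    by (rule Sum_any.cong) (auto simp: lookup_single * when_def)
  then show ?thesis by simp
qed

lemma sga_eq_sum:
  fixes x :: "'k::field sga"
  assumes "supp x \<subseteq> A" "finite A"
  shows "x = (\<Sum>g\<in>A. Poly_Mapping.single g (coeff x g))"
proof (rule poly_mapping_eqI)
  fix h
  have "coeff (\<Sum>g\<in>A. Poly_Mapping.single g (coeff x g)) h = (\<Sum>g\<in>A. if g = h then coeff x g else 0)"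
    by (simp add: lookup_sum lookup_single when_def)
  also have "\<dots> = coeff x h"
    using assms by (auto simp: in_keys_iff subset_iff)
  finally show "coeff x h = coeff (\<Sum>g\<in>A. Poly_Mapping.single g (coeff x g)) h" ..
qed

lemma sga_eq_sum_perm_elt: "supp x \<subseteq> A \<Longrightarrow> finite A \<Longrightarrow> x = (\<Sum>g\<in>A. coeff x g \<cdot> perm_elt g)"
  for x :: "'k::field sga"
  using sga_eq_sum [of x A] by (simp add: smul_def mult_single)

lemma coeff_mult:
  fixes x :: "'k::field sga"
  assumes "finite A" "supp x \<subseteq> A"
  shows "coeff (x * y) h = (\<Sum>g\<in>A. coeff x g * coeff y (- g + h))"
proof -
  have "x * y = (\<Sum>g\<in>A. Poly_Mapping.single g (coeff x g) * y)"
    by (subst sga_eq_sum [OF assms(2,1)]) (simp add: sum_distrib_right)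
  then show ?thesis by (simp add: lookup_sum coeff_single_mult)
qed

lemma coeff_perm_elt_mult [simp]: "coeff (perm_elt g * x) h = coeff x (- g + h)" for x :: "'k::field sga"
  by (simp add: coeff_single_mult)

lemma coeff_smul [simp]: "coeff (c \<cdot> x) h = c * coeff x h" for x :: "'k::field sga"
  by (simp add: smul_def coeff_single_mult)

lemma coeff_mult_single: "coeff (x * Poly_Mapping.single g c) h = coeff x (h - g) * c"
  for x :: "'k::field sga"
proof -
  have *: "- k + h = g \<longleftrightarrow> k = h - g" for k
  proof
    assume "- k + h = g"
    then have "h = k + g" by (metis add_minus_cancel)
    then show "k = h - g" by simp
  next
    assume "k = h - g"
    then have "h = k + g" by simp
    then show "- k + h = g" by simp
  qed
  have "coeff (x * Poly_Mapping.single g c) h = 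
     (\<Sum>k\<in>insert (h - g) (supp x). coeff x k * (c when k = h - g))"
    by (subst coeff_mult [where A = "insert (h - g) (supp x)"])
       (auto simp: lookup_single * eq_commute [of g] intro!: sum.cong)
  also have "\<dots> = (\<Sum>k\<in>{h - g}. coeff x k * (c when k = h - g))"
    by (rule sum.mono_neutral_right) auto
  finally show ?thesis by simp
qed

lemma coeff_mult_perm_elt [simp]: "coeff (x * perm_elt g) h = coeff x (h - g)" for x :: "'k::field sga"
  by (simp add: coeff_mult_single)

lemma smul_simps [simp]:
  fixes x y :: "'k::field sga"
  shows "x * (c \<cdot> y) = c \<cdot> (x * y)" "(c \<cdot> x) * y = c \<cdot> (x * y)" "c \<cdot> (d \<cdot> x) = (c * d) \<cdot> x"
    "1 \<cdot> x = x" "0 \<cdot> x = 0" "c \<cdot> 0 = (0 :: 'k sga)" "(- 1) \<cdot> x = - x"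
proof -
  have "x * Poly_Mapping.single 0 c = c \<cdot> x"
    by (rule poly_mapping_eqI) (simp add: coeff_mult_single)
  then show "x * (c \<cdot> y) = c \<cdot> (x * y)" by (simp add: smul_def flip: mult.assoc)
  show "(c \<cdot> x) * y = c \<cdot> (x * y)" by (simp add: smul_def mult.assoc)
qed (rule poly_mapping_eqI, simp)+

lemma smul_distrib:
  fixes x y :: "'k::field sga"
  shows "c \<cdot> (x + y) = c \<cdot> x + c \<cdot> y" "(c + d) \<cdot> x = c \<cdot> x + d \<cdot> x" "c \<cdot> (x - y) = c \<cdot> x - c \<cdot> y"
    "c \<cdot> (\<Sum>i\<in>I. f i) = (\<Sum>i\<in>I. c \<cdot> f i)"
  by (simp_all add: smul_def algebra_simps sum_distrib_left single_add)

lemma perm_elt_mult: "perm_elt g * perm_elt h = (perm_elt (g + h) :: 'k::field sga)"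
  by (simp add: mult_single)

lemma perm_elt_mult_assoc: "perm_elt g * (perm_elt h * x) = perm_elt (g + h) * x" for x :: "'k::field sga"
  by (simp add: mult.assoc [symmetric] mult_single)

text \<open>The coefficient at the identity is a trace: both sides are the sum of
  \<open>coeff x g * coeff y (- g)\<close>. The supports are enlarged by inverses so that inversion
  carries one index set onto the other.\<close>

lemma coeff_mult_zero_commute: "coeff (x * y) 0 = coeff (y * x) 0" for x y :: "'k::field sga"
proof -
  let ?A = "supp x \<union> uminus ` supp y" and ?B = "supp y \<union> uminus ` supp x"
  have B: "?B = uminus ` ?A" by (auto simp: image_Un image_image)
  have "coeff (x * y) 0 = (\<Sum>g\<in>?A. coeff x g * coeff y (- g))"
    by (subst coeff_mult [where A = ?A]) auto
  also have "\<dots> = (\<Sum>g\<in>?B. coeff y g * coeff x (- g))"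
    unfolding B by (subst sum.reindex) (auto simp: inj_on_def mult.commute)
  also have "\<dots> = coeff (y * x) 0"
    by (subst coeff_mult [where A = ?B]) auto
  finally show ?thesis .
qed

lemma supp_mult_symg: "supp x \<subseteq> symg r \<Longrightarrow> supp y \<subseteq> symg r \<Longrightarrow> supp (x * y) \<subseteq> symg r"
  for x y :: "'k::field sga"
  using keys_mult [of x y] by (force intro: symg_closed)

lemma supp_sum: "(\<And>i. i \<in> I \<Longrightarrow> supp (f i) \<subseteq> A) \<Longrightarrow> supp (\<Sum>i\<in>I. f i) \<subseteq> A"
  for f :: "'i \<Rightarrow> 'k::field sga"
  by (induction I rule: infinite_finite_induct) (use keys_add in \<open>fastforce simp: subset_iff\<close>)+

lemma supp_perm_elt_symg: "g \<in> symg r \<Longrightarrow> supp (perm_elt g :: 'k::field sga) \<subseteq> symg r"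
  by simp

text \<open>The bridge from coefficient functions on permutations, as in the statement, to the
  convolution ring; \<open>emb_mult\<close> and \<open>emb_inject\<close> make it faithful to
  products and equations.\<close>

definition emb :: "nat \<Rightarrow> 'k::field galg \<Rightarrow> 'k sga" where
  "emb r x = (\<Sum>g\<in>symg r. Poly_Mapping.single g (x (pfun g)))"

lemma coeff_emb: "coeff (emb r x) g = (if g \<in> symg r then x (pfun g) else 0)"
  by (simp add: emb_def lookup_sum lookup_single when_def)

lemma supp_emb: "supp (emb r x) \<subseteq> symg r"
  by (auto simp: in_keys_iff coeff_emb split: if_splits)

lemma emb_mult: "emb r (galg_mult r x y) = emb r x * emb r y"
proof (rule poly_mapping_eqI)
  fix h
  have "coeff (emb r x * emb r y) h = (\<Sum>g\<in>symg r. coeff (emb r x) g * coeff (emb r y) (- g + h))"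
    by (rule coeff_mult) (auto simp: supp_emb)
  also have "\<dots> = (if h \<in> symg r then \<Sum>g\<in>symg r. x (pfun g) * y (pfun (- g + h)) else 0)"
  proof -
    have "- g + h \<in> symg r \<longleftrightarrow> h \<in> symg r" if "g \<in> symg r" for g
      using that by (metis add_minus_cancel symg_closed(2) symg_closed(3))
    then show ?thesis by (auto simp: coeff_emb)
  qed
  also have "\<dots> = coeff (emb r (galg_mult r x y)) h"
    by (simp add: coeff_emb galg_mult_def sum_permutes_eq_symg pfun_plus pfun_uminus symg_iff
        del: One_nat_def)
  finally show "coeff (emb r (galg_mult r x y)) h = coeff (emb r x * emb r y) h" ..
qed

lemma emb_scale: "emb r (galg_scale c x) = c \<cdot> emb r x"
  by (rule poly_mapping_eqI) (simp add: coeff_emb galg_scale_def)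

lemma emb_eqD:
  assumes "emb r x = emb r y" "\<sigma> permutes {1..r}"
  shows "x \<sigma> = y \<sigma>"
  using arg_cong [OF assms(1), of "\<lambda>z. coeff z (Perm \<sigma>)"] assms(2)
  by (simp add: coeff_emb Perm_in_symg pfun_Perm)

section \<open>Young diagrams and their strands\<close>

definition cells :: "nat list \<Rightarrow> (nat \<times> nat) set" where
  "cells lam = {(i, c). 1 \<le> i \<and> 1 \<le> c \<and> c \<le> part lam i}"

definition strand :: "nat list \<Rightarrow> nat \<times> nat \<Rightarrow> nat" where
  "strand lam = (\<lambda>(i, c). offset lam i + c)"

text \<open>\<open>rw\<close> and \<open>cl\<close> give the row and column of the box that holds
  strand \<open>x\<close> in the row reading tableau. Outside \<open>{1..sum_list lam}\<close> they
  are unspecified, whence the range conditions below.\<close>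

definition rw :: "nat list \<Rightarrow> nat \<Rightarrow> nat" where
  "rw lam x = fst (inv_into (cells lam) (strand lam) x)"

definition cl :: "nat list \<Rightarrow> nat \<Rightarrow> nat" where
  "cl lam x = snd (inv_into (cells lam) (strand lam) x)"

lemma offset_1 [simp]: "offset lam (Suc 0) = 0"
  by (simp add: offset_def)

lemma offset_Suc: "1 \<le> s \<Longrightarrow> offset lam (Suc s) = offset lam s + part lam s"
  by (simp add: offset_def)

lemma offset_mono: "s \<le> t \<Longrightarrow> offset lam s \<le> offset lam t"
  unfolding offset_def by (rule sum_mono2) auto

lemma offset_length: "offset lam (Suc (length lam)) = sum_list lam"
proof -
  have "offset lam (Suc (length lam)) = (\<Sum>i = 0..<length lam. part lam (Suc i))"
    unfolding offset_def using sum.shift_bounds_Suc_ivl [of "part lam" 0 "length lam"] by simp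
  then show ?thesis by (simp add: part_def sum_list_sum_nth)
qed

lemma offset_le: "offset lam s \<le> sum_list lam"
proof (cases "s \<le> Suc (length lam)")
  case True
  then show ?thesis using offset_mono [OF True, of lam] by (simp add: offset_length)
next
  case False
  have "offset lam s = offset lam (Suc (length lam))"
    unfolding offset_def by (rule sum.mono_neutral_right) (use False in \<open>auto simp: part_def\<close>)
  then show ?thesis by (simp add: offset_length)
qed

lemma strand_bij: "bij_betw (strand lam) (cells lam) {1..sum_list lam}"
proof (rule bij_betw_imageI)
  show "inj_on (strand lam) (cells lam)"
  proof (rule inj_onI, clarify)
    fix i c j d
    assume *: "(i, c) \<in> cells lam" "(j, d) \<in> cells lam" "strand lam (i, c) = strand lam (j, d)"
    have "\<not> i' < j'" if "(i', c') \<in> cells lam" "(j', d') \<in> cells lam"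
      "strand lam (i', c') = strand lam (j', d')" for i' c' j' d'
    proof
      assume "i' < j'"
      then have "offset lam (Suc i') \<le> offset lam j'" by (intro offset_mono) auto
      then show False using that by (auto simp: cells_def strand_def offset_Suc)
    qed
    then have "i = j" using * by (metis linorder_neqE_nat)
    then show "i = j \<and> c = d" using * by (simp add: strand_def)
  qed
  show "strand lam ` cells lam = {1..sum_list lam}"
  proof (intro equalityI subsetI)
    fix x assume "x \<in> strand lam ` cells lam"
    then obtain i c where *: "(i, c) \<in> cells lam" "x = offset lam i + c"
      by (auto simp: strand_def)
    then have "x \<le> offset lam (Suc i)" by (auto simp: cells_def offset_Suc)
    then show "x \<in> {1..sum_list lam}" using * offset_le [of lam "Suc i"] by (auto simp: cells_def)
  next
    fix x assume x: "x \<in> {1..sum_list lam}"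
    \<comment> \<open>The row of \<open>x\<close> is the first one that does not end before
      \<open>x\<close>.\<close>
    define i where "i = (LEAST i. x \<le> offset lam (Suc i))"
    have 1: "x \<le> offset lam (Suc i)"
      unfolding i_def by (rule LeastI [of _ "length lam"]) (use x in \<open>simp add: offset_length\<close>)
    have "i \<noteq> 0" using 1 x by (intro notI) simp
    then obtain j where j: "i = Suc j" by (cases i) auto
    then have "\<not> x \<le> offset lam (Suc j)"
      using not_less_Least [of j "\<lambda>i. x \<le> offset lam (Suc i)"] by (simp add: i_def)
    then have 2: "offset lam i < x" by (simp add: j)
    have "(i, x - offset lam i) \<in> cells lam"
      using 1 2 \<open>i \<noteq> 0\<close> by (auto simp: cells_def offset_Suc)
    moreover have "strand lam (i, x - offset lam i) = x" using 2 by (simp add: strand_def)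
    ultimately show "x \<in> strand lam ` cells lam" by (metis imageI)
  qed
qed

lemma strand_in: "ic \<in> cells lam \<Longrightarrow> strand lam ic \<in> {1..sum_list lam}"
  using strand_bij by (metis bij_betwE)

lemma rw_strand [simp]: "(i, c) \<in> cells lam \<Longrightarrow> rw lam (strand lam (i, c)) = i"
  and cl_strand [simp]: "(i, c) \<in> cells lam \<Longrightarrow> cl lam (strand lam (i, c)) = c"
  using bij_betw_inv_into_left [OF strand_bij, of "(i, c)" lam] by (simp_all add: rw_def cl_def)

lemma rw_cl_cells: "x \<in> {1..sum_list lam} \<Longrightarrow> (rw lam x, cl lam x) \<in> cells lam"
  using bij_betw_inv_into [OF strand_bij [of lam]] by (simp add: rw_def cl_def bij_betwE)

lemma strand_rw_cl: "x \<in> {1..sum_list lam} \<Longrightarrow> strand lam (rw lam x, cl lam x) = x"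
  using bij_betw_inv_into_right [OF strand_bij, of x lam] by (simp add: rw_def cl_def)

lemma rw_cl_eq_imp_eq:
  "x \<in> {1..sum_list lam} \<Longrightarrow> y \<in> {1..sum_list lam} \<Longrightarrow> rw lam x = rw lam y \<Longrightarrow> cl lam x = cl lam y \<Longrightarrow> x = y"
  using strand_rw_cl by metis

lemma row_strands_eq: "1 \<le> s \<Longrightarrow> row_strands lam s = {x\<in>{1..sum_list lam}. rw lam x = s}"
proof (intro equalityI subsetI)
  fix x assume "1 \<le> s" "x \<in> row_strands lam s"
  then obtain c where "(s, c) \<in> cells lam" "x = strand lam (s, c)"
    by (auto simp: row_strands_def strand_def cells_def)
  then show "x \<in> {x\<in>{1..sum_list lam}. rw lam x = s}" using strand_in by simp
next
  fix x assume "x \<in> {x\<in>{1..sum_list lam}. rw lam x = s}"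
  then have "strand lam (s, cl lam x) = x" "(s, cl lam x) \<in> cells lam"
    using strand_rw_cl [of x] rw_cl_cells [of x] by auto
  then show "x \<in> row_strands lam s"
    unfolding row_strands_def strand_def cells_def
    by (intro CollectI exI [of _ "cl lam x"]) simp
qed

lemma col_strands_eq: "1 \<le> c \<Longrightarrow> col_strands lam c = {x\<in>{1..sum_list lam}. cl lam x = c}"
proof (intro equalityI subsetI)
  fix x assume "1 \<le> c" "x \<in> col_strands lam c"
  then obtain s where "(s, c) \<in> cells lam" "x = strand lam (s, c)"
    by (auto simp: col_strands_def strand_def cells_def)
  then show "x \<in> {x\<in>{1..sum_list lam}. cl lam x = c}" using strand_in by simp
next
  fix x assume "x \<in> {x\<in>{1..sum_list lam}. cl lam x = c}"
  then have "strand lam (rw lam x, c) = x" "(rw lam x, c) \<in> cells lam"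
    using strand_rw_cl [of x] rw_cl_cells [of x] by auto
  then show "x \<in> col_strands lam c"
    unfolding col_strands_def strand_def cells_def
    by (intro CollectI exI [of _ "rw lam x"]) simp
qed

text \<open>Replaces setwise stability of rows or columns by invariance of the row or column number,
  a form in which the subgroup laws are immediate. The bound \<open>1 \<le> f x\<close> puts every
  point in one of the numbered fibres, and finiteness turns an injective self-map of a fibre into a
  surjective one.\<close>

lemma fibre_stabilizer:
  fixes N :: "nat set"
  assumes \<sigma>: "\<sigma> permutes N" and "finite N" and f: "\<And>x. x \<in> N \<Longrightarrow> 1 \<le> f x"
    and F: "\<And>s. 1 \<le> s \<Longrightarrow> F s = {x\<in>N. f x = s}"
  shows "(\<forall>s\<ge>1. \<sigma> ` F s = F s) \<longleftrightarrow> (\<forall>x\<in>N. f (\<sigma> x) = (f x :: nat))"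
proof (intro iffI allI ballI impI)
  fix x assume "\<forall>s\<ge>1. \<sigma> ` F s = F s" "x \<in> N"
  then have "\<sigma> x \<in> F (f x)" using F f by (metis (mono_tags, lifting) image_eqI mem_Collect_eq)
  then show "f (\<sigma> x) = f x" using F f \<open>x \<in> N\<close> by simp
next
  fix s :: nat assume *: "\<forall>x\<in>N. f (\<sigma> x) = f x" "1 \<le> s"
  show "\<sigma> ` F s = F s"
  proof (rule endo_inj_surj)
    show "finite (F s)" using * F \<open>finite N\<close> by simp
    show "\<sigma> ` F s \<subseteq> F s" using * F permutes_in_image [OF \<sigma>] by auto
    show "inj_on \<sigma> (F s)" using permutes_inj [OF \<sigma>] by (rule inj_on_subset) simp
  qed
qed

section \<open>Row and column groups\<close>

definition rowg :: "nat list \<Rightarrow> sperm set" where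
  "rowg lam = {g\<in>symg (sum_list lam). \<forall>x\<in>{1..sum_list lam}. rw lam (pfun g x) = rw lam x}"

definition colg :: "nat list \<Rightarrow> sperm set" where
  "colg lam = {g\<in>symg (sum_list lam). \<forall>x\<in>{1..sum_list lam}. cl lam (pfun g x) = cl lam x}"

lemma pfun_row_group: "pfun g \<in> row_group lam \<longleftrightarrow> g \<in> rowg lam"
proof -
  have "(\<forall>s\<ge>1. pfun g ` row_strands lam s = row_strands lam s) \<longleftrightarrow>
      (\<forall>x\<in>{1..sum_list lam}. rw lam (pfun g x) = rw lam x)" if "pfun g permutes {1..sum_list lam}"
    by (rule fibre_stabilizer [OF that])
       (use rw_cl_cells row_strands_eq in \<open>auto simp: cells_def\<close>)
  then show ?thesis by (auto simp: row_group_def rowg_def symg_def)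
qed

lemma pfun_col_group: "pfun g \<in> col_group lam \<longleftrightarrow> g \<in> colg lam"
proof -
  have "(\<forall>s\<ge>1. pfun g ` col_strands lam s = col_strands lam s) \<longleftrightarrow>
      (\<forall>x\<in>{1..sum_list lam}. cl lam (pfun g x) = cl lam x)" if "pfun g permutes {1..sum_list lam}"
    by (rule fibre_stabilizer [OF that])
       (use rw_cl_cells col_strands_eq in \<open>auto simp: cells_def\<close>)
  then show ?thesis by (auto simp: col_group_def colg_def symg_def)
qed

definition subgrp :: "sperm set \<Rightarrow> bool" where
  "subgrp H \<longleftrightarrow> 0 \<in> H \<and> (\<forall>g\<in>H. \<forall>h\<in>H. g + h \<in> H) \<and> (\<forall>g\<in>H. - g \<in> H)"

lemma subgrp_cancel:
  assumes "subgrp H" "h \<in> H"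
  shows "- h + g \<in> H \<longleftrightarrow> g \<in> H" "g - h \<in> H \<longleftrightarrow> g \<in> H" "h + g \<in> H \<longleftrightarrow> g \<in> H"
proof -
  show 3: "h + g \<in> H \<longleftrightarrow> g \<in> H"
    using assms unfolding subgrp_def by (metis minus_add_cancel)
  show "- h + g \<in> H \<longleftrightarrow> g \<in> H"
    using assms unfolding subgrp_def by (metis add_minus_cancel)
  show "g - h \<in> H \<longleftrightarrow> g \<in> H"
    using assms unfolding subgrp_def by (metis diff_add_cancel add_uminus_conv_diff)
qed

lemma subgrp_uminus: "subgrp H \<Longrightarrow> - g \<in> H \<longleftrightarrow> g \<in> H"
  unfolding subgrp_def by (metis minus_minus)

lemma pfun_in_interval: "g \<in> symg r \<Longrightarrow> pfun g x \<in> {1..r} \<longleftrightarrow> x \<in> {1..r}"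
  unfolding symg_def mem_Collect_eq by (rule permutes_in_image)

lemma pfun_uminus_pfun [simp]: "pfun (- g) (pfun g x) = x"
  by (metis comp_apply id_apply left_minus pfun_plus pfun_zero)

lemma pfun_pfun_uminus [simp]: "pfun g (pfun (- g) x) = x"
  by (metis minus_minus pfun_uminus_pfun)

lemma subgrp_fibre_stabilizer: "subgrp {g\<in>symg r. \<forall>x\<in>{1..r}. f (pfun g x) = f x}"
  unfolding subgrp_def
  using pfun_in_interval symg_closed(3)
  by (auto simp: pfun_plus simp del: One_nat_def atLeastAtMost_iff) 
     (metis pfun_pfun_uminus)

lemma subgrp_rowg: "subgrp (rowg lam)" and subgrp_colg: "subgrp (colg lam)"
  unfolding rowg_def colg_def by (rule subgrp_fibre_stabilizer)+

lemma rowg_symg: "rowg lam \<subseteq> symg (sum_list lam)" and colg_symg: "colg lam \<subseteq> symg (sum_list lam)"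
  by (auto simp: rowg_def colg_def)

lemma pfun_outside: "g \<in> symg r \<Longrightarrow> x \<notin> {1..r} \<Longrightarrow> pfun g x = x"
  unfolding symg_def by (simp add: permutes_not_in)

text \<open>A strand is determined by its row and column together. This is what isolates the
  identity term in the product of symmetrizer and antisymmetrizer.\<close>

lemma rowg_Int_colg: "g \<in> rowg lam \<Longrightarrow> g \<in> colg lam \<Longrightarrow> g = 0"
proof -
  assume g: "g \<in> rowg lam" "g \<in> colg lam"
  then have s: "g \<in> symg (sum_list lam)" by (simp add: rowg_def)
  have "pfun g x = x" for x
  proof (cases "x \<in> {1..sum_list lam}")
    case True
    have "pfun g x \<in> {1..sum_list lam}" using pfun_in_interval [OF s] True by blast
    then show ?thesis
      using True by (rule rw_cl_eq_imp_eq) (use g True in \<open>simp_all add: rowg_def colg_def\<close>)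
  qed (rule pfun_outside [OF s])
  then have "pfun g = pfun 0" by auto
  then show ?thesis unfolding pfun_inject .
qed

section \<open>The dominance argument\<close>

lemma part_antimono:
  assumes "is_partition lam r" "1 \<le> i" "i \<le> j"
  shows "part lam j \<le> part lam i"
proof (cases "i < j \<and> j \<le> length lam")
  case True
  then show ?thesis
    using assms sorted_wrt_nth_less [of "(\<ge>)" lam "i - 1" "j - 1"]
    by (auto simp: is_partition_def part_def)
next
  case False
  then show ?thesis using assms by (cases "i = j") (auto simp: part_def)
qed

lemma rw_le_iff:
  assumes "x \<in> {1..sum_list lam}"
  shows "rw lam x \<le> k \<longleftrightarrow> x \<le> offset lam (Suc k)"
proof -
  have x: "x = offset lam (rw lam x) + cl lam x" "1 \<le> cl lam x" "cl lam x \<le> part lam (rw lam x)" "1 \<le> rw lam x"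
    using strand_rw_cl [OF assms] rw_cl_cells [OF assms] by (auto simp: strand_def cells_def)
  show ?thesis
  proof
    assume "rw lam x \<le> k"
    then have "offset lam (Suc (rw lam x)) \<le> offset lam (Suc k)" by (intro offset_mono) simp
    then show "x \<le> offset lam (Suc k)" using x by (simp add: offset_Suc)
  next
    assume *: "x \<le> offset lam (Suc k)"
    show "rw lam x \<le> k"
    proof (rule ccontr)
      assume "\<not> rw lam x \<le> k"
      then have "offset lam (Suc k) \<le> offset lam (rw lam x)" by (intro offset_mono) simp
      then show False using * x by linarith
    qed
  qed
qed

lemma card_rw_le: "card {x\<in>{1..sum_list lam}. rw lam x \<le> k} = offset lam (Suc k)"
proof -
  have "{x\<in>{1..sum_list lam}. rw lam x \<le> k} = {1..offset lam (Suc k)}"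
    using rw_le_iff offset_le [of lam "Suc k"] by auto
  then show ?thesis by simp
qed

lemma card_eq_sum_fibres:
  assumes "finite A" "finite C" "f ` A \<subseteq> C"
  shows "card A = (\<Sum>c\<in>C. card {x\<in>A. f x = c})"
  using sum.group [OF assms, of "\<lambda>_. 1 :: nat"] by simp

context
  fixes lam mu :: "nat list" and h :: sperm
  assumes mu: "is_partition mu (sum_list lam)" and h: "h \<in> symg (sum_list lam)"
    and inj: "inj_on (\<lambda>x. (rw lam x, cl mu (pfun h x))) {1..sum_list lam}"
begin

private lemma sum_mu: "sum_list mu = sum_list lam"
  using mu by (simp add: is_partition_def)

text \<open>By \<open>inj\<close>, no two strands share a row of \<open>lam\<close> and, after
  \<open>h\<close>, a column of \<open>mu\<close>. If column \<open>c\<close> of \<open>mu\<close>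
  reaches row \<open>k\<close>, the left side is at most \<open>k\<close> (one strand per row) while
  the right side has a box in each of the first \<open>k\<close> rows. If it does not, the whole
  column lies in the first \<open>k\<close> rows and \<open>h\<close> itself maps the left set into
  the right one.\<close>

lemma card_column_le:
  "card {x\<in>{1..sum_list lam}. rw lam x \<le> k \<and> cl mu (pfun h x) = c}
     \<le> card {y\<in>{1..sum_list lam}. rw mu y \<le> k \<and> cl mu y = c}" (is "card ?A \<le> card ?B")
proof (cases "1 \<le> k \<and> 1 \<le> c \<and> c \<le> part mu k")
  case True
  then have cell: "(i, c) \<in> cells mu" if "i \<in> {1..k}" for i
    using part_antimono [OF mu, of i k] that by (auto simp: cells_def)
  have "card ?A = card (rw lam ` ?A)"
    by (rule card_image [symmetric]) (use inj in \<open>auto simp: inj_on_def\<close>)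
  also have "rw lam ` ?A \<subseteq> {1..k}"
  proof clarify
    fix x assume "x \<in> {1..sum_list lam}" "rw lam x \<le> k"
    then show "rw lam x \<in> {1..k}" using rw_cl_cells [of x lam] by (simp add: cells_def)
  qed
  then have "card (rw lam ` ?A) \<le> k" using card_mono [of "{1..k}"] by force
  also have "k = card ((\<lambda>i. strand mu (i, c)) ` {1..k})"
    by (subst card_image) (use cell in \<open>auto intro!: inj_on_inverseI [where g = "rw mu"]\<close>)
  also have "\<dots> \<le> card ?B"
    using cell strand_in [of _ mu] by (intro card_mono) (auto simp: sum_mu)
  finally show ?thesis .
next
  case False
  have "pfun h ` ?A \<subseteq> ?B"
  proof clarify
    fix x assume x: "x \<in> {1..sum_list lam}" "rw lam x \<le> k" "c = cl mu (pfun h x)"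
    then have hx: "pfun h x \<in> {1..sum_list lam}" using pfun_in_interval [OF h] by blast
    have cell: "(rw mu (pfun h x), cl mu (pfun h x)) \<in> cells mu"
      by (rule rw_cl_cells) (use hx sum_mu in simp)
    have "1 \<le> k" using x rw_cl_cells [of x lam] by (auto simp: cells_def)
    have "rw mu (pfun h x) \<le> k"
    proof (rule ccontr)
      assume "\<not> rw mu (pfun h x) \<le> k"
      then have "part mu (rw mu (pfun h x)) \<le> part mu k"
        using \<open>1 \<le> k\<close> by (intro part_antimono [OF mu]) auto
      then show False using cell False x \<open>1 \<le> k\<close> by (auto simp: cells_def)
    qed
    then show "pfun h x \<in> {1..sum_list lam} \<and> rw mu (pfun h x) \<le> k \<and> cl mu (pfun h x) = cl mu (pfun h x)"
      using hx by simp
  qed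
  moreover have "inj_on (pfun h) ?A" by (rule inj_on_inverseI [where g = "pfun (- h)"]) simp
  ultimately show ?thesis by (intro card_inj_on_le [of "pfun h"]) auto
qed

private lemma card_sums:
  "offset lam (Suc k) = (\<Sum>c\<in>{1..sum_list lam}. card {x\<in>{1..sum_list lam}. rw lam x \<le> k \<and> cl mu (pfun h x) = c})"
  "offset mu (Suc k) = (\<Sum>c\<in>{1..sum_list lam}. card {y\<in>{1..sum_list lam}. rw mu y \<le> k \<and> cl mu y = c})"
proof -
  have cl: "cl mu y \<in> {1..sum_list lam}" if "y \<in> {1..sum_list lam}" for y
  proof -
    have "y \<in> {1..sum_list mu}" using that sum_mu by simp
    from strand_rw_cl [OF this] rw_cl_cells [OF this] this show ?thesis
      by (auto simp: strand_def cells_def sum_mu)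
  qed
  show "offset lam (Suc k) = (\<Sum>c\<in>{1..sum_list lam}. card {x\<in>{1..sum_list lam}. rw lam x \<le> k \<and> cl mu (pfun h x) = c})"
    using card_eq_sum_fibres [of "{x\<in>{1..sum_list lam}. rw lam x \<le> k}" "{1..sum_list lam}" "\<lambda>x. cl mu (pfun h x)"]
      cl pfun_in_interval [OF h] by (auto simp: card_rw_le simp del: One_nat_def atLeastAtMost_iff)
  show "offset mu (Suc k) = (\<Sum>c\<in>{1..sum_list lam}. card {y\<in>{1..sum_list lam}. rw mu y \<le> k \<and> cl mu y = c})"
    using card_eq_sum_fibres [of "{x\<in>{1..sum_list lam}. rw mu x \<le> k}" "{1..sum_list lam}" "cl mu"]
      card_rw_le [of mu k] cl unfolding sum_mu
    by (auto simp: image_subset_iff simp del: One_nat_def atLeastAtMost_iff)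
qed

text \<open>The column bounds are summed; \<open>offset\<close> at \<open>Suc k\<close> is the sum
  of the first \<open>k\<close> parts, so this is dominance of \<open>mu\<close> over
  \<open>lam\<close>.\<close>

lemma dominance: "offset lam (Suc k) \<le> offset mu (Suc k)"
  unfolding card_sums by (intro sum_mono card_column_le)

text \<open>For equal shapes the column bounds add up to an equality, so each of them is an
  equality, for every \<open>k\<close>. Were the box in row \<open>rw lam x\<close> and column
  \<open>?c\<close> missing, the right hand count for that column would not grow at this row,
  whereas the left hand count grows by \<open>x\<close>.\<close>

lemma cell_of_injective_filling:
  assumes eq: "lam = mu" and x: "x \<in> {1..sum_list lam}"
  shows "(rw lam x, cl mu (pfun h x)) \<in> cells lam"
proof (rule ccontr)
  let ?N = "{1..sum_list lam}" and ?c = "cl mu (pfun h x)"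
  define A where "A k = {x\<in>?N. rw lam x \<le> k \<and> cl mu (pfun h x) = ?c}" for k
  define B where "B k = {y\<in>?N. rw mu y \<le> k \<and> cl mu y = ?c}" for k
  have hx: "pfun h x \<in> ?N" using pfun_in_interval [OF h] x by blast
  have c: "?c \<in> ?N"
    using strand_rw_cl [of "pfun h x" mu] rw_cl_cells [of "pfun h x" mu] hx sum_mu
    by (auto simp: strand_def cells_def)
  have card: "card (A k) = card (B k)" for k
  proof -
    have "(\<Sum>c\<in>?N. card {x\<in>?N. rw lam x \<le> k \<and> cl mu (pfun h x) = c}) =
        (\<Sum>c\<in>?N. card {y\<in>?N. rw mu y \<le> k \<and> cl mu y = c})"
      using card_sums [of k] eq by simp
    from sum_mono_inv [OF this card_column_le c] show ?thesis by (simp add: A_def B_def)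
  qed
  assume no: "(rw lam x, ?c) \<notin> cells lam"
  have "1 \<le> rw lam x" using rw_cl_cells [OF x] by (auto simp: cells_def)
  have "B (rw lam x - 1) = B (rw lam x)"
  proof (intro equalityI subsetI)
    fix y assume y: "y \<in> B (rw lam x)"
    then have "(rw mu y, ?c) \<in> cells mu"
      using rw_cl_cells [of y mu] sum_mu by (simp add: B_def)
    then have "rw mu y \<noteq> rw lam x" using no eq by metis
    then show "y \<in> B (rw lam x - 1)" using y by (auto simp: B_def)
  qed (auto simp: B_def)
  then have "card (A (rw lam x - 1)) = card (A (rw lam x))" using card by metis
  moreover have "A (rw lam x - 1) \<subseteq> A (rw lam x)" by (auto simp: A_def)
  ultimately have "A (rw lam x - 1) = A (rw lam x)"
    by (intro card_subset_eq) (auto simp: A_def)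
  moreover have "x \<in> A (rw lam x)" using x by (simp add: A_def)
  ultimately have "x \<in> A (rw lam x - 1)" by simp
  then have "rw lam x \<le> rw lam x - 1" by (simp add: A_def)
  then show False using \<open>1 \<le> rw lam x\<close> by linarith
qed

end

lemma offset_inject:
  assumes "is_partition lam r" "is_partition mu r" "\<And>k. offset lam (Suc k) = offset mu (Suc k)"
  shows "lam = mu"
proof -
  have p: "part lam i = part mu i" if "1 \<le> i" for i
    using assms(3) [of i] assms(3) [of "i - 1"] that by (simp add: offset_Suc)
  have l: "i \<le> length nu \<longleftrightarrow> part nu i \<noteq> 0" if "1 \<le> i" "is_partition nu r" for i nu
  proof -
    have "i \<le> length nu \<Longrightarrow> nu ! (i - 1) \<in> set nu"
      using that by (intro nth_mem) auto
    then have "i \<le> length nu \<Longrightarrow> nu ! (i - 1) \<noteq> 0"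
      using that by (metis is_partition_def)
    then show ?thesis using that by (auto simp: part_def)
  qed
  have ll: "i \<le> length lam \<longleftrightarrow> i \<le> length mu" if "1 \<le> i" for i
    using l [OF that] p [OF that] assms by simp
  have "length lam = length mu"
    using ll [of "length lam"] ll [of "length mu"]
    by (cases "length lam = 0"; cases "length mu = 0") auto
  then show ?thesis
  proof (rule nth_equalityI)
    fix i assume "i < length lam"
    then show "lam ! i = mu ! i"
      using p [of "Suc i"] \<open>length lam = length mu\<close> by (simp add: part_def)
  qed
qed

text \<open>The map \<open>f\<close> keeps each strand in its row and moves it to the column of its
  preimage under \<open>g\<close>; the target box exists by
  \<open>cell_of_injective_filling\<close>. Then \<open>f\<close> lies in the row group and
  \<open>f\<close> after \<open>g\<close> preserves columns, so \<open>p\<close> is the inverse of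
  \<open>f\<close>. The complementary case is \<open>clash_transposition\<close>.\<close>

lemma rowg_colg_decompose:
  assumes lam: "is_partition lam (sum_list lam)" and g: "g \<in> symg (sum_list lam)"
    and inj: "inj_on (\<lambda>x. (rw lam x, cl lam (pfun (- g) x))) {1..sum_list lam}"
  obtains p q where "p \<in> rowg lam" "q \<in> colg lam" "g = p + q"
proof -
  let ?N = "{1..sum_list lam}"
  have g': "- g \<in> symg (sum_list lam)" using g by simp
  define f where "f x = (if x \<in> ?N then strand lam (rw lam x, cl lam (pfun (- g) x)) else x)" for x
  have cell: "(rw lam x, cl lam (pfun (- g) x)) \<in> cells lam" if "x \<in> ?N" for x
    using cell_of_injective_filling [OF lam g' inj refl that] .
  have f: "f x \<in> ?N" "rw lam (f x) = rw lam x" "cl lam (f x) = cl lam (pfun (- g) x)" if "x \<in> ?N" for x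
    using cell [OF that] strand_in [OF cell [OF that]] that by (auto simp: f_def)
  have "f permutes ?N"
  proof (rule bij_imp_permutes)
    have "inj_on f ?N"
    proof (rule inj_onI)
      fix x y assume "x \<in> ?N" "y \<in> ?N" "f x = f y"
      then show "x = y" using inj_onD [OF inj, of x y] f(2,3) [of x] f(2,3) [of y] by simp
    qed
    moreover have "f ` ?N = ?N" using f(1) \<open>inj_on f ?N\<close> by (intro endo_inj_surj) auto
    ultimately show "bij_betw f ?N ?N" by (simp add: bij_betw_def)
  qed (auto simp: f_def)
  then have pf: "pfun (Perm f) = f" and s: "Perm f \<in> symg (sum_list lam)"
    by (simp_all add: pfun_Perm Perm_in_symg)
  have "Perm f \<in> rowg lam" using f s by (auto simp: rowg_def pf)
  moreover have "Perm f + g \<in> colg lam"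
    using f s g pfun_in_interval [OF g] by (auto simp: colg_def pfun_plus pf simp del: One_nat_def atLeastAtMost_iff)
  ultimately show ?thesis
    using that [of "- Perm f" "Perm f + g"] subgrp_uminus [OF subgrp_rowg, of "Perm f"]
    by (simp add: add.assoc [symmetric])
qed

section \<open>Young idempotents\<close>

definition sgn_elt :: "sperm \<Rightarrow> 'k::field" where
  "sgn_elt g = of_int (sign (pfun g))"

lemma permutation_pfun: "permutation (pfun g)"
  using pfun [of g] by (auto intro: permutation_permutes [THEN iffD2])

lemma sgn_elt_add: "sgn_elt (g + h) = (sgn_elt g * sgn_elt h :: 'k::field)"
  by (simp add: sgn_elt_def pfun_plus sign_compose permutation_pfun)

lemma sgn_elt_0 [simp]: "sgn_elt 0 = 1"
  by (simp add: sgn_elt_def sign_id)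

lemma sgn_elt_square [simp]: "sgn_elt g * sgn_elt g = (1 :: 'k::field)"
  by (simp add: sgn_elt_def sign_def)

lemma sgn_elt_uminus [simp]: "sgn_elt (- g) = (sgn_elt g :: 'k::field)"
proof -
  have "(sgn_elt g :: 'k) = sgn_elt g * (sgn_elt g * sgn_elt (- g))"
    by (simp flip: sgn_elt_add)
  then show ?thesis by (simp flip: mult.assoc)
qed

lemma sgn_elt_diff: "sgn_elt (g - h) = (sgn_elt h * sgn_elt g :: 'k::field)"
  using sgn_elt_add [of g "- h", where ?'k = 'k] by simp

definition row_elt :: "nat list \<Rightarrow> 'k::field sga" where
  "row_elt lam = emb (sum_list lam) (symmetrizer (row_group lam))"

definition col_elt :: "nat list \<Rightarrow> 'k::field sga" where
  "col_elt lam = emb (sum_list lam) (antisymmetrizer (col_group lam))"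

definition young_prod :: "nat list \<Rightarrow> 'k::field sga" where
  "young_prod lam = row_elt lam * col_elt lam"

definition young_elt :: "nat list \<Rightarrow> 'k::field sga" where
  "young_elt lam = emb (sum_list lam) (young_idem lam)"

text \<open>The two-sided equivariance satisfied by every product of the form (row symmetrizer) x
  (column antisymmetrizer). Keeping \<open>R\<close> and \<open>C\<close> as parameters allows the
  empty set on either side, so one-sided conditions fit the same lemmas.\<close>

definition young_class :: "sperm set \<Rightarrow> sperm set \<Rightarrow> 'k::field sga set" where
  "young_class R C = {x. (\<forall>p\<in>R. perm_elt p * x = x) \<and> (\<forall>q\<in>C. x * perm_elt q = sgn_elt q \<cdot> x)}"

lemma card_pfun_group:
  assumes "\<And>\<sigma>. \<sigma> \<in> G \<Longrightarrow> \<sigma> permutes {1..r}" "\<And>g. pfun g \<in> G \<longleftrightarrow> g \<in> H"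
  shows "card G = card H"
proof -
  have "G = pfun ` H"
  proof (intro equalityI subsetI)
    fix \<sigma> assume "\<sigma> \<in> G"
    then have "pfun (Perm \<sigma>) = \<sigma>" using assms(1) by (intro pfun_Perm)
    then show "\<sigma> \<in> pfun ` H" using assms(2) \<open>\<sigma> \<in> G\<close> by (metis imageI)
  qed (use assms(2) in auto)
  then show ?thesis by (simp add: card_image inj_on_def pfun_inject)
qed

lemma coeff_row_elt: "coeff (row_elt lam) g = (if g \<in> rowg lam then 1 / of_nat (card (rowg lam)) else (0 :: 'k::field))"
proof -
  have "card (row_group lam) = card (rowg lam)"
    by (rule card_pfun_group [OF _ pfun_row_group, where r = "sum_list lam"]) (simp add: row_group_def)
  then show ?thesis
    using rowg_symg [of lam] by (auto simp: row_elt_def coeff_emb symmetrizer_def pfun_row_group)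
qed

lemma coeff_col_elt: "coeff (col_elt lam) g = (if g \<in> colg lam then sgn_elt g / of_nat (card (colg lam)) else (0 :: 'k::field))"
proof -
  have "card (col_group lam) = card (colg lam)"
    by (rule card_pfun_group [OF _ pfun_col_group, where r = "sum_list lam"]) (simp add: col_group_def)
  then show ?thesis
    using colg_symg [of lam] by (auto simp: col_elt_def coeff_emb antisymmetrizer_def pfun_col_group sgn_elt_def)
qed

lemma finite_rowg: "finite (rowg lam)" and finite_colg: "finite (colg lam)"
  by (rule finite_subset [OF rowg_symg], simp, rule finite_subset [OF colg_symg], simp)

lemma card_rowg_nonzero: "of_nat (card (rowg lam)) \<noteq> (0 :: 'k::field_char_0)"
  and card_colg_nonzero: "of_nat (card (colg lam)) \<noteq> (0 :: 'k::field_char_0)"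
proof -
  have "rowg lam \<noteq> {}" "colg lam \<noteq> {}"
    using subgrp_rowg [of lam] subgrp_colg [of lam] by (auto simp: subgrp_def)
  then show "of_nat (card (rowg lam)) \<noteq> (0 :: 'k)" "of_nat (card (colg lam)) \<noteq> (0 :: 'k)"
    by (simp_all add: finite_rowg finite_colg card_gt_0_iff)
qed

lemma perm_elt_row_elt: "p \<in> rowg lam \<Longrightarrow> perm_elt p * row_elt lam = (row_elt lam :: 'k::field sga)"
  and row_elt_perm_elt: "p \<in> rowg lam \<Longrightarrow> row_elt lam * perm_elt p = (row_elt lam :: 'k::field sga)"
  by (rule poly_mapping_eqI; simp add: coeff_row_elt subgrp_cancel [OF subgrp_rowg])+

lemma col_elt_perm_elt: "q \<in> colg lam \<Longrightarrow> col_elt lam * perm_elt q = sgn_elt q \<cdot> (col_elt lam :: 'k::field sga)"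
  and perm_elt_col_elt: "q \<in> colg lam \<Longrightarrow> perm_elt q * col_elt lam = sgn_elt q \<cdot> (col_elt lam :: 'k::field sga)"
  by (rule poly_mapping_eqI; simp add: coeff_col_elt subgrp_cancel [OF subgrp_colg] sgn_elt_add sgn_elt_diff)+

lemma supp_row_elt: "supp (row_elt lam :: 'k::field sga) \<subseteq> symg (sum_list lam)"
  and supp_col_elt: "supp (col_elt lam :: 'k::field sga) \<subseteq> symg (sum_list lam)"
  and supp_young_elt: "supp (young_elt lam :: 'k::field sga) \<subseteq> symg (sum_list lam)"
  unfolding row_elt_def col_elt_def young_elt_def by (rule supp_emb)+

lemma young_classI:
  "(\<And>p. p \<in> R \<Longrightarrow> perm_elt p * x = x) \<Longrightarrow> (\<And>q. q \<in> C \<Longrightarrow> x * perm_elt q = sgn_elt q \<cdot> x) \<Longrightarrow> x \<in> young_class R C"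
  by (simp add: young_class_def)

lemma young_classD:
  "x \<in> young_class R C \<Longrightarrow> p \<in> R \<Longrightarrow> perm_elt p * x = x"
  "x \<in> young_class R C \<Longrightarrow> q \<in> C \<Longrightarrow> x * perm_elt q = sgn_elt q \<cdot> x"
  by (simp_all add: young_class_def)

lemma young_class_mult:
  fixes x y u :: "'k::field sga"
  assumes "x \<in> young_class R C'" "y \<in> young_class R' C"
  shows "x * u * y \<in> young_class R C" "x * y \<in> young_class R C"
proof -
  show *: "x * u * y \<in> young_class R C" for u
  proof (rule young_classI)
    show "perm_elt p * (x * u * y) = x * u * y" if "p \<in> R" for p
      using young_classD(1) [OF assms(1) that] by (simp flip: mult.assoc)
    show "x * u * y * perm_elt q = sgn_elt q \<cdot> (x * u * y)" if "q \<in> C" for q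
      using young_classD(2) [OF assms(2) that] by (simp add: mult.assoc)
  qed
  from * [of 1] show "x * y \<in> young_class R C" by simp
qed

lemma young_prod_class: "(young_prod lam :: 'k::field sga) \<in> young_class (rowg lam) (colg lam)"
  unfolding young_prod_def
  by (rule young_class_mult(2) [of _ _ "{}" _ "{}"]; rule young_classI) (simp_all add: perm_elt_row_elt col_elt_perm_elt)

lemma supp_young_prod: "supp (young_prod lam :: 'k::field sga) \<subseteq> symg (sum_list lam)"
  unfolding young_prod_def by (intro supp_mult_symg supp_row_elt supp_col_elt)

lemma young_emb: "emb (sum_list lam) (young_product lam) = young_prod lam"
  "young_elt lam = young_scalar lam \<cdot> young_prod lam"
  by (simp_all add: young_elt_def young_idem_def emb_scale young_product_def emb_mult young_prod_def row_elt_def col_elt_def)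

text \<open>Only the factorization of the identity with both factors trivial contributes, by
  \<open>rowg_Int_colg\<close>.\<close>

lemma coeff_young_prod_0: "coeff (young_prod lam) 0 = 1 / (of_nat (card (rowg lam)) * of_nat (card (colg lam)) :: 'k::field)"
proof -
  have "coeff (young_prod lam) 0 = (\<Sum>g\<in>symg (sum_list lam). coeff (row_elt lam) g * coeff (col_elt lam) (- g) :: 'k)"
    unfolding young_prod_def by (subst coeff_mult) (auto simp: supp_row_elt)
  also have "\<dots> = (\<Sum>g\<in>{0}. coeff (row_elt lam) g * coeff (col_elt lam) (- g))"
    by (rule sum.mono_neutral_right)
       (auto simp: coeff_row_elt coeff_col_elt subgrp_uminus [OF subgrp_colg] dest: rowg_Int_colg)
  also have "\<dots> = 1 / (of_nat (card (rowg lam)) * of_nat (card (colg lam)))"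
    using subgrp_rowg [of lam] subgrp_colg [of lam] by (simp add: coeff_row_elt coeff_col_elt subgrp_def)
  finally show ?thesis .
qed

lemma coeff_young_prod_0_nonzero: "coeff (young_prod lam) 0 \<noteq> (0 :: 'k::field_char_0)"
  unfolding coeff_young_prod_0
  using card_rowg_nonzero [of lam, where ?'k = 'k] card_colg_nonzero [of lam, where ?'k = 'k] by simp

lemma eq_neg_imp_0: "x = - x \<Longrightarrow> x = (0 :: 'k::field_char_0)"
  by (metis add_neg_numeral_special(7) eq_neg_iff_add_eq_0 mult_2 mult_eq_0_iff zero_neq_numeral)

text \<open>Two strands in the same row of the first tableau and in the same column of the second,
  translated by \<open>g\<close>, give a transposition which is absorbed on one side and negates on the other.\<close>

lemma clash_transposition:
  assumes len: "sum_list mu = sum_list lam" and g: "g \<in> symg (sum_list lam)"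
    and ninj: "\<not> inj_on (\<lambda>x. (rw lam x, cl mu (pfun (- g) x))) {1..sum_list lam}"
  obtains t where "t \<in> rowg lam" "- g + t + g \<in> colg mu" "sgn_elt (- g + t + g) = (- 1 :: 'k::field)"
proof -
  let ?N = "{1..sum_list lam}"
  obtain x y where xy: "x \<in> ?N" "y \<in> ?N" "x \<noteq> y" "rw lam x = rw lam y"
    "cl mu (pfun (- g) x) = cl mu (pfun (- g) y)"
    using ninj by (auto simp: inj_on_def)
  define t where "t = Perm (transpose x y)"
  have tr: "transpose x y permutes ?N" using xy by (intro permutes_swap_id)
  then have pt: "pfun t = transpose x y" and ts: "t \<in> symg (sum_list lam)"
    by (simp_all add: t_def pfun_Perm Perm_in_symg)
  have "t \<in> rowg lam"
    using ts xy(4) by (auto simp: rowg_def pt transpose_def)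
  moreover have "- g + t + g \<in> colg mu"
  proof -
    have "cl mu (pfun (- g) (transpose x y (pfun g z))) = cl mu z" for z
    proof -
      have "z = pfun (- g) (pfun g z)" by simp
      moreover have "cl mu (pfun (- g) (transpose x y w)) = cl mu (pfun (- g) w)" for w
        using xy(5) by (simp add: transpose_def)
      ultimately show ?thesis by metis
    qed
    then show ?thesis using g ts by (simp add: colg_def len pfun_plus pt)
  qed
  moreover have "sgn_elt (- g + t + g) = (- 1 :: 'k)"
  proof -
    have "sgn_elt (- g + t + g) = (sgn_elt t * (sgn_elt g * sgn_elt g) :: 'k)" by (simp add: sgn_elt_add)
    also have "sgn_elt g * sgn_elt g = (1 :: 'k)" by (rule sgn_elt_square)
    also have "sgn_elt t * 1 = (- 1 :: 'k)" using xy(3) by (simp add: sgn_elt_def pt sign_swap_id)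
    finally show ?thesis .
  qed
  ultimately show ?thesis using that by blast
qed

text \<open>Equivariance ties the coefficient at \<open>p + q\<close> to the one at
  \<open>0\<close>. Any other \<open>g\<close> admits a clashing transposition, which fixes the
  coefficient from the left and negates it from the right, so it vanishes in characteristic
  zero.\<close>

lemma young_class_eq_0:
  fixes x :: "'k::field_char_0 sga"
  assumes lam: "is_partition lam (sum_list lam)" and supp: "supp x \<subseteq> symg (sum_list lam)"
    and x: "x \<in> young_class (rowg lam) (colg lam)" and x0: "coeff x 0 = 0"
  shows "x = 0"
proof (rule poly_mapping_eqI)
  fix g
  have row: "coeff x (p + h) = coeff x h" if "p \<in> rowg lam" for p h
  proof -
    have "perm_elt (- p) * x = x"
      using that by (intro young_classD(1) [OF x]) (simp add: subgrp_uminus [OF subgrp_rowg])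
    then have "coeff (perm_elt (- p) * x) h = coeff x h" by simp
    then show ?thesis by simp
  qed
  have col: "coeff x (h + q) = sgn_elt q * coeff x h" if "q \<in> colg lam" for q h
  proof -
    have "x * perm_elt (- q) = sgn_elt (- q) \<cdot> x"
      using that by (intro young_classD(2) [OF x]) (simp add: subgrp_uminus [OF subgrp_colg])
    then have "coeff (x * perm_elt (- q)) h = coeff (sgn_elt q \<cdot> x) h" by simp
    then show ?thesis by (simp only: coeff_mult_perm_elt coeff_smul diff_minus_eq_add)
  qed
  show "coeff x g = coeff 0 g"
  proof (cases "g \<in> symg (sum_list lam)")
    case True
    show ?thesis
    proof (cases "inj_on (\<lambda>x. (rw lam x, cl lam (pfun (- g) x))) {1..sum_list lam}")
      case inj: True
      obtain p q where "p \<in> rowg lam" "q \<in> colg lam" "g = p + q"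
        using rowg_colg_decompose [OF lam True inj] .
      then show ?thesis using row col [of q 0] x0 by simp
    next
      case False
      obtain t where t: "t \<in> rowg lam" "- g + t + g \<in> colg lam" "sgn_elt (- g + t + g) = (- 1 :: 'k)"
        using clash_transposition [OF refl True False] .
      have "coeff x g = coeff x (t + g)" using row t by simp
      also have "t + g = g + (- g + t + g)" by (simp flip: add.assoc)
      also have "coeff x \<dots> = - coeff x g" using col [OF t(2), of g] t(3) by simp
      finally show ?thesis using eq_neg_imp_0 by simp
    qed
  qed (use supp in \<open>auto simp: in_keys_iff\<close>)
qed

lemma young_class_linear:
  "x \<in> young_class R C \<Longrightarrow> y \<in> young_class R C \<Longrightarrow> x - c \<cdot> y \<in> young_class R C"
  for x y :: "'k::field sga"
  by (simp add: young_class_def right_diff_distrib left_diff_distrib smul_distrib mult.commute)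

text \<open>Within k[S_r] the class is thus a line, spanned by \<open>young_prod lam\<close>, with
  the coefficient at the identity as coordinate.\<close>

lemma young_class_multiple:
  fixes x :: "'k::field_char_0 sga"
  assumes lam: "is_partition lam (sum_list lam)" and supp: "supp x \<subseteq> symg (sum_list lam)"
    and x: "x \<in> young_class (rowg lam) (colg lam)"
  shows "x = (coeff x 0 / coeff (young_prod lam) 0) \<cdot> young_prod lam"
proof -
  let ?d = "x - (coeff x 0 / coeff (young_prod lam) 0) \<cdot> young_prod lam"
  have "?d = 0"
  proof (rule young_class_eq_0 [OF lam])
    show "?d \<in> young_class (rowg lam) (colg lam)"
      by (intro young_class_linear x young_prod_class)
    show "coeff ?d 0 = 0" by (simp add: lookup_minus coeff_young_prod_0_nonzero)
    show "supp ?d \<subseteq> symg (sum_list lam)"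
    proof (rule subsetI, rule ccontr)
      fix g assume "g \<in> supp ?d" "g \<notin> symg (sum_list lam)"
      moreover from this have "coeff x g = 0" "coeff (young_prod lam :: 'k sga) g = 0"
        using supp supp_young_prod [of lam, where ?'k = 'k] by (auto simp: in_keys_iff)
      ultimately show False by (simp add: in_keys_iff lookup_minus)
    qed
  qed
  then show ?thesis by simp
qed

lemma young_prod_sandwich:
  fixes x :: "'k::field_char_0 sga"
  assumes lam: "is_partition lam (sum_list lam)" and supp: "supp x \<subseteq> symg (sum_list lam)"
  shows "young_prod lam * x * young_prod lam = (coeff (young_prod lam * x * young_prod lam) 0 / coeff (young_prod lam) 0) \<cdot> young_prod lam"
proof (rule young_class_multiple [OF lam])
  show "supp (young_prod lam * x * young_prod lam) \<subseteq> symg (sum_list lam)"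
    by (intro supp_mult_symg supp_young_prod supp)
  show "young_prod lam * x * young_prod lam \<in> young_class (rowg lam) (colg lam)"
    by (rule young_class_mult(1) [OF young_prod_class young_prod_class])
qed

definition flip :: "'k::field sga \<Rightarrow> 'k sga" where
  "flip x = Poly_Mapping.map_key uminus x"

lemma coeff_flip [simp]: "coeff (flip x) g = coeff x (- g)"
  by (simp add: flip_def map_key.rep_eq)

text \<open>Inversion is an anti-automorphism. The coefficient of \<open>flip (x * y)\<close> at
  \<open>h\<close> is the trace of \<open>x * y * perm_elt h\<close>, so cyclicity of the trace
  yields the reversed product.\<close>

lemma flip_mult: "flip (x * y) = flip y * flip x" for x y :: "'k::field sga"
proof (rule poly_mapping_eqI)
  fix h
  have "coeff (flip (x * y)) h = coeff (x * (y * perm_elt h)) 0"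
    by (simp flip: mult.assoc)
  also have "\<dots> = coeff ((y * perm_elt h) * x) 0" by (rule coeff_mult_zero_commute)
  also have "\<dots> = coeff (y * (perm_elt h * x)) 0" by (simp only: mult.assoc)
  also have "\<dots> = (\<Sum>g\<in>supp y. coeff y g * coeff x (- h - g))"
    by (subst coeff_mult [where A = "supp y"]) simp_all
  also have "\<dots> = (\<Sum>g\<in>uminus ` supp y. coeff (flip y) g * coeff (flip x) (- g + h))"
    by (subst sum.reindex) (auto simp: inj_on_def minus_add)
  also have "\<dots> = coeff (flip y * flip x) h"
    by (rule coeff_mult [symmetric]) (auto simp: in_keys_iff intro: image_eqI [where x = "- _"])
  finally show "coeff (flip (x * y)) h = coeff (flip y * flip x) h" .
qed

lemma flip_row_elt: "flip (row_elt lam) = (row_elt lam :: 'k::field sga)"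
  and flip_col_elt: "flip (col_elt lam) = (col_elt lam :: 'k::field sga)"
  by (rule poly_mapping_eqI; simp add: coeff_row_elt coeff_col_elt
        subgrp_uminus [OF subgrp_rowg] subgrp_uminus [OF subgrp_colg])+

lemma sum_const_smul: "(\<Sum>i\<in>G. c \<cdot> x) = (of_nat (card G) * c) \<cdot> x" for x :: "'k::field sga"
  by (induction G rule: infinite_finite_induct) (simp_all add: smul_distrib distrib_right)

text \<open>All \<open>card G\<close> summands equal \<open>x\<close> divided by
  \<open>card G\<close>. Only invariance of \<open>x\<close> under the members of \<open>G\<close>
  enters, so the lemma serves both the full row group and the symmetrizer on a single row.\<close>

lemma emb_symmetrizer_absorb:
  fixes x :: "'k::field_char_0 sga"
  assumes G: "\<And>\<sigma>. \<sigma> \<in> G \<Longrightarrow> \<sigma> permutes {1..r}" "G \<noteq> {}"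
    and x: "\<And>g. pfun g \<in> G \<Longrightarrow> perm_elt g * x = x"
  shows "emb r (symmetrizer G) * x = x"
proof -
  have fin: "finite G"
    using G by (intro finite_subset [OF _ finite_permutations [of "{1..r}"]]) auto
  have "emb r (symmetrizer G) * x = (\<Sum>g\<in>symg r. (if pfun g \<in> G then (1 / of_nat (card G)) \<cdot> x else 0))"
    unfolding emb_def sum_distrib_right
  proof (rule sum.cong)
    fix g
    have "Poly_Mapping.single g (symmetrizer G (pfun g)) * x = symmetrizer G (pfun g) \<cdot> (perm_elt g * x)"
      unfolding smul_def mult.assoc [symmetric] mult_single by simp
    also have "\<dots> = (if pfun g \<in> G then (1 / of_nat (card G)) \<cdot> x else 0)"
      by (simp add: symmetrizer_def x)
    finally show "Poly_Mapping.single g (symmetrizer G (pfun g)) * x =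
        (if pfun g \<in> G then (1 / of_nat (card G)) \<cdot> x else 0)" .
  qed simp
  also have "\<dots> = (\<Sum>\<sigma> | \<sigma> permutes {1..r}. (if \<sigma> \<in> G then (1 / of_nat (card G)) \<cdot> x else 0))"
    by (rule sum_permutes_eq_symg [symmetric])
  also have "\<dots> = (\<Sum>\<sigma>\<in>G. (1 / of_nat (card G)) \<cdot> x)"
    using G by (intro sum.mono_neutral_cong_right) (auto simp: finite_permutations)
  also have "\<dots> = x"
    using fin G(2) by (simp only: sum_const_smul) simp
  finally show ?thesis .
qed

lemma row_elt_absorb:
  fixes x :: "'k::field_char_0 sga"
  assumes "\<And>p. p \<in> rowg lam \<Longrightarrow> perm_elt p * x = x"
  shows "row_elt lam * x = x"
  unfolding row_elt_def
proof (rule emb_symmetrizer_absorb)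
  show "row_group lam \<noteq> {}"
    using subgrp_rowg [of lam] by (auto simp: subgrp_def pfun_row_group [symmetric])
qed (use assms in \<open>auto simp: row_group_def pfun_row_group [symmetric]\<close>)

text \<open>Row and column elements have rational coefficients; staying rational under products is
  what later gives meaning to positivity of a sum of squares over an arbitrary field of
  characteristic zero.\<close>

lemma coeff_mult_Rats:
  fixes x y :: "'k::field_char_0 sga"
  assumes "\<And>g. coeff x g \<in> \<rat>" "\<And>g. coeff y g \<in> \<rat>"
  shows "coeff (x * y) h \<in> \<rat>"
proof -
  have "(\<Sum>g\<in>A. coeff x g * coeff y (- g + h)) \<in> \<rat>" for A
    by (intro Rats_sum Rats_mult assms)
  then show ?thesis by (simp add: coeff_mult [where A = "supp x"])
qed

text \<open>The element \<open>X = aba\<close> is symmetric with rational coefficients and satisfies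
  \<open>X\<^sup>2 = mX\<close>, where \<open>(ab)\<^sup>2 = m ab\<close>; the trace of \<open>X\<^sup>2\<close> is a sum of
  squares, so \<open>m \<noteq> 0\<close>.\<close>

lemma young_prod_square:
  assumes lam: "is_partition lam (sum_list lam)"
  obtains m :: "'k::field_char_0" where "m \<noteq> 0" "young_prod lam * young_prod lam = m \<cdot> young_prod lam"
proof -
  define X :: "'k sga" where "X = young_prod lam * row_elt lam"
  define m :: 'k where "m = coeff (young_prod lam * 1 * young_prod lam) 0 / coeff (young_prod lam) 0"
  have m: "young_prod lam * young_prod lam = m \<cdot> young_prod lam"
    using young_prod_sandwich [OF lam, of 1] by (simp add: m_def)
  have ay: "row_elt lam * young_prod lam = (young_prod lam :: 'k sga)"
    by (rule row_elt_absorb) (rule young_classD(1) [OF young_prod_class])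
  have "X * X = young_prod lam * ((row_elt lam * young_prod lam) * row_elt lam)"
    by (simp add: X_def mult.assoc)
  also have "\<dots> = m \<cdot> X"
    unfolding ay by (simp add: X_def m flip: mult.assoc)
  finally have XX: "coeff (X * X) 0 = m * coeff X 0" by simp
  have "flip X = X"
    by (simp add: X_def young_prod_def flip_mult flip_row_elt flip_col_elt mult.assoc)
  then have sym: "coeff X (- g) = coeff X g" for g
    by (metis coeff_flip)
  \<comment> \<open>Cyclicity of the trace moves the right factor to the left, where it is
    absorbed.\<close>
  have "coeff X 0 = coeff (row_elt lam * young_prod lam :: 'k sga) 0"
    unfolding X_def by (rule coeff_mult_zero_commute)
  then have X0: "coeff X 0 \<noteq> 0" by (simp add: ay coeff_young_prod_0_nonzero)
  have rat_sgn_elt: "sgn_elt g \<in> (\<rat> :: 'k set)" for g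
    by (simp add: sgn_elt_def)
  have "coeff X g \<in> \<rat>" for g
    unfolding X_def young_prod_def
    by (intro coeff_mult_Rats) (auto simp: coeff_row_elt coeff_col_elt intro!: Rats_divide rat_sgn_elt)
  then obtain r where r: "\<And>g. coeff X g = of_rat (r g)"
    unfolding Rats_def image_iff by metis
  have "coeff (X * X) 0 = (\<Sum>g\<in>supp X. coeff X g * coeff X (- g))"
    by (subst coeff_mult [where A = "supp X"]) auto
  also have "\<dots> = (\<Sum>g\<in>supp X. coeff X g * coeff X g)"
    by (simp only: sym)
  also have "\<dots> = of_rat (\<Sum>g\<in>supp X. r g * r g)"
    by (simp add: r of_rat_sum of_rat_mult)
  finally have s: "coeff (X * X) 0 = of_rat (\<Sum>g\<in>supp X. r g * r g)" .
  have "0 \<in> supp X" "r 0 \<noteq> 0" using X0 r [of 0] by (auto simp: in_keys_iff)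
  then have "(\<Sum>g\<in>supp X. r g * r g) > 0"
    by (intro sum_pos2 [of _ 0]) (auto simp: zero_less_mult_iff linorder_neq_iff)
  then have "coeff (X * X) 0 \<noteq> 0" by (simp add: s)
  then have "m \<noteq> 0" using XX by auto
  then show ?thesis using that m by blast
qed

lemma emb_inject:
  assumes "\<And>\<sigma>. \<not> \<sigma> permutes {1..r} \<Longrightarrow> x \<sigma> = 0" "\<And>\<sigma>. \<not> \<sigma> permutes {1..r} \<Longrightarrow> y \<sigma> = 0"
  shows "emb r x = emb r y \<longleftrightarrow> x = y"
  using emb_eqD [of r x y] assms by fastforce

text \<open>\<open>young_scalar\<close> is a definite description, so existence and uniqueness are
  both at stake. Idempotence of \<open>c \<cdot> young_prod lam\<close> means
  \<open>c * c * m = c\<close>, the nonzero coefficient at the identity allowing scalars to be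
  compared; with \<open>c \<noteq> 0\<close> this leaves \<open>c = 1 / m\<close>.\<close>

lemma young_scalar:
  assumes lam: "is_partition lam (sum_list lam)"
  shows "young_scalar lam \<noteq> (0 :: 'k::field_char_0)" "young_elt lam * young_elt lam = (young_elt lam :: 'k sga)"
proof -
  obtain m :: 'k where m: "m \<noteq> 0" "young_prod lam * young_prod lam = m \<cdot> young_prod lam"
    using young_prod_square [OF lam] .
  let ?n = "sum_list lam"
  let ?P = "\<lambda>c :: 'k. c \<noteq> 0 \<and> (let e = galg_scale c (young_product lam) in galg_mult ?n e e = e)"
  have P: "?P c \<longleftrightarrow> c \<noteq> 0 \<and> (c \<cdot> young_prod lam) * (c \<cdot> young_prod lam) = c \<cdot> young_prod lam" for c
  proof -
    let ?e = "galg_scale c (young_product lam)"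
    have "galg_mult ?n ?e ?e = ?e \<longleftrightarrow> emb ?n (galg_mult ?n ?e ?e) = emb ?n ?e"
      by (rule emb_inject [symmetric]) (simp_all add: galg_mult_def galg_scale_def young_product_def)
    then show ?thesis by (simp only: Let_def emb_mult emb_scale young_emb)
  qed
  have "?P c \<longleftrightarrow> c = 1 / m" for c
  proof -
    have "(c \<cdot> young_prod lam) * (c \<cdot> young_prod lam) = (c * c * m) \<cdot> young_prod lam"
      by (simp add: m(2) mult.assoc)
    moreover have "d \<cdot> young_prod lam = d' \<cdot> young_prod lam \<longleftrightarrow> d = d'" for d d' :: 'k
    proof
      assume "d \<cdot> young_prod lam = d' \<cdot> young_prod lam"
      then have "coeff (d \<cdot> young_prod lam) 0 = coeff (d' \<cdot> young_prod lam) 0" by simp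
      then show "d = d'" by (simp add: coeff_young_prod_0_nonzero)
    qed simp
    ultimately show ?thesis unfolding P using m(1) by (auto simp: field_simps)
  qed
  then have "young_scalar lam = 1 / m"
    unfolding young_scalar_def by simp
  moreover have "?P (1 / m)" using \<open>\<And>c. ?P c \<longleftrightarrow> c = 1 / m\<close> by blast
  ultimately show "young_scalar lam \<noteq> (0 :: 'k)" "young_elt lam * young_elt lam = (young_elt lam :: 'k sga)"
    using P [of "1 / m"] by (simp_all add: young_emb)
qed

lemma coeff_young_elt_0_nonzero: "is_partition lam (sum_list lam) \<Longrightarrow> coeff (young_elt lam) 0 \<noteq> (0 :: 'k::field_char_0)"
  by (simp add: young_emb young_scalar coeff_young_prod_0_nonzero)

lemma young_elt_class: "(young_elt lam :: 'k::field sga) \<in> young_class (rowg lam) (colg lam)"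
  using young_prod_class [of lam, where ?'k = 'k]
  by (intro young_classI) (simp_all add: young_emb young_classD mult.commute)

lemma perm_elt_young_elt: "p \<in> rowg lam \<Longrightarrow> perm_elt p * young_elt lam = (young_elt lam :: 'k::field sga)"
  by (rule young_classD(1) [OF young_elt_class])

text \<open>That some multiple occurs follows from the line above. Taking the trace and cycling one
  factor \<open>young_elt lam\<close> to the front, where idempotence merges it with the other,
  computes which multiple it is.\<close>

lemma young_elt_sandwich:
  fixes x :: "'k::field_char_0 sga"
  assumes lam: "is_partition lam (sum_list lam)" and supp: "supp x \<subseteq> symg (sum_list lam)"
  shows "young_elt lam * x * young_elt lam = (coeff (young_elt lam * x) 0 / coeff (young_elt lam) 0) \<cdot> young_elt lam"
proof -
  have "young_elt lam * x * young_elt lam = (young_scalar lam * young_scalar lam) \<cdot> (young_prod lam * x * young_prod lam)"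
    by (simp add: young_emb mult.assoc)
  also have "\<dots> \<in> (\<lambda>d. d \<cdot> young_prod lam) ` UNIV"
    by (subst young_prod_sandwich [OF assms]) simp
  finally obtain d' where "young_elt lam * x * young_elt lam = d' \<cdot> young_prod lam" by auto
  also have "\<dots> = (d' / young_scalar lam) \<cdot> young_elt lam"
    by (simp add: young_emb young_scalar [OF lam])
  finally obtain d where d: "young_elt lam * x * young_elt lam = d \<cdot> young_elt lam" by auto
  have "d * coeff (young_elt lam) 0 = coeff (young_elt lam * x * young_elt lam) 0" by (simp add: d)
  also have "\<dots> = coeff (young_elt lam * (young_elt lam * x)) 0" by (rule coeff_mult_zero_commute)
  also have "\<dots> = coeff (young_elt lam * x) 0" by (simp add: young_scalar [OF lam] flip: mult.assoc)
  finally have "d = coeff (young_elt lam * x) 0 / coeff (young_elt lam) 0"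
    using coeff_young_elt_0_nonzero [OF lam, where ?'k = 'k] by (simp add: field_simps)
  then show ?thesis using d by simp
qed

lemma sandwich_0:
  fixes x u v :: "'k::field sga"
  assumes "supp x \<subseteq> symg r" "\<And>g. g \<in> symg r \<Longrightarrow> u * perm_elt g * v = 0"
  shows "u * x * v = 0"
proof -
  have "u * x * v = (\<Sum>g\<in>symg r. coeff x g \<cdot> (u * perm_elt g * v))"
    by (subst sga_eq_sum_perm_elt [OF assms(1)])
       (simp_all add: sum_distrib_left sum_distrib_right mult.assoc)
  then show ?thesis using assms(2) by simp
qed

text \<open>If dominance fails, no permutation is injective in the sense required there, so each
  \<open>g\<close> has a clashing transposition. Inserted between the factors it is absorbed by the
  row element and negates the column element, so each term is its own negative.\<close>

lemma row_elt_col_elt_0: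
  assumes lam: "is_partition lam n" and mu: "is_partition mu n"
    and nd: "\<not> (\<forall>k. offset lam (Suc k) \<le> offset mu (Suc k))"
    and x: "supp x \<subseteq> symg n"
  shows "row_elt lam * x * col_elt mu = (0 :: 'k::field_char_0 sga)"
    "col_elt mu * x * row_elt lam = (0 :: 'k::field_char_0 sga)"
proof -
  have n: "sum_list lam = n" "sum_list mu = n" using lam mu by (simp_all add: is_partition_def)
  have neg: "z = - z \<Longrightarrow> z = 0" for z :: "'k sga"
    by (rule poly_mapping_eqI) (metis eq_neg_imp_0 lookup_uminus lookup_zero)
  have clash: "\<exists>t. t \<in> rowg lam \<and> - g + t + g \<in> colg mu \<and> sgn_elt (- g + t + g) = (- 1 :: 'k)"
    if g: "g \<in> symg n" for g
  proof -
    have "\<not> inj_on (\<lambda>x. (rw lam x, cl mu (pfun (- g) x))) {1..sum_list lam}"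
      using dominance [of mu lam "- g"] mu g nd n by auto
    then show ?thesis using clash_transposition [of mu lam g, where ?'k = 'k] g n by metis
  qed
  show "row_elt lam * x * col_elt mu = 0"
  proof (rule sandwich_0 [OF x])
    fix g assume "g \<in> symg n"
    then obtain t where t: "t \<in> rowg lam" "- g + t + g \<in> colg mu" "sgn_elt (- g + t + g) = (- 1 :: 'k)"
      using clash by blast
    have "row_elt lam * perm_elt g * col_elt mu = row_elt lam * perm_elt t * perm_elt g * (col_elt mu :: 'k sga)"
      using t by (simp add: row_elt_perm_elt)
    also have "\<dots> = row_elt lam * perm_elt g * (perm_elt (- g + t + g) * col_elt mu)"
      by (simp add: mult.assoc perm_elt_mult_assoc) (simp add: add.assoc [symmetric])
    also have "\<dots> = - (row_elt lam * perm_elt g * col_elt mu)"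
      using t by (simp add: perm_elt_col_elt)
    finally show "row_elt lam * perm_elt g * col_elt mu = (0 :: 'k sga)" by (rule neg)
  qed
  show "col_elt mu * x * row_elt lam = 0"
  proof (rule sandwich_0 [OF x])
    fix g assume "g \<in> symg n"
    then obtain t where t: "t \<in> rowg lam" "g + t + - g \<in> colg mu" "sgn_elt (g + t + - g) = (- 1 :: 'k)"
      using clash [of "- g"] by auto
    have "col_elt mu * perm_elt g * row_elt lam = col_elt mu * perm_elt g * (perm_elt t * row_elt lam :: 'k sga)"
      using t by (simp add: perm_elt_row_elt)
    also have "\<dots> = (col_elt mu * perm_elt (g + t + - g)) * perm_elt g * row_elt lam"
      by (simp only: mult.assoc perm_elt_mult_assoc) (simp add: add.assoc)
    also have "\<dots> = - (col_elt mu * perm_elt g * row_elt lam)"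
      unfolding col_elt_perm_elt [OF t(2)] t(3) by simp
    finally show "col_elt mu * perm_elt g * row_elt lam = (0 :: 'k sga)" by (rule neg)
  qed
qed

text \<open>Dominance is antisymmetric, so for different shapes it fails in one of the two
  directions. Depending on the direction, either the outer pair (row element of \<open>lam\<close>,
  column element of \<open>mu\<close>) or the inner pair (column element of \<open>lam\<close>, row
  element of \<open>mu\<close>) annihilates.\<close>

lemma young_elt_orthogonal:
  fixes x :: "'k::field_char_0 sga"
  assumes lam: "is_partition lam n" and mu: "is_partition mu n" and ne: "lam \<noteq> mu"
    and x: "supp x \<subseteq> symg n"
  shows "young_elt lam * x * young_elt mu = 0"
proof -
  have n: "sum_list lam = n" "sum_list mu = n" using lam mu by (simp_all add: is_partition_def)
  have s: "supp (col_elt lam * x * row_elt mu) \<subseteq> symg n"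
    using supp_col_elt [of lam, where ?'k = 'k] supp_row_elt [of mu, where ?'k = 'k] x n
    by (intro supp_mult_symg) auto
  have e: "young_elt lam * x * young_elt mu =
      (young_scalar lam * young_scalar mu) \<cdot> (row_elt lam * (col_elt lam * x * row_elt mu) * col_elt mu)"
    by (simp add: young_emb young_prod_def mult.assoc mult.commute [of "young_scalar mu"])
  have "\<not> (\<forall>k. offset lam (Suc k) \<le> offset mu (Suc k)) \<or> \<not> (\<forall>k. offset mu (Suc k) \<le> offset lam (Suc k))"
    using offset_inject [OF lam mu] ne by (meson antisym)
  then show ?thesis
  proof
    assume "\<not> (\<forall>k. offset lam (Suc k) \<le> offset mu (Suc k))"
    from row_elt_col_elt_0(1) [OF lam mu this s] show ?thesis by (simp add: e)
  next
    assume "\<not> (\<forall>k. offset mu (Suc k) \<le> offset lam (Suc k))"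
    from row_elt_col_elt_0(2) [OF mu lam this x] show ?thesis by (simp add: e)
  qed
qed

section \<open>Adding a box\<close>

lemma young_class_coeff:
  fixes x :: "'k::field sga"
  assumes x: "x \<in> young_class (rowg lam) (colg lam)"
  shows "p \<in> rowg lam \<Longrightarrow> q \<in> colg lam \<Longrightarrow> coeff x (p + q) = sgn_elt q * coeff x 0"
proof -
  assume pq: "p \<in> rowg lam" "q \<in> colg lam"
  have "coeff x (p + q) = coeff (perm_elt (- p) * x * perm_elt (- q)) 0"
    by (simp add: minus_add)
  also have "perm_elt (- p) * x = x"
    using pq by (intro young_classD(1) [OF x]) (simp add: subgrp_uminus [OF subgrp_rowg])
  also have "x * perm_elt (- q) = sgn_elt (- q) \<cdot> x"
    using pq by (intro young_classD(2) [OF x]) (simp add: subgrp_uminus [OF subgrp_colg])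
  finally show ?thesis by simp
qed

lemma supp_young_elt_cases:
  assumes "coeff (young_elt lam) g \<noteq> (0 :: 'k::field)"
  obtains p q where "p \<in> rowg lam" "q \<in> colg lam" "g = p + q"
proof -
  have "coeff (young_prod lam) g \<noteq> (0 :: 'k)" using assms by (auto simp: young_emb)
  then have "g \<in> supp (row_elt lam * col_elt lam :: 'k sga)" by (simp add: young_prod_def in_keys_iff)
  then obtain p q where "p \<in> supp (row_elt lam :: 'k sga)" "q \<in> supp (col_elt lam :: 'k sga)" "g = p + q"
    using keys_mult by blast
  then show ?thesis
    using that by (auto simp: in_keys_iff coeff_row_elt coeff_col_elt split: if_splits)
qed

context
  fixes lam :: "nat list" and m s :: nat
  assumes lam: "is_partition lam m" and s: "s \<in> addable lam"
begin

lemma sum_lam: "sum_list lam = m"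
  using lam by (simp add: is_partition_def)

lemma s_bounds: "1 \<le> s" "s \<le> length lam + 1"
  using s by (simp_all add: addable_def)

lemma is_partition_add_box: "is_partition (add_box lam s) (Suc m)"
  using s by (simp add: addable_def sum_lam)

lemma sum_add_box: "sum_list (add_box lam s) = Suc m"
  using is_partition_add_box by (simp add: is_partition_def)

lemma part_add_box: "1 \<le> i \<Longrightarrow> part (add_box lam s) i = part lam i + (if i = s then 1 else 0)"
  using s_bounds by (auto simp: part_def add_box_def nth_append nth_list_update)

lemma offset_add_box: "offset (add_box lam s) i = offset lam i + (if s < i then 1 else 0)"
proof -
  have "offset (add_box lam s) i = (\<Sum>j = 1..<i. part lam j + (if j = s then 1 else 0))"
    unfolding offset_def by (rule sum.cong) (auto simp: part_add_box)
  then show ?thesis using s_bounds by (auto simp: sum.distrib offset_def)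
qed

definition box where "box = offset lam s + part lam s + 1"

lemma box_bounds: "1 \<le> box" "box \<le> Suc m"
  using offset_le [of lam "Suc s"] s_bounds by (simp_all add: box_def offset_Suc sum_lam)

lemma w_perm_eq: "w_perm lam s i = (if i = box then Suc m else if box < i \<and> i \<le> Suc m then i - 1 else i)"
  by (simp add: w_perm_def box_def sum_lam Let_def)

lemma w_perm_permutes: "w_perm lam s permutes {1..Suc m}"
proof (rule bij_imp_permutes)
  have "inj_on (w_perm lam s) {1..Suc m}"
    using box_bounds by (auto simp: inj_on_def w_perm_eq split: if_splits)
  moreover have "w_perm lam s ` {1..Suc m} \<subseteq> {1..Suc m}"
    using box_bounds by (auto simp: w_perm_eq)
  ultimately show "bij_betw (w_perm lam s) {1..Suc m} {1..Suc m}"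
    by (simp add: bij_betw_def endo_inj_surj)
qed (use box_bounds in \<open>auto simp: w_perm_eq\<close>)

definition w_elt where "w_elt = Perm (w_perm lam s)"

lemma pfun_w_elt: "pfun w_elt = w_perm lam s" and w_elt_symg: "w_elt \<in> symg (Suc m)"
  using w_perm_permutes by (simp_all add: w_elt_def pfun_Perm Perm_in_symg del: One_nat_def)

lemma cells_add_box: "cells (add_box lam s) = insert (s, part lam s + 1) (cells lam)"
  using s_bounds by (auto simp: cells_def part_add_box split: if_splits)

lemma strand_box: "strand (add_box lam s) (s, part lam s + 1) = box"
  by (simp add: strand_def offset_add_box box_def)

text \<open>The permutation translates between the two row readings: an old box keeps its row and
  column, and its strand number differs by one exactly in the rows below \<open>s\<close>.\<close>

lemma w_perm_strand:
  assumes "(i, c) \<in> cells lam"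
  shows "w_perm lam s (strand (add_box lam s) (i, c)) = strand lam (i, c)"
proof -
  have c: "1 \<le> i" "1 \<le> c" "c \<le> part lam i" using assms by (auto simp: cells_def)
  consider "i < s" | "i = s" | "s < i" by linarith
  then show ?thesis
  proof cases
    case 1
    then have "offset lam (Suc i) \<le> offset lam s" by (intro offset_mono) simp
    then show ?thesis using c 1 by (simp add: w_perm_eq strand_def offset_add_box box_def offset_Suc)
  next
    case 2
    then show ?thesis using c by (simp add: w_perm_eq strand_def offset_add_box box_def)
  next
    case 3
    then have "offset lam (Suc s) \<le> offset lam i" by (intro offset_mono) simp
    moreover have "offset lam (Suc i) \<le> m" using offset_le [of lam "Suc i"] by (simp add: sum_lam)
    ultimately show ?thesis
      using c 3 s_bounds by (simp add: w_perm_eq strand_def offset_add_box box_def offset_Suc)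
  qed
qed

lemma rw_cl_w_elt:
  assumes "x \<in> {1..Suc m}" "x \<noteq> box"
  shows "rw (add_box lam s) x = rw lam (pfun w_elt x)" "cl (add_box lam s) x = cl lam (pfun w_elt x)"
    "pfun w_elt x \<in> {1..m}"
proof -
  let ?mu = "add_box lam s"
  have x: "x \<in> {1..sum_list ?mu}" using assms by (simp add: sum_add_box)
  obtain i c where ic: "(i, c) = (rw ?mu x, cl ?mu x)" by auto
  then have *: "(i, c) \<in> cells ?mu" "x = strand ?mu (i, c)"
    using rw_cl_cells [OF x] strand_rw_cl [OF x] by auto
  then have "(i, c) \<in> cells lam" using assms(2) strand_box by (auto simp: cells_add_box)
  then have **: "(i, c) \<in> cells lam" "pfun w_elt x = strand lam (i, c)"
    using * w_perm_strand by (auto simp: pfun_w_elt)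
  then show "rw ?mu x = rw lam (pfun w_elt x)" "cl ?mu x = cl lam (pfun w_elt x)"
    using ic by auto
  show "pfun w_elt x \<in> {1..m}" using ** strand_in [of "(i, c)" lam] by (simp add: sum_lam)
qed

lemma w_elt_box: "pfun w_elt box = Suc m"
  by (simp add: pfun_w_elt w_perm_eq)

lemma symg_fix_last: "g \<in> symg (Suc r) \<Longrightarrow> pfun g (Suc r) = Suc r \<Longrightarrow> g \<in> symg r"
  unfolding symg_def mem_Collect_eq by (rule permutes_fix_last)

lemma symg_last: "g \<in> symg r \<Longrightarrow> pfun g (Suc r) = Suc r"
  by (rule pfun_outside) auto

lemma conj_w_elt:
  assumes "h \<in> symg (Suc m)" "pfun h box = box"
  shows "w_elt + h - w_elt \<in> symg m"
proof (rule symg_fix_last)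
  show "w_elt + h - w_elt \<in> symg (Suc m)" using assms w_elt_symg by (intro symg_closed)
  have "pfun (- w_elt) (Suc m) = box" by (metis w_elt_box pfun_uminus_pfun)
  then show "pfun (w_elt + h - w_elt) (Suc m) = Suc m"
    using assms(2) w_elt_box by (simp add: pfun_plus diff_conv_add_uminus del: add_uminus_conv_diff)
qed

text \<open>Conjugation by \<open>w_elt\<close> identifies S_m with permutations fixing the new box.
  Since \<open>w_elt\<close> preserves rows and columns of the old boxes, row and column groups
  correspond as well.\<close>

lemma
  assumes g: "g \<in> symg m"
  shows conj_box: "pfun (- w_elt + g + w_elt) box = box"
    and conj_rowg: "- w_elt + g + w_elt \<in> rowg (add_box lam s) \<longleftrightarrow> g \<in> rowg lam"
    and conj_colg: "- w_elt + g + w_elt \<in> colg (add_box lam s) \<longleftrightarrow> g \<in> colg lam"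
proof -
  let ?h = "- w_elt + g + w_elt" and ?N = "{1..Suc m}"
  have "g \<in> symg (Suc m)" using g symg_mono [of m "Suc m"] by auto
  then have h: "?h \<in> symg (Suc m)" using w_elt_symg by (intro symg_closed) simp_all
  have "pfun ?h box = pfun (- w_elt) (Suc m)" using symg_last [OF g] by (simp add: pfun_plus w_elt_box)
  also have "\<dots> = box" by (metis w_elt_box pfun_uminus_pfun)
  finally show b: "pfun ?h box = box" .
  have nb: "pfun ?h x \<in> ?N" "pfun ?h x \<noteq> box" if "x \<in> ?N" "x \<noteq> box" for x
    using that b pfun_in_interval [OF h, of x] pfun_uminus_pfun [of ?h x] pfun_uminus_pfun [of ?h box]
    by metis+
  have wh: "pfun w_elt (pfun ?h x) = pfun g (pfun w_elt x)" for x
    by (simp add: pfun_plus)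
  have preim: "\<exists>x\<in>?N. x \<noteq> box \<and> pfun w_elt x = y" if "y \<in> {1..m}" for y
  proof (intro bexI conjI)
    have "y \<in> ?N" using that by simp
    then show "pfun (- w_elt) y \<in> ?N" using pfun_in_interval [of "- w_elt" "Suc m" y] w_elt_symg by simp
    show "pfun (- w_elt) y \<noteq> box"
    proof
      assume "pfun (- w_elt) y = box"
      then have "y = Suc m" by (metis pfun_pfun_uminus w_elt_box)
      then show False using that by simp
    qed
  qed simp
  \<comment> \<open>One equivalence serves rows and columns. At \<open>box\<close> the left
    condition is automatic because \<open>?h\<close> fixes it, and \<open>w_elt\<close> carries the
    remaining points onto \<open>{1..m}\<close>.\<close>
  have key: "(\<forall>x\<in>?N. f' (pfun ?h x) = f' x) \<longleftrightarrow> (\<forall>y\<in>{1..m}. f (pfun g y) = f y)"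
    if f: "\<And>x. x \<in> ?N \<Longrightarrow> x \<noteq> box \<Longrightarrow> f' x = f (pfun w_elt x)" for f f' :: "nat \<Rightarrow> nat"
  proof (intro iffI ballI)
    fix y assume *: "\<forall>x\<in>?N. f' (pfun ?h x) = f' x" "y \<in> {1..m}"
    then obtain x where x: "x \<in> ?N" "x \<noteq> box" "pfun w_elt x = y" using preim by blast
    then show "f (pfun g y) = f y"
      using * f [of x] f [of "pfun ?h x"] nb [of x] wh [of x] by metis
  next
    fix x assume *: "\<forall>y\<in>{1..m}. f (pfun g y) = f y" "x \<in> ?N"
    show "f' (pfun ?h x) = f' x"
    proof (cases "x = box")
      case False
      then show ?thesis
        using * f [of x] f [of "pfun ?h x"] nb [of x] wh [of x] rw_cl_w_elt(3) [of x] by metis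
    qed (simp add: b)
  qed
  show "?h \<in> rowg (add_box lam s) \<longleftrightarrow> g \<in> rowg lam"
    using key [of "rw (add_box lam s)" "rw lam"] rw_cl_w_elt(1) h g
    unfolding rowg_def sum_add_box sum_lam by blast
  show "?h \<in> colg (add_box lam s) \<longleftrightarrow> g \<in> colg lam"
    using key [of "cl (add_box lam s)" "cl lam"] rw_cl_w_elt(2) h g
    unfolding colg_def sum_add_box sum_lam by blast
qed

text \<open>The ratio of the two coefficients is the same for all \<open>g\<close> in S_m, written
  without division. If \<open>g = p + q\<close> in the groups of \<open>lam\<close>, both
  coefficients are \<open>sgn_elt q\<close> times their value at \<open>0\<close>. Otherwise both
  vanish, since a factorization of the conjugate in the groups of the larger shape would descend to
  one of \<open>g\<close>.\<close>

lemma coeff_young_elt_add_box: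
  assumes g: "g \<in> symg m"
  shows "coeff (young_elt (add_box lam s)) (- w_elt + g + w_elt) * coeff (young_elt lam) 0 =
    coeff (young_elt (add_box lam s)) 0 * (coeff (young_elt lam) g :: 'k::field_char_0)"
proof (cases "\<exists>p\<in>rowg lam. \<exists>q\<in>colg lam. g = p + q")
  case True
  then obtain p q where pq: "p \<in> rowg lam" "q \<in> colg lam" "g = p + q" by blast
  then have pq': "p \<in> symg m" "q \<in> symg m" by (auto simp: rowg_def colg_def sum_lam)
  have "- w_elt + g + w_elt = (- w_elt + p + w_elt) + (- w_elt + q + w_elt)"
    by (simp add: pq add.assoc)
  moreover have "- w_elt + p + w_elt \<in> rowg (add_box lam s)" "- w_elt + q + w_elt \<in> colg (add_box lam s)"
    using pq pq' conj_rowg conj_colg by blast+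
  moreover have "sgn_elt (- w_elt + q + w_elt) = (sgn_elt q :: 'k)"
  proof -
    have "sgn_elt (- w_elt + q + w_elt) = (sgn_elt q * (sgn_elt w_elt * sgn_elt w_elt) :: 'k)" by (simp add: sgn_elt_add)
    then show ?thesis by simp
  qed
  ultimately have "coeff (young_elt (add_box lam s)) (- w_elt + g + w_elt) = (sgn_elt q * coeff (young_elt (add_box lam s)) 0 :: 'k)"
    using young_class_coeff [OF young_elt_class] by metis
  then show ?thesis using young_class_coeff [OF young_elt_class pq(1,2), where ?'k = 'k] pq(3) by simp
next
  case False
  then have "coeff (young_elt lam) g = (0 :: 'k)" using supp_young_elt_cases by metis
  moreover have "coeff (young_elt (add_box lam s)) (- w_elt + g + w_elt) = (0 :: 'k)"
  proof (rule ccontr)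
    let ?mu = "add_box lam s"
    assume "\<not> ?thesis"
    then obtain p q where pq: "p \<in> rowg ?mu" "q \<in> colg ?mu" "- w_elt + g + w_elt = p + q"
      using supp_young_elt_cases by metis
    then have pqs: "p \<in> symg (Suc m)" "q \<in> symg (Suc m)" by (auto simp: rowg_def colg_def sum_add_box)
    have bN: "box \<in> {1..sum_list ?mu}" using box_bounds by (simp add: sum_add_box)
    have qN: "pfun q box \<in> {1..sum_list ?mu}"
      using pfun_in_interval [OF pqs(2), of box] bN unfolding sum_add_box by blast
    have pqb: "pfun p (pfun q box) = box"
      using conj_box [OF g] pq(3) by (simp add: pfun_plus)
    \<comment> \<open>\<open>q\<close> keeps the column of \<open>box\<close>, and its row as well
      because \<open>p\<close>, which preserves rows, brings it back to \<open>box\<close>. Hence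
      both factors fix the new box and come from S_m.\<close>
    have "pfun q box = box"
    proof (rule rw_cl_eq_imp_eq [OF qN bN])
      show "cl ?mu (pfun q box) = cl ?mu box" using pq(2) bN by (simp add: colg_def)
      have "rw ?mu (pfun p (pfun q box)) = rw ?mu (pfun q box)" using pq(1) qN by (simp add: rowg_def)
      then show "rw ?mu (pfun q box) = rw ?mu box" by (simp add: pqb)
    qed
    then have qb: "pfun q box = box" "pfun p box = box" using pqb by simp_all
    define p' q' where "p' = w_elt + p - w_elt" and "q' = w_elt + q - w_elt"
    have "p' \<in> symg m" "q' \<in> symg m"
      unfolding p'_def q'_def using qb pqs by (blast intro: conj_w_elt)+
    moreover have "- w_elt + p' + w_elt = p" "- w_elt + q' + w_elt = q"
      by (simp_all add: p'_def q'_def flip: add.assoc add_uminus_conv_diff) (simp_all add: add.assoc)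
    ultimately have "p' \<in> rowg lam" "q' \<in> colg lam" using pq conj_rowg conj_colg by metis+
    moreover have "g = p' + q'"
    proof -
      have "g = w_elt + (- w_elt + g + w_elt) - w_elt" by (simp add: add.assoc flip: add_uminus_conv_diff)
      also have "\<dots> = p' + q'" unfolding pq(3) p'_def q'_def by (simp add: add.assoc flip: add_uminus_conv_diff)
      finally show ?thesis .
    qed
    ultimately show False using False by blast
  qed
  ultimately show ?thesis by simp
qed

definition iota_elt :: "'k::field sga" where "iota_elt = young_elt lam * perm_elt w_elt * young_elt (add_box lam s)"
definition rho_elt :: "'k::field sga" where "rho_elt = young_elt (add_box lam s) * perm_elt (- w_elt) * young_elt lam"

text \<open>With \<open>e\<close> and \<open>f\<close> the idempotents of the larger and smaller
  shape, the product is \<open>e\<close> times the trace of \<open>e * ?x\<close> over the trace of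
  \<open>e\<close>. As \<open>f\<close> is supported on S_m, only coefficients of \<open>e\<close>
  on conjugates of S_m enter; replacing them by proportional coefficients of \<open>f\<close> turns
  the sum into the trace of \<open>f * f = f\<close>, and the constants of proportionality cancel,
  leaving the factor 1.\<close>

lemma rho_elt_iota_elt: "rho_elt * iota_elt = (young_elt (add_box lam s) :: 'k::field_char_0 sga)"
proof -
  let ?mu = "add_box lam s"
  let ?e = "young_elt ?mu :: 'k sga" and ?f = "young_elt lam :: 'k sga"
  have lam': "is_partition lam (sum_list lam)" and mu': "is_partition ?mu (sum_list ?mu)"
    using lam is_partition_add_box by (simp_all add: sum_lam sum_add_box)
  have "coeff ?f 0 * coeff (?f * (perm_elt w_elt * ?e * perm_elt (- w_elt))) 0
      = coeff ?f 0 * (\<Sum>g\<in>symg m. coeff ?f g * coeff (perm_elt w_elt * ?e * perm_elt (- w_elt)) (- g))"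
    using supp_young_elt [of lam, where ?'k = 'k] by (subst coeff_mult [where A = "symg m"]) (simp_all add: sum_lam)
  also have "\<dots> = (\<Sum>g\<in>symg m. coeff ?f g * (coeff ?e (- w_elt + - g + w_elt) * coeff ?f 0))"
    by (simp add: sum_distrib_left mult_ac add.assoc flip: add_uminus_conv_diff)
  also have "\<dots> = (\<Sum>g\<in>symg m. coeff ?f g * (coeff ?e 0 * coeff ?f (- g)))"
    by (rule sum.cong) (simp_all add: coeff_young_elt_add_box del: add_uminus_conv_diff)
  also have "\<dots> = coeff ?e 0 * coeff (?f * ?f) 0"
    using supp_young_elt [of lam, where ?'k = 'k]
    by (subst coeff_mult [where A = "symg m"]) (simp_all add: sum_lam sum_distrib_left mult_ac)
  also have "?f * ?f = ?f" by (rule young_scalar(2) [OF lam'])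
  finally have *: "coeff (?f * (perm_elt w_elt * ?e * perm_elt (- w_elt))) 0 = coeff ?e 0"
    using coeff_young_elt_0_nonzero [OF lam', where ?'k = 'k] by simp
  let ?x = "perm_elt (- w_elt) * ?f * perm_elt w_elt"
  have "supp ?x \<subseteq> symg (sum_list ?mu)"
    using supp_young_elt [of lam, where ?'k = 'k] symg_mono [of m "Suc m"] w_elt_symg
    by (intro supp_mult_symg supp_perm_elt_symg) (auto simp: sum_lam sum_add_box)
  note young_elt_sandwich [OF mu' this]
  also have "coeff (?e * ?x) 0 = coeff ((?e * perm_elt (- w_elt)) * (?f * perm_elt w_elt)) 0" by (simp only: mult.assoc)
  also have "\<dots> = coeff ((?f * perm_elt w_elt) * (?e * perm_elt (- w_elt))) 0" by (rule coeff_mult_zero_commute)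
  also have "\<dots> = coeff ?e 0" using * by (simp only: mult.assoc)
  finally have "?e * ?x * ?e = ?e"
    using coeff_young_elt_0_nonzero [OF mu', where ?'k = 'k] by simp
  moreover have "rho_elt * iota_elt = ?e * (perm_elt (- w_elt) * (?f * ?f) * perm_elt w_elt) * ?e"
    unfolding rho_elt_def iota_elt_def by (simp only: mult.assoc)
  ultimately show ?thesis by (simp add: young_scalar(2) [OF lam'])
qed

lemma supp_iota_elt: "supp (iota_elt :: 'k::field sga) \<subseteq> symg (Suc m)"
  and supp_rho_elt: "supp (rho_elt :: 'k::field sga) \<subseteq> symg (Suc m)"
  using supp_young_elt [of lam, where ?'k = 'k] supp_young_elt [of "add_box lam s", where ?'k = 'k]
    symg_mono [of m "Suc m"] w_elt_symg
  unfolding iota_elt_def rho_elt_def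
  by (intro supp_mult_symg supp_perm_elt_symg; auto simp: sum_lam sum_add_box)+

end

section \<open>Conjugacy of permutations under the stabilizer of the last point\<close>

text \<open>Forward iterates are enough: on a finite set a bijection returns to its starting point,
  so this is the whole cycle.\<close>

definition cyc :: "('a \<Rightarrow> 'a) \<Rightarrow> 'a \<Rightarrow> 'a set" where
  "cyc f x = range (\<lambda>i. (f ^^ i) x)"

lemma self_in_cyc: "x \<in> cyc f x"
  unfolding cyc_def by (rule range_eqI [where x = 0]) simp

lemma cyc_step: "y \<in> cyc f x \<Longrightarrow> f y \<in> cyc f x"
proof -
  assume "y \<in> cyc f x"
  then obtain i where "y = (f ^^ i) x" by (auto simp: cyc_def)
  then have "f y = (f ^^ Suc i) x" by simp
  then show "f y \<in> cyc f x" unfolding cyc_def by (rule range_eqI)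
qed

lemma bij_betw_funpow: "bij_betw f A A \<Longrightarrow> bij_betw (f ^^ i) A A"
  by (induction i) (auto simp: bij_betw_id intro: bij_betw_trans)

lemma cyc_period:
  assumes f: "bij_betw f A A" and "finite A" and x: "x \<in> A"
  obtains l where "0 < l" "(f ^^ l) x = x" "bij_betw (\<lambda>i. (f ^^ i) x) {..<l} (cyc f x)"
proof -
  have mem: "(f ^^ i) x \<in> A" for i
    using bij_betw_funpow [OF f, of i] x by (metis bij_betwE)
  have cancel: "(f ^^ (j - i)) x = x" if "i < j" "(f ^^ i) x = (f ^^ j) x" for i j
  proof -
    have "(f ^^ i) ((f ^^ (j - i)) x) = (f ^^ i) x"
      using that by (metis comp_apply funpow_add le_add_diff_inverse less_imp_le)
    then show ?thesis
      using bij_betw_funpow [OF f, of i] mem x by (metis bij_betw_def inj_on_def)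
  qed
  define l where "l = (LEAST l. 0 < l \<and> (f ^^ l) x = x)"
  have "\<exists>l. 0 < l \<and> (f ^^ l) x = x"
  proof -
    have "\<not> inj_on (\<lambda>i. (f ^^ i) x) {..card A}"
    proof
      assume "inj_on (\<lambda>i. (f ^^ i) x) {..card A}"
      then have "card {..card A} \<le> card A"
        using mem \<open>finite A\<close> by (intro card_inj_on_le) auto
      then show False by simp
    qed
    then obtain i j where "i \<noteq> j" "(f ^^ i) x = (f ^^ j) x" by (auto simp: inj_on_def)
    then have "\<exists>i j. i < j \<and> (f ^^ i) x = (f ^^ j) x" by (metis linorder_neqE_nat)
    then show ?thesis using cancel by (metis zero_less_diff)
  qed
  then have "0 < l \<and> (f ^^ l) x = x" unfolding l_def by (rule LeastI_ex)
  then have l: "0 < l" "(f ^^ l) x = x" by simp_all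
  have least: "\<not> (0 < k \<and> (f ^^ k) x = x)" if "k < l" for k
    using that unfolding l_def by (rule not_less_Least)
  have ne: "(f ^^ i) x \<noteq> (f ^^ j) x" if "i < j" "j < l" for i j
    using cancel [of i j] least [of "j - i"] that by auto
  have "inj_on (\<lambda>i. (f ^^ i) x) {..<l}"
  proof (rule inj_onI, rule ccontr)
    fix i j assume "i \<in> {..<l}" "j \<in> {..<l}" "(f ^^ i) x = (f ^^ j) x" "i \<noteq> j"
    then show False using ne [of i j] ne [of j i] by (cases "i < j") auto
  qed
  moreover have "(\<lambda>i. (f ^^ i) x) ` {..<l} = cyc f x"
  proof -
    have "(f ^^ i) x \<in> (\<lambda>i. (f ^^ i) x) ` {..<l}" for i
      using l funpow_mod_eq [of l f x i] by (intro image_eqI [where x = "i mod l"]) auto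
    then show ?thesis by (auto simp: cyc_def)
  qed
  ultimately show ?thesis using that l by (auto simp: bij_betw_def)
qed

lemma cyc_subset: "bij_betw f A A \<Longrightarrow> x \<in> A \<Longrightarrow> cyc f x \<subseteq> A"
proof -
  assume f: "bij_betw f A A" and x: "x \<in> A"
  have "(f ^^ i) x \<in> A" for i
    using bij_betw_apply [OF bij_betw_funpow [OF f] x] .
  then show "cyc f x \<subseteq> A" unfolding cyc_def by (rule image_subsetI)
qed

lemma cyc_eq:
  assumes "bij_betw f A A" "finite A" "x \<in> A" "y \<in> cyc f x"
  shows "cyc f y = cyc f x"
proof -
  have sub: "cyc f v \<subseteq> cyc f u" if v: "v \<in> cyc f u" for u v
  proof -
    obtain i where "v = (f ^^ i) u" using v by (auto simp: cyc_def)
    then have "(f ^^ k) v = (f ^^ (k + i)) u" for k by (simp add: funpow_add)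
    then show ?thesis by (auto simp: cyc_def)
  qed
  obtain l where l: "0 < l" "(f ^^ l) x = x" "bij_betw (\<lambda>i. (f ^^ i) x) {..<l} (cyc f x)"
    using cyc_period [OF assms(1-3)] .
  then obtain i where i: "i < l" "y = (f ^^ i) x"
    using assms(4) by (auto simp: bij_betw_def)
  have "(f ^^ (l - i)) y = (f ^^ (l - i + i)) x" by (simp add: i funpow_add)
  also have "\<dots> = x" using i l by simp
  finally have "x \<in> cyc f y" unfolding cyc_def by (metis rangeI)
  then show ?thesis using sub [of x y] sub [OF assms(4)] by blast
qed

lemma bij_betw_cyc_complement:
  assumes f: "bij_betw f A A" "finite A" and x: "x \<in> A"
  shows "bij_betw f (A - cyc f x) (A - cyc f x)"
    "cyc f ` (A - cyc f x) = cyc f ` A - {cyc f x}" 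
proof -
  have fin: "finite (cyc f x)" using cyc_subset [OF f(1) x] f(2) by (rule finite_subset)
  have inj: "inj_on f (cyc f x)" using f(1) cyc_subset [OF f(1) x] by (auto simp: bij_betw_def intro: inj_on_subset)
  have "f ` cyc f x = cyc f x" by (rule endo_inj_surj [OF fin _ inj]) (auto intro: cyc_step)
  with inj have c: "bij_betw f (cyc f x) (cyc f x)" by (simp add: bij_betw_def)
  show "bij_betw f (A - cyc f x) (A - cyc f x)"
    using cyc_subset [OF f(1) x] f(1) c by (intro bij_betw_DiffI)
  show "cyc f ` (A - cyc f x) = cyc f ` A - {cyc f x}"
  proof (intro equalityI subsetI)
    fix C assume "C \<in> cyc f ` (A - cyc f x)"
    then obtain y where y: "y \<in> A" "y \<notin> cyc f x" "C = cyc f y" by blast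
    then show "C \<in> cyc f ` A - {cyc f x}" using self_in_cyc [of y f] by auto
  next
    fix C assume "C \<in> cyc f ` A - {cyc f x}"
    then obtain y where y: "y \<in> A" "C = cyc f y" "C \<noteq> cyc f x" by blast
    then show "C \<in> cyc f ` (A - cyc f x)" using cyc_eq [OF f x, of y] by blast
  qed
qed

text \<open>Iterates of \<open>x\<close> are matched with iterates of \<open>y\<close>. Equal
  lengths make the matching compatible at the step where both cycles close up. The base points are
  matched so that a marked point can be kept fixed.\<close>

lemma cyc_iso:
  assumes f: "bij_betw f A A" "finite A" "x \<in> A" and g: "bij_betw g B B" "finite B" "y \<in> B"
    and card: "card (cyc f x) = card (cyc g y)"
  obtains h where "bij_betw h (cyc f x) (cyc g y)" "h x = y" "\<And>z. z \<in> cyc f x \<Longrightarrow> h (f z) = g (h z)"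
proof -
  obtain l where l: "0 < l" "(f ^^ l) x = x" "bij_betw (\<lambda>i. (f ^^ i) x) {..<l} (cyc f x)"
    using cyc_period [OF f] .
  obtain k where k: "0 < k" "(g ^^ k) y = y" "bij_betw (\<lambda>i. (g ^^ i) y) {..<k} (cyc g y)"
    using cyc_period [OF g] .
  have lk: "l = k" using card l(3) k(3) by (metis bij_betw_same_card card_lessThan)
  define h where "h = (\<lambda>i. (g ^^ i) y) \<circ> inv_into {..<l} (\<lambda>i. (f ^^ i) x)"
  have h: "h ((f ^^ i) x) = (g ^^ i) y" if "i < l" for i
    using bij_betw_inv_into_left [OF l(3)] that by (simp add: h_def)
  have "bij_betw h (cyc f x) (cyc g y)"
    unfolding h_def using bij_betw_inv_into [OF l(3)] k(3) lk by (intro bij_betw_trans) auto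
  moreover have "h x = y" using h [of 0] l by simp
  moreover have "h (f z) = g (h z)" if z: "z \<in> cyc f x" for z
  proof -
    obtain i where i: "i < l" "z = (f ^^ i) x" using z l(3) by (auto simp: bij_betw_def)
    show ?thesis
    proof (cases "Suc i < l")
      case True
      then show ?thesis using h [of "Suc i"] h [of i] i by simp
    next
      case False
      then have "Suc i = l" using i by simp
      then have "f z = x" "g ((g ^^ i) y) = y" using i l(2) k(2) lk by auto
      then show ?thesis using h [of i] i \<open>h x = y\<close> by simp
    qed
  qed
  ultimately show ?thesis using that by blast
qed

definition cycle_type :: "('a \<Rightarrow> 'a) \<Rightarrow> 'a set \<Rightarrow> nat multiset" where
  "cycle_type f A = image_mset card (mset_set (cyc f ` A))"

lemma cycle_type_remove:
  assumes "bij_betw f A A" "finite A" "x \<in> A"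
  shows "cycle_type f A = add_mset (card (cyc f x)) (cycle_type f (A - cyc f x))"
proof -
  have "mset_set (cyc f ` A) = add_mset (cyc f x) (mset_set (cyc f ` A - {cyc f x}))"
    using assms by (intro mset_set.remove) auto
  then show ?thesis
    using bij_betw_cyc_complement(2) [OF assms] by (simp add: cycle_type_def)
qed

lemma cycle_type_sum:
  "bij_betw f A A \<Longrightarrow> finite A \<Longrightarrow> sum_mset (cycle_type f A) = card A"
proof (induction "card A" arbitrary: A rule: less_induct)
  case less
  show ?case
  proof (cases "A = {}")
    case False
    then obtain x where x: "x \<in> A" by blast
    have sub: "cyc f x \<subseteq> A" "finite (cyc f x)" using cyc_subset [OF less.prems(1) x] less.prems(2) finite_subset by auto
    have "card (A - cyc f x) < card A"
      using x self_in_cyc [of x f] less.prems(2) by (intro psubset_card_mono) auto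
    then have "sum_mset (cycle_type f (A - cyc f x)) = card (A - cyc f x)"
      using bij_betw_cyc_complement(1) [OF less.prems x] less.prems(2) by (intro less.hyps) auto
    then show ?thesis
      using cycle_type_remove [OF less.prems x] sub less.prems(2)
      by (simp add: card_Diff_subset card_mono)
  qed (simp add: cycle_type_def)
qed

lemma cycle_type_nonzero: "bij_betw f A A \<Longrightarrow> finite A \<Longrightarrow> 0 \<notin># cycle_type f A"
  using cyc_subset [of f A] self_in_cyc by (fastforce simp: cycle_type_def card_eq_0_iff dest: finite_subset)

lemma glue_conj:
  assumes "bij_betw h C D" "\<And>z. z \<in> C \<Longrightarrow> h (f z) = g (h z)" "\<And>z. z \<in> C \<Longrightarrow> f z \<in> C"
    and "bij_betw h' C' D'" "\<And>z. z \<in> C' \<Longrightarrow> h' (f z) = g (h' z)" "\<And>z. z \<in> C' \<Longrightarrow> f z \<in> C'"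
    and "C \<inter> C' = {}" "D \<inter> D' = {}"
  defines "k \<equiv> (\<lambda>z. if z \<in> C then h z else h' z)"
  shows "bij_betw k (C \<union> C') (D \<union> D')" "z \<in> C \<union> C' \<Longrightarrow> k (f z) = g (k z)"
proof -
  have "bij_betw k C D \<longleftrightarrow> bij_betw h C D" by (rule bij_betw_cong) (simp add: k_def)
  moreover have "bij_betw k C' D' \<longleftrightarrow> bij_betw h' C' D'"
    by (rule bij_betw_cong) (use assms(7) in \<open>auto simp: k_def\<close>)
  ultimately show "bij_betw k (C \<union> C') (D \<union> D')"
    using assms(1,4,8) by (intro bij_betw_combine) auto
  show "k (f z) = g (k z)" if "z \<in> C \<union> C'"
  proof (cases "z \<in> C")
    case True
    then show ?thesis using assms(2,3) by (simp add: k_def)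
  next
    case False
    then have z: "z \<in> C'" "f z \<in> C'" using that assms(6) by auto
    then have "f z \<notin> C" using assms(7) by blast
    then show ?thesis using False z assms(5) by (simp add: k_def)
  qed
qed

text \<open>Induction on the size: one cycle of \<open>f\<close> is matched with a cycle of
  \<open>g\<close> of equal length, and the conjugator on the rest is glued to it.\<close>

lemma cycle_type_conj:
  assumes "bij_betw f A A" "finite A" "bij_betw g B B" "finite B" "cycle_type f A = cycle_type g B"
  shows "\<exists>h. bij_betw h A B \<and> (\<forall>z\<in>A. h (f z) = g (h z))"
  using assms
proof (induction "card A" arbitrary: A B rule: less_induct)
  case less
  show ?case
  proof (cases "A = {}")
    case True
    then have "cyc g ` B = {}" using less.prems by (simp add: cycle_type_def mset_set_empty_iff)
    then show ?thesis using True by (auto simp: bij_betw_def)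
  next
    case False
    then obtain x where x: "x \<in> A" by blast
    have "card (cyc f x) \<in># cycle_type g B"
      using cycle_type_remove [OF less.prems(1,2) x] less.prems(5) by (metis union_single_eq_member)
    then obtain y where y: "y \<in> B" "card (cyc f x) = card (cyc g y)"
      using less.prems(4) by (auto simp: cycle_type_def)
    let ?A = "A - cyc f x" and ?B = "B - cyc g y"
    have sub: "cyc f x \<subseteq> A" "cyc g y \<subseteq> B" using cyc_subset x y(1) less.prems(1,3) by metis+
    obtain h where h: "bij_betw h (cyc f x) (cyc g y)" "\<And>z. z \<in> cyc f x \<Longrightarrow> h (f z) = g (h z)"
      using cyc_iso [OF less.prems(1,2) x less.prems(3,4) y] by metis
    have "card ?A < card A"
      using x self_in_cyc [of x f] less.prems(2) by (intro psubset_card_mono) auto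
    moreover have ct: "cycle_type f ?A = cycle_type g ?B"
      using cycle_type_remove [OF less.prems(1,2) x] cycle_type_remove [OF less.prems(3,4) y(1)] less.prems(5) y(2)
      by simp
    moreover have bA: "bij_betw f ?A ?A" and bB: "bij_betw g ?B ?B"
      using bij_betw_cyc_complement(1) less.prems x y(1) by metis+
    ultimately obtain h' where h': "bij_betw h' ?A ?B" "\<And>z. z \<in> ?A \<Longrightarrow> h' (f z) = g (h' z)"
      using less.hyps [of ?A ?B] less.prems(2,4) by (metis finite_Diff)
    let ?k = "\<lambda>z. if z \<in> cyc f x then h z else h' z"
    have fA: "f z \<in> ?A" if "z \<in> ?A" for z using bA that by (metis bij_betwE)
    have "bij_betw ?k (cyc f x \<union> ?A) (cyc g y \<union> ?B)"
      by (rule glue_conj(1) [OF h cyc_step h' fA]) auto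
    moreover have "\<forall>z\<in>cyc f x \<union> ?A. ?k (f z) = g (?k z)"
      by (intro ballI glue_conj(2) [OF h cyc_step h' fA]) auto
    moreover have U: "cyc f x \<union> ?A = A" "cyc g y \<union> ?B = B" using sub by auto
    ultimately show ?thesis unfolding U by (intro exI [of _ ?k] conjI)
  qed
qed

text \<open>The cycles through \<open>x\<close> are matched separately, sending \<open>x\<close> to
  itself; with \<open>x\<close> the last point this makes the conjugator an element of the smaller
  symmetric group.\<close>

lemma cycle_type_conj_pointed:
  assumes f: "bij_betw f A A" "finite A" "x \<in> A" and g: "bij_betw g A A" 
    and card: "card (cyc f x) = card (cyc g x)"
    and ct: "cycle_type f (A - cyc f x) = cycle_type g (A - cyc g x)"
  shows "\<exists>h. bij_betw h A A \<and> h x = x \<and> (\<forall>z\<in>A. h (f z) = g (h z))"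
proof -
  let ?A = "A - cyc f x" and ?B = "A - cyc g x"
  have sub: "cyc f x \<subseteq> A" "cyc g x \<subseteq> A" using cyc_subset f g by metis+
  obtain h where h: "bij_betw h (cyc f x) (cyc g x)" "h x = x" "\<And>z. z \<in> cyc f x \<Longrightarrow> h (f z) = g (h z)"
    using cyc_iso [OF f g f(2,3) card] by metis
  have bA: "bij_betw f ?A ?A" and bB: "bij_betw g ?B ?B"
    using bij_betw_cyc_complement(1) f g by metis+
  obtain h' where h': "bij_betw h' ?A ?B" "\<And>z. z \<in> ?A \<Longrightarrow> h' (f z) = g (h' z)"
    using cycle_type_conj [OF bA _ bB _ ct] f(2) by (metis finite_Diff)
  let ?k = "\<lambda>z. if z \<in> cyc f x then h z else h' z"
  have fA: "f z \<in> ?A" if "z \<in> ?A" for z using bA that by (metis bij_betwE)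
  have "bij_betw ?k (cyc f x \<union> ?A) (cyc g x \<union> ?B)"
    by (rule glue_conj(1) [OF h(1,3) cyc_step h' fA]) auto
  moreover have "\<forall>z\<in>cyc f x \<union> ?A. ?k (f z) = g (?k z)"
    by (intro ballI glue_conj(2) [OF h(1,3) cyc_step h' fA]) auto
  moreover have "?k x = x" using h(2) self_in_cyc [of x f] by simp
  moreover have U: "cyc f x \<union> ?A = A" "cyc g x \<union> ?B = A" using sub by auto
  ultimately show ?thesis unfolding U by (intro exI [of _ ?k] conjI)
qed

text \<open>The topmost row of length \<open>k\<close> can be lengthened, since every row above it
  is strictly longer; for \<open>k = 0\<close> this is the new row below the diagram.\<close>

lemma add_box_first_row:
  assumes lam: "is_partition lam m" and k: "k = 0 \<or> k \<in> set lam"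
  shows "\<exists>s\<in>addable lam. part lam s = k"
proof (cases "k = 0")
  case True
  have "sorted_wrt (\<ge>) (lam @ [1])"
    using lam by (auto simp: is_partition_def sorted_wrt_append Suc_le_eq intro: gr0I)
  then have "Suc (length lam) \<in> addable lam"
    using lam by (auto simp: addable_def is_partition_def add_box_def)
  moreover have "part lam (Suc (length lam)) = 0" by (simp add: part_def)
  ultimately show ?thesis using True by metis
next
  case False
  define i where "i = (LEAST i. i < length lam \<and> lam ! i = k)"
  have "\<exists>i. i < length lam \<and> lam ! i = k" using k False by (simp add: in_set_conv_nth)
  then have "i < length lam \<and> lam ! i = k" unfolding i_def by (rule LeastI_ex)
  then have i: "i < length lam" "lam ! i = k" by simp_all
  have le: "lam ! j \<ge> lam ! j'" if "j < j'" "j' < length lam" for j j'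
    using lam that by (simp add: is_partition_def sorted_wrt_iff_nth_less)
  have lt: "lam ! j > k" if "j < i" for j
  proof -
    have "lam ! j \<noteq> k" using not_less_Least that i(1) unfolding i_def by fastforce
    then show ?thesis using le [of j i] that i by simp
  qed
  let ?mu = "lam[i := Suc k]"
  have "sorted_wrt (\<ge>) ?mu"
    unfolding sorted_wrt_iff_nth_less
  proof (intro allI impI)
    fix a b assume "a < b" "b < length ?mu"
    then show "?mu ! a \<ge> ?mu ! b"
      using le [of a b] lt [of a] i by (auto simp: nth_list_update)
  qed
  moreover have "0 \<notin> set ?mu" using lam set_update_subset_insert [of lam i "Suc k"] by (auto simp: is_partition_def)
  moreover have "sum_list ?mu = sum_list lam + 1"
    using i elem_le_sum_list [of i lam] by (simp add: sum_list_update)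
  ultimately have "Suc i \<in> addable lam"
    using i by (simp add: addable_def is_partition_def add_box_def)
  moreover have "part lam (Suc i) = k" using i by (simp add: part_def)
  ultimately show ?thesis by metis
qed

lemma is_partition_of_mset:
  assumes "0 \<notin># N"
  shows "is_partition (rev (sorted_list_of_multiset N)) (sum_mset N)"
proof -
  have "sum_list (sorted_list_of_multiset N) = sum_mset N"
    by (metis mset_sorted_list_of_multiset sum_mset_sum_list)
  moreover have "set (sorted_list_of_multiset N) = set_mset N"
    by (metis mset_sorted_list_of_multiset set_mset_mset)
  ultimately show ?thesis
    using assms sorted_sorted_list_of_multiset [of N] by (simp add: is_partition_def sorted_wrt_rev)
qed

definition box_pairs :: "nat \<Rightarrow> (nat list \<times> nat) set" where
  "box_pairs m = {(lam, s). is_partition lam m \<and> s \<in> addable lam}"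

lemma bij_betw_pfun: "g \<in> symg r \<Longrightarrow> bij_betw (pfun g) {1..r} {1..r}"
  unfolding symg_def by (simp add: permutes_imp_bij)

text \<open>A cycle type together with the length \<open>k + 1\<close> of the cycle through the last point is encoded
  by the cycle type \<open>lam\<close> left after deleting the last point and the addable row of \<open>lam\<close> of
  length \<open>k\<close>.\<close>

lemma marked_cycle_type:
  "\<exists>ty. \<forall>g\<in>symg (Suc m). ty g \<in> box_pairs m \<and>
     (\<forall>h\<in>symg (Suc m). ty g = ty h \<longrightarrow> (\<exists>t\<in>symg m. t + g = h + t))"
proof -
  let ?N = "{1..Suc m}"
  define c where "c g = card (cyc (pfun g) (Suc m))" for g
  define M where "M g = cycle_type (pfun g) (?N - cyc (pfun g) (Suc m))" for g
  \<comment> \<open>Deleting the last point shortens its cycle by one. If that point is fixed,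
    nothing remains of the cycle; the partition then gets no part for it, and the mark is the empty
    row below the diagram.\<close>
  define L where "L g = M g + (if c g = 1 then {#} else {#c g - 1#})" for g
  define ty where "ty g = (rev (sorted_list_of_multiset (L g)),
    SOME s. s \<in> addable (rev (sorted_list_of_multiset (L g))) \<and>
      part (rev (sorted_list_of_multiset (L g))) s = c g - 1)" for g
  have ty: "ty g \<in> box_pairs m" "mset (fst (ty g)) = L g" "part (fst (ty g)) (snd (ty g)) = c g - 1" "c g \<ge> 1"
    if g: "g \<in> symg (Suc m)" for g
  proof -
    let ?lam = "rev (sorted_list_of_multiset (L g))"
    have b: "bij_betw (pfun g) ?N ?N" using bij_betw_pfun [OF g] .
    note b' = bij_betw_cyc_complement(1) [OF b, of "Suc m"]
    have sub: "cyc (pfun g) (Suc m) \<subseteq> ?N" using cyc_subset [OF b, of "Suc m"] by simp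
    have fin: "finite (cyc (pfun g) (Suc m))" using sub by (rule finite_subset) simp
    show c1: "c g \<ge> 1"
      using fin self_in_cyc [of "Suc m" "pfun g"] by (auto simp: c_def Suc_le_eq card_gt_0_iff)
    have "sum_mset (M g) = card (?N - cyc (pfun g) (Suc m))"
      unfolding M_def by (rule cycle_type_sum) (use b' in auto)
    also have "\<dots> = Suc m - c g" using sub fin by (simp add: card_Diff_subset c_def)
    finally have "sum_mset (M g) = Suc m - c g" .
    moreover have "c g \<le> Suc m" unfolding c_def using card_mono [OF _ sub] by simp
    ultimately have "sum_mset (L g) = m" using c1 by (auto simp: L_def)
    moreover have z: "0 \<notin># M g"
      unfolding M_def by (rule cycle_type_nonzero) (use b' in auto)
    ultimately have p: "is_partition ?lam m"
      using is_partition_of_mset [of "L g"] c1 by (auto simp: L_def split: if_splits)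
    have "c g - 1 = 0 \<or> c g - 1 \<in> set ?lam" by (auto simp: L_def)
    then have "\<exists>s. s \<in> addable ?lam \<and> part ?lam s = c g - 1"
      using add_box_first_row [OF p] by blast
    then have "snd (ty g) \<in> addable ?lam \<and> part ?lam (snd (ty g)) = c g - 1"
      unfolding ty_def snd_conv by (rule someI_ex)
    then show "ty g \<in> box_pairs m" "part (fst (ty g)) (snd (ty g)) = c g - 1"
      using p by (auto simp: box_pairs_def ty_def)
    show "mset (fst (ty g)) = L g" by (simp add: ty_def)
  qed
  have conj: "\<exists>t\<in>symg m. t + g = h + t" if g: "g \<in> symg (Suc m)" and h: "h \<in> symg (Suc m)" and eq: "ty g = ty h" for g h
  proof -
    have c: "c g = c h" using ty [OF g] ty [OF h] eq by (metis le_add_diff_inverse)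
    have "L g = L h" using ty(2) [OF g] ty(2) [OF h] eq by simp
    then have M: "M g = M h" using c by (auto simp: L_def split: if_splits)
    have "\<exists>k. bij_betw k ?N ?N \<and> k (Suc m) = Suc m \<and> (\<forall>z\<in>?N. k (pfun g z) = pfun h (k z))"
      using c M by (intro cycle_type_conj_pointed bij_betw_pfun g h) (auto simp: c_def M_def)
    then obtain k where k: "bij_betw k ?N ?N" "k (Suc m) = Suc m" "\<And>z. z \<in> ?N \<Longrightarrow> k (pfun g z) = pfun h (k z)"
      by blast
    define k' where "k' z = (if z \<in> ?N then k z else z)" for z
    have "bij_betw k' ?N ?N \<longleftrightarrow> bij_betw k ?N ?N" by (rule bij_betw_cong) (simp add: k'_def)
    then have k'p: "k' permutes ?N" using k(1) by (intro bij_imp_permutes) (auto simp: k'_def)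
    define t where "t = Perm k'"
    have t: "pfun t = k'" "t \<in> symg (Suc m)"
      using k'p by (simp_all only: t_def pfun_Perm Perm_in_symg)
    have "k' permutes {1..m}"
      using k'p by (rule permutes_fix_last) (use k(2) in \<open>simp add: k'_def\<close>)
    then have "t \<in> symg m" by (simp only: symg_def mem_Collect_eq t)
    moreover have "k' (pfun g z) = pfun h (k' z)" for z
    proof (cases "z \<in> ?N")
      case True
      then have "pfun g z \<in> ?N" using bij_betw_pfun [OF g] by (metis bij_betwE)
      then show ?thesis using True k(3) by (simp add: k'_def)
    next
      case False
      then have "pfun g z = z" "pfun h z = z"
        using g h by (metis symg_def mem_Collect_eq permutes_not_in)+
      then show ?thesis using False by (auto simp: k'_def)
    qed
    then have "pfun (t + g) = pfun (h + t)" by (simp add: pfun_plus t fun_eq_iff)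
    then have "t + g = h + t" by (simp only: pfun_inject)
    ultimately show ?thesis by blast
  qed
  show ?thesis using ty(1) conj by metis
qed

lemma finite_box_pairs: "finite (box_pairs m)"
proof -
  have "lam \<in> {xs. set xs \<subseteq> {..m} \<and> length xs \<le> m}" if "is_partition lam m" for lam
  proof -
    have "x \<le> m" if "x \<in> set lam" for x
      using member_le_sum_list [OF that] \<open>is_partition lam m\<close> by (simp add: is_partition_def)
    moreover have "length lam \<le> m"
    proof -
      have "0 \<notin> set xs \<Longrightarrow> length xs \<le> sum_list xs" for xs :: "nat list"
        by (induction xs) auto
      then show ?thesis using that by (auto simp: is_partition_def)
    qed
    ultimately show ?thesis by auto
  qed
  moreover have "s \<in> {..Suc (length lam)}" if "s \<in> addable lam" for s lam
    using that by (simp add: addable_def)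
  ultimately have "box_pairs m \<subseteq> {xs. set xs \<subseteq> {..m} \<and> length xs \<le> m} \<times> {..Suc m}"
    by (fastforce simp: box_pairs_def)
  then show ?thesis
    by (rule finite_subset) (simp add: finite_lists_length_le)
qed

section \<open>Completeness\<close>

lemma add_box_inject:
  assumes "is_partition lam m" "s \<in> addable lam" "r \<in> addable lam" "add_box lam s = add_box lam r"
  shows "s = r"
proof (rule ccontr)
  assume "s \<noteq> r"
  then show False
    using assms(4) part_add_box [OF assms(1,2), of s] part_add_box [OF assms(1,3), of s]
      s_bounds [OF assms(1,2)] by simp
qed

lemma young_elt_square: "is_partition lam r \<Longrightarrow> young_elt lam * young_elt lam = (young_elt lam :: 'k::field_char_0 sga)"
  by (rule young_scalar(2)) (simp add: is_partition_def)

lemma rho_elt_iota_elt_0: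
  assumes "is_partition lam m" "s \<in> addable lam" "r \<in> addable lam" "s \<noteq> r"
  shows "rho_elt lam s * iota_elt lam r = (0 :: 'k::field_char_0 sga)"
proof -
  have "rho_elt lam s * iota_elt lam r = young_elt (add_box lam s) *
      (perm_elt (- w_elt lam s) * young_elt lam * young_elt lam * perm_elt (w_elt lam r)) * (young_elt (add_box lam r) :: 'k sga)"
    unfolding rho_elt_def [OF assms(1,2)] iota_elt_def [OF assms(1,3)] by (simp only: mult.assoc)
  also have "\<dots> = 0"
  proof (rule young_elt_orthogonal)
    show "is_partition (add_box lam s) (Suc m)" "is_partition (add_box lam r) (Suc m)"
      using assms by (auto intro: is_partition_add_box)
    show "add_box lam s \<noteq> add_box lam r" using add_box_inject assms by blast
    show "supp (perm_elt (- w_elt lam s) * young_elt lam * young_elt lam * perm_elt (w_elt lam r) :: 'k sga) \<subseteq> symg (Suc m)"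
      using supp_young_elt [of lam, where ?'k = 'k] symg_mono [of m "Suc m"]
        w_elt_symg [OF assms(1,2)] w_elt_symg [OF assms(1,3)] sum_lam [OF assms(1,2)]
      by (intro supp_mult_symg supp_perm_elt_symg) auto
  qed
  finally show ?thesis .
qed

definition box_idem :: "nat list \<Rightarrow> nat \<Rightarrow> 'k::field sga" where
  "box_idem lam s = iota_elt lam s * rho_elt lam s"

lemma
  assumes lam: "is_partition lam m" and s: "s \<in> addable lam"
  shows young_elt_box_idem: "young_elt lam * box_idem lam s = (box_idem lam s :: 'k::field_char_0 sga)"
    and box_idem_young_elt: "box_idem lam s * young_elt lam = (box_idem lam s :: 'k::field_char_0 sga)"
    and box_idem_nonzero: "box_idem lam s \<noteq> (0 :: 'k::field_char_0 sga)"
    and supp_box_idem: "supp (box_idem lam s :: 'k sga) \<subseteq> symg (Suc m)"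
proof -
  note d = rho_elt_def [OF assms] iota_elt_def [OF assms]
  show "young_elt lam * box_idem lam s = (box_idem lam s :: 'k sga)"
    unfolding box_idem_def d by (simp add: young_elt_square [OF lam] flip: mult.assoc)
  show "box_idem lam s * young_elt lam = (box_idem lam s :: 'k sga)"
    unfolding box_idem_def d by (simp add: young_elt_square [OF lam] mult.assoc)
  have mu: "is_partition (add_box lam s) (sum_list (add_box lam s))"
    using is_partition_add_box [OF assms] sum_add_box [OF assms] by simp
  show "box_idem lam s \<noteq> (0 :: 'k sga)"
  proof
    assume 0: "box_idem lam s = (0 :: 'k sga)"
    have "rho_elt lam s * box_idem lam s * iota_elt lam s = (rho_elt lam s * iota_elt lam s) * (rho_elt lam s * (iota_elt lam s :: 'k sga))"
      unfolding box_idem_def by (simp only: mult.assoc)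
    also have "\<dots> = young_elt (add_box lam s) * young_elt (add_box lam s)"
      by (simp only: rho_elt_iota_elt [OF assms])
    finally have "rho_elt lam s * box_idem lam s * iota_elt lam s = (young_elt (add_box lam s) * young_elt (add_box lam s) :: 'k sga)" .
    then have "young_elt (add_box lam s) = (0 :: 'k sga)"
      by (simp add: 0 young_scalar(2) [OF mu])
    then show False using coeff_young_elt_0_nonzero [OF mu, where ?'k = 'k] by simp
  qed
  show "supp (box_idem lam s :: 'k sga) \<subseteq> symg (Suc m)"
    unfolding box_idem_def by (intro supp_mult_symg supp_iota_elt supp_rho_elt assms)
qed

lemma box_idem_box_idem:
  assumes "is_partition lam m" "s \<in> addable lam" "r \<in> addable lam"
  shows "box_idem lam s * box_idem lam r = (if s = r then box_idem lam s else (0 :: 'k::field_char_0 sga))"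
proof (cases "s = r")
  case True
  have "box_idem lam s * box_idem lam s = iota_elt lam s * (rho_elt lam s * iota_elt lam s) * (rho_elt lam s :: 'k sga)"
    unfolding box_idem_def by (simp only: mult.assoc)
  also have "\<dots> = box_idem lam s"
    unfolding rho_elt_iota_elt [OF assms(1,2)] box_idem_def
    by (simp add: iota_elt_def [OF assms(1,2)] mult.assoc)
       (simp add: young_elt_square [OF is_partition_add_box [OF assms(1,2)]] flip: mult.assoc)
  finally show ?thesis using True by simp
next
  case False
  have "box_idem lam s * box_idem lam r = iota_elt lam s * (rho_elt lam s * iota_elt lam r) * (rho_elt lam r :: 'k sga)"
    unfolding box_idem_def by (simp only: mult.assoc)
  then show ?thesis using rho_elt_iota_elt_0 [OF assms False, where ?'k = 'k] False by simp
qed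

text \<open>The average without the factor 1/m!, which only rescales coefficients. Its invariance
  under conjugation is \<open>conj_sum_conj\<close>.\<close>

definition conj_sum :: "nat \<Rightarrow> nat list \<times> nat \<Rightarrow> 'k::field sga" where
  "conj_sum m p = (\<Sum>t\<in>symg m. perm_elt t * box_idem (fst p) (snd p) * perm_elt (- t))"

lemma conj_sum_conj:
  assumes "h \<in> symg m"
  shows "perm_elt h * conj_sum m p * perm_elt (- h) = (conj_sum m p :: 'k::field sga)"
proof -
  have "perm_elt h * conj_sum m p * perm_elt (- h) =
      (\<Sum>t\<in>symg m. perm_elt (h + t) * box_idem (fst p) (snd p) * (perm_elt (- (h + t)) :: 'k sga))"
    by (simp add: conj_sum_def sum_distrib_left sum_distrib_right mult.assoc perm_elt_mult perm_elt_mult_assoc minus_add)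
  also have "\<dots> = conj_sum m p"
    unfolding conj_sum_def
    by (rule sum_symg_translate(1) [OF assms, of "\<lambda>t. perm_elt t * box_idem (fst p) (snd p) * perm_elt (- t)"])
  finally show ?thesis .
qed

lemma supp_conj_sum:
  assumes "(lam, s) \<in> box_pairs m"
  shows "supp (conj_sum m (lam, s) :: 'k::field_char_0 sga) \<subseteq> symg (Suc m)"
proof -
  have ls: "is_partition lam m" "s \<in> addable lam" using assms by (auto simp: box_pairs_def)
  show ?thesis
    unfolding conj_sum_def using symg_mono [of m "Suc m"]
    by (intro supp_sum supp_mult_symg supp_perm_elt_symg) (auto intro: supp_box_idem [OF ls, THEN subsetD])
qed

lemma smul_sum_left: "(\<Sum>i\<in>I. c i) \<cdot> x = (\<Sum>i\<in>I. c i \<cdot> x)" for x :: "'k::field sga"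
  by (induction I rule: infinite_finite_induct) (simp_all add: smul_distrib)

text \<open>Writing \<open>box_idem lam' s\<close> between two copies of
  \<open>young_elt lam'\<close> exposes factors
  \<open>young_elt lam * perm_elt t * young_elt lam'\<close>. For different shapes these vanish; for
  equal ones they are scalar multiples of the idempotent, and the scalars sum to the trace of its
  square over the square of its trace.\<close>

lemma young_elt_conj_sum_young_elt:
  assumes lam: "is_partition lam m" and p: "(lam', s) \<in> box_pairs m"
  shows "young_elt lam * conj_sum m (lam', s) * young_elt lam =
    (if lam = lam' then (1 / coeff (young_elt lam) 0) \<cdot> box_idem lam s else (0 :: 'k::field_char_0 sga))"
proof -
  let ?e = "young_elt lam :: 'k sga"
  have ls: "is_partition lam' m" "s \<in> addable lam'" using p by (auto simp: box_pairs_def)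
  have lam0: "is_partition lam (sum_list lam)" "sum_list lam = m" using lam by (simp_all add: is_partition_def)
  have split: "?e * (perm_elt t * box_idem lam' s * perm_elt (- t)) * ?e =
      (?e * perm_elt t * young_elt lam') * box_idem lam' s * (young_elt lam' * perm_elt (- t) * ?e)" for t
  proof -
    have "?e * (perm_elt t * box_idem lam' s * perm_elt (- t)) * ?e =
      ?e * (perm_elt t * (young_elt lam' * box_idem lam' s * young_elt lam') * perm_elt (- t)) * ?e"
      by (simp add: young_elt_box_idem [OF ls] box_idem_young_elt [OF ls])
    then show ?thesis by (simp only: mult.assoc)
  qed
  have sum: "?e * conj_sum m (lam', s) * ?e =
      (\<Sum>t\<in>symg m. (?e * perm_elt t * young_elt lam') * box_idem lam' s * (young_elt lam' * perm_elt (- t) * ?e))"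
    unfolding conj_sum_def fst_conv snd_conv sum_distrib_left sum_distrib_right split ..
  show ?thesis
  proof (cases "lam = lam'")
    case False
    have "(?e * perm_elt t * young_elt lam') * box_idem lam' s * (young_elt lam' * perm_elt (- t) * ?e) = 0" if "t \<in> symg m" for t
      using young_elt_orthogonal [OF lam ls(1) False supp_perm_elt_symg [OF that], where ?'k = 'k] by simp
    then show ?thesis using False unfolding sum by simp
  next
    case True
    let ?c = "coeff ?e 0"
    have c: "?c \<noteq> 0" using coeff_young_elt_0_nonzero [OF lam0(1)] .
    have k: "?e * perm_elt t * ?e = (coeff ?e (- t) / ?c) \<cdot> ?e" if "t \<in> symg m" for t
    proof -
      have "supp (perm_elt t :: 'k sga) \<subseteq> symg (sum_list lam)"
        using supp_perm_elt_symg [OF that] by (simp add: lam0)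
      from young_elt_sandwich [OF lam0(1) this] show ?thesis by simp
    qed
    have E: "?e * box_idem lam s * ?e = box_idem lam s"
      using young_elt_box_idem [OF ls, where ?'k = 'k] box_idem_young_elt [OF ls, where ?'k = 'k] True by simp
    have "?e * conj_sum m (lam', s) * ?e = (\<Sum>t\<in>symg m. (coeff ?e (- t) / ?c * (coeff ?e t / ?c)) \<cdot> box_idem lam s)"
      unfolding sum unfolding True [symmetric]
    proof (rule sum.cong [OF refl])
      fix t assume t: "t \<in> symg m"
      then have "- t \<in> symg m" by simp
      then show "(?e * perm_elt t * ?e) * box_idem lam s * (?e * perm_elt (- t) * ?e) =
          (coeff ?e (- t) / ?c * (coeff ?e t / ?c)) \<cdot> box_idem lam s"
        using E unfolding k [OF t] k [OF \<open>- t \<in> symg m\<close>] by (simp add: mult.commute)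
    qed
    also have "\<dots> = (\<Sum>t\<in>symg m. coeff ?e (- t) / ?c * (coeff ?e t / ?c)) \<cdot> box_idem lam s"
      by (simp add: smul_sum_left)
    also have "(\<Sum>t\<in>symg m. coeff ?e (- t) / ?c * (coeff ?e t / ?c)) =
        (\<Sum>t\<in>symg m. coeff ?e t * coeff ?e (- t + 0)) / (?c * ?c)"
      by (simp add: sum_divide_distrib mult.commute)
    also have "(\<Sum>t\<in>symg m. coeff ?e t * coeff ?e (- t + 0)) = coeff (?e * ?e) 0"
      using supp_young_elt [of lam, where ?'k = 'k] lam0 by (intro coeff_mult [symmetric]) auto
    also have "\<dots> / (?c * ?c) = 1 / ?c" using c by (simp add: young_elt_square [OF lam])
    finally show ?thesis using True by simp
  qed
qed

lemma young_elt_sum_conj_sum_young_elt: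
  assumes lam: "is_partition lam m"
  shows "young_elt lam * (\<Sum>p\<in>box_pairs m. c p \<cdot> conj_sum m p) * young_elt lam =
    (\<Sum>s\<in>addable lam. (c (lam, s) / coeff (young_elt lam) 0) \<cdot> (box_idem lam s :: 'k::field_char_0 sga))"
proof -
  have fin: "finite (addable lam)"
    by (rule finite_subset [of _ "{..Suc (length lam)}"]) (auto simp: addable_def)
  have "young_elt lam * (\<Sum>p\<in>box_pairs m. c p \<cdot> conj_sum m p) * young_elt lam =
      (\<Sum>p\<in>box_pairs m. c p \<cdot> (young_elt lam * conj_sum m p * (young_elt lam :: 'k sga)))"
    by (simp add: sum_distrib_left sum_distrib_right)
  also have "\<dots> = (\<Sum>p\<in>box_pairs m. if p \<in> Pair lam ` addable lam then
      (c p / coeff (young_elt lam) 0) \<cdot> box_idem (fst p) (snd p) else 0)"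
    by (rule sum.cong) (auto simp: young_elt_conj_sum_young_elt [OF lam] box_pairs_def)
  also have "\<dots> = (\<Sum>p\<in>Pair lam ` addable lam. (c p / coeff (young_elt lam) 0) \<cdot> box_idem (fst p) (snd p))"
    using lam finite_box_pairs [of m]
    by (intro sum.mono_neutral_cong_right) (auto simp: box_pairs_def)
  also have "\<dots> = (\<Sum>s\<in>addable lam. (c (lam, s) / coeff (young_elt lam) 0) \<cdot> box_idem lam s)"
    by (subst sum.reindex) (auto simp: inj_on_def)
  finally show ?thesis .
qed

lemma sum_box_idem_mult_box_idem:
  assumes lam: "is_partition lam m" and s: "s \<in> addable lam"
  shows "(\<Sum>r\<in>addable lam. d r \<cdot> box_idem lam r) * box_idem lam s = d s \<cdot> (box_idem lam s :: 'k::field_char_0 sga)"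
proof -
  have fin: "finite (addable lam)"
    by (rule finite_subset [of _ "{..Suc (length lam)}"]) (auto simp: addable_def)
  have "(\<Sum>r\<in>addable lam. d r \<cdot> box_idem lam r) * box_idem lam s =
      (\<Sum>r\<in>addable lam. if r = s then d s \<cdot> box_idem lam s else (0 :: 'k sga))"
    unfolding sum_distrib_right by (rule sum.cong) (auto simp: box_idem_box_idem [OF lam _ s])
  then show ?thesis using fin s by simp
qed

lemma smul_eq_0: "x \<noteq> 0 \<Longrightarrow> c \<cdot> x = 0 \<Longrightarrow> c = 0" for x :: "'k::field sga"
  by (metis coeff_smul lookup_zero mult_eq_0_iff poly_mapping_eqI)

text \<open>Compression by \<open>young_elt lam\<close> removes all pairs with another partition;
  multiplication by \<open>box_idem lam s\<close> then removes the other rows, these idempotents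
  being orthogonal. What survives is a nonzero multiple of \<open>c p\<close>.\<close>

lemma conj_sum_independent:
  assumes "(\<Sum>p\<in>box_pairs m. c p \<cdot> conj_sum m p) = (0 :: 'k::field_char_0 sga)" "p \<in> box_pairs m"
  shows "c p = 0"
proof -
  obtain lam s where p: "p = (lam, s)" by (cases p)
  then have ls: "is_partition lam m" "s \<in> addable lam" using assms(2) by (auto simp: box_pairs_def)
  have "is_partition lam (sum_list lam)" using ls(1) by (simp add: is_partition_def)
  from coeff_young_elt_0_nonzero [OF this] have e: "coeff (young_elt lam) 0 \<noteq> (0 :: 'k)" .
  have "0 = (c (lam, s) / coeff (young_elt lam) 0) \<cdot> (box_idem lam s :: 'k sga)"
    using young_elt_sum_conj_sum_young_elt [OF ls(1), of c] sum_box_idem_mult_box_idem [OF ls, of "\<lambda>s. c (lam, s) / coeff (young_elt lam) 0"]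
    unfolding assms(1) by simp
  then show ?thesis using smul_eq_0 [OF box_idem_nonzero [OF ls]] e p by (metis divide_eq_0_iff)
qed

section \<open>Linear algebra: the dimension count\<close>

global_interpretation sga: vector_space "smul :: 'k::field \<Rightarrow> 'k sga \<Rightarrow> 'k sga"
  by unfold_locales (simp_all add: smul_distrib)

lemma inj_on_conj_sum: "inj_on (conj_sum m ::  _ \<Rightarrow> 'k::field_char_0 sga) (box_pairs m)"
proof (rule inj_onI, rule ccontr)
  fix p q assume *: "p \<in> box_pairs m" "q \<in> box_pairs m" "conj_sum m p = (conj_sum m q :: 'k sga)" "p \<noteq> q"
  \<comment> \<open>A coincidence of two averages is read as a linear relation with coefficients 1
    and -1.\<close>
  let ?c = "\<lambda>r. (if r = p then 1 else 0) - (if r = q then 1 else 0) :: 'k"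
  have "(\<Sum>r\<in>box_pairs m. ?c r \<cdot> conj_sum m r) = 
      (\<Sum>r\<in>box_pairs m. if r = p then conj_sum m r else 0) - (\<Sum>r\<in>box_pairs m. if r = q then conj_sum m r else 0)"
    unfolding sum_subtractf [symmetric] by (rule sum.cong) auto
  also have "\<dots> = 0" using * finite_box_pairs [of m] by simp
  finally have "?c p = 0" using *(1) by (rule conj_sum_independent)
  then show False using * by simp
qed

text \<open>Otherwise 1 could be added to the independent averages, giving more independent elements
  than there are pairs. All of them are invariant under conjugation by S_m, and the invariants lie
  in the span of at most as many elements as there are pairs.\<close>

lemma one_in_span_conj_sum: "(1 :: 'k::field_char_0 sga) \<in> sga.span (conj_sum m ` box_pairs m)"
proof (rule ccontr)
  let ?S = "conj_sum m ` box_pairs m :: 'k sga set"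
  assume not: "1 \<notin> sga.span ?S"
  obtain ty where ty: "\<And>g. g \<in> symg (Suc m) \<Longrightarrow> ty g \<in> box_pairs m"
    "\<And>g h. g \<in> symg (Suc m) \<Longrightarrow> h \<in> symg (Suc m) \<Longrightarrow> ty g = ty h \<Longrightarrow> \<exists>t\<in>symg m. t + g = h + t"
    using marked_cycle_type [of m] by blast
  \<comment> \<open>Sums over the fibres of \<open>ty\<close>. Equality of types implies conjugacy,
    so an invariant element is constant on each fibre and is a combination of these sums; an empty
    fibre contributes zero.\<close>
  define T :: "nat list \<times> nat \<Rightarrow> 'k sga" where "T q = (\<Sum>g | g \<in> symg (Suc m) \<and> ty g = q. perm_elt g)" for q
  have inv: "x \<in> sga.span (T ` box_pairs m)"
    if supp: "supp x \<subseteq> symg (Suc m)" and x: "\<And>t. t \<in> symg m \<Longrightarrow> perm_elt t * x * perm_elt (- t) = x" for x :: "'k sga"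
  proof -
    have const: "coeff x g = coeff x h" if gh: "g \<in> symg (Suc m)" "h \<in> symg (Suc m)" "ty g = ty h" for g h
    proof -
      obtain t where t: "t \<in> symg m" "t + g = h + t" using ty(2) [OF gh] by blast
      have "coeff x h = coeff (perm_elt t * x * perm_elt (- t)) h" using x [OF t(1)] by simp
      also have "\<dots> = coeff x (- t + (h + t))" by (simp add: add.assoc)
      also have "- t + (h + t) = g" using t(2) by (metis minus_add_cancel)
      finally show ?thesis ..
    qed
    define d where "d q = coeff x (SOME g. g \<in> symg (Suc m) \<and> ty g = q)" for q
    have d: "coeff x g = d (ty g)" if "g \<in> symg (Suc m)" for g
      unfolding d_def using someI [of "\<lambda>h. h \<in> symg (Suc m) \<and> ty h = ty g" g] that
      by (intro const) auto
    have "x = (\<Sum>g\<in>symg (Suc m). coeff x g \<cdot> perm_elt g)"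
      by (rule sga_eq_sum_perm_elt [OF supp]) simp
    also have "\<dots> = (\<Sum>q\<in>box_pairs m. \<Sum>g | g \<in> symg (Suc m) \<and> ty g = q. coeff x g \<cdot> perm_elt g)"
      by (rule sum.group [symmetric]) (use ty(1) finite_box_pairs in auto)
    also have "\<dots> = (\<Sum>q\<in>box_pairs m. d q \<cdot> T q)"
      unfolding T_def smul_distrib by (intro sum.cong refl) (auto simp: d)
    finally show ?thesis
      by (metis (no_types, lifting) imageI sga.span_base sga.span_scale sga.span_sum)
  qed
  have sub: "?S \<subseteq> sga.span (T ` box_pairs m)"
    using supp_conj_sum conj_sum_conj by (force intro: inv)
  have one: "1 \<in> sga.span (T ` box_pairs m)"
  proof (rule inv)
    show "supp (1 :: 'k sga) \<subseteq> symg (Suc m)" by simp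
    show "perm_elt t * 1 * perm_elt (- t) = (1 :: 'k sga)" for t by (simp add: perm_elt_mult)
  qed
  note inj = inj_on_conj_sum [of m, where ?'k = 'k]
  have "sga.independent ?S"
    unfolding sga.dependent_finite [OF finite_imageI [OF finite_box_pairs]]
  proof clarify
    fix u p assume *: "(\<Sum>v\<in>?S. u v \<cdot> v) = 0" "p \<in> box_pairs m" "u (conj_sum m p) \<noteq> 0"
    have "(\<Sum>p\<in>box_pairs m. u (conj_sum m p) \<cdot> (conj_sum m p :: 'k sga)) = 0"
      using *(1) by (simp add: sum.reindex [OF inj])
    from conj_sum_independent [OF this *(2)] *(3) show False by simp
  qed
  then have "sga.independent (insert 1 ?S)"
    using not by (simp add: sga.independent_insert)
  from sga.independent_span_bound [OF _ this, of "T ` box_pairs m"]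
  have "card (insert 1 ?S) \<le> card (T ` box_pairs m)"
    using sub one finite_box_pairs by auto
  also have "\<dots> \<le> card (box_pairs m)" by (rule card_image_le [OF finite_box_pairs])
  also have "\<dots> = card ?S" by (rule card_image [OF inj, symmetric])
  finally have "card (insert 1 ?S) \<le> card ?S" .
  moreover have "1 \<notin> ?S" using not by (auto intro: sga.span_base)
  ultimately show False using finite_box_pairs [of m] by simp
qed

text \<open>Compressing an expansion of 1 in the averages by \<open>young_elt lam\<close> gives a
  combination of the idempotents \<open>box_idem lam s\<close>. Each is fixed by left multiplication
  with \<open>young_elt lam\<close>, so by orthogonality its coefficient is 1.\<close>

lemma young_elt_eq_sum_box_idem:
  assumes lam: "is_partition lam m"
  shows "young_elt lam = (\<Sum>s\<in>addable lam. box_idem lam s :: 'k::field_char_0 sga)"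
proof -
  have "(1 :: 'k sga) \<in> range (\<lambda>u. \<Sum>v\<in>conj_sum m ` box_pairs m. u v \<cdot> v)"
    using one_in_span_conj_sum [of m, where ?'k = 'k] sga.span_finite [OF finite_imageI [OF finite_box_pairs]] by blast
  then obtain u where u: "(1 :: 'k sga) = (\<Sum>v\<in>conj_sum m ` box_pairs m. u v \<cdot> v)" by blast
  define c where "c = (\<lambda>p. u (conj_sum m p))"
  have c: "(1 :: 'k sga) = (\<Sum>p\<in>box_pairs m. c p \<cdot> conj_sum m p)"
    using u by (simp only: sum.reindex [OF inj_on_conj_sum] comp_def c_def)
  define d where "d s = c (lam, s) / coeff (young_elt lam) 0" for s
  have e: "young_elt lam = (\<Sum>s\<in>addable lam. d s \<cdot> (box_idem lam s :: 'k sga))"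
    using young_elt_sum_conj_sum_young_elt [OF lam, of c] unfolding c [symmetric] d_def by (simp add: young_elt_square [OF lam])
  have "d s = 1" if s: "s \<in> addable lam" for s
  proof -
    have "(d s - 1) \<cdot> box_idem lam s = (0 :: 'k sga)"
      using sum_box_idem_mult_box_idem [OF lam s, of d] young_elt_box_idem [OF lam s, where ?'k = 'k]
      unfolding e [symmetric] by (simp add: sga.scale_left_diff_distrib)
    then have "d s - 1 = 0" by (rule smul_eq_0 [OF box_idem_nonzero [OF lam s]])
    then show ?thesis by simp
  qed
  then show ?thesis by (subst e) simp
qed

section \<open>Permutation diagrams\<close>

lemma heis_eq_refl [simp]: "heis_eq x x"
  by (simp add: heis_eq_def heis_ideal.zero)

lemma abs_hmor_rel: "heis_rel x y \<Longrightarrow> abs_hmor x = abs_hmor y"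
  unfolding hmor.abs_eq_iff heis_eq_def by (rule heis_ideal.rel)

lemma hdiag_mult: "hdiag d * hdiag e = (if dcod e = ddom d then hdiag (dcomp d e) else 0)"
  by (simp add: hdiag.abs_eq times_hmor.abs_eq zero_hmor.abs_eq vdiag_def vcomp_single)

lemma vtens_single: "Poly_Mapping.single d c \<boxtimes> Poly_Mapping.single e c' = Poly_Mapping.single (dtens d e) (c * c')"
  by (simp add: vtens_def bilin_single vscale_single)

lemma vtens_add: "(x + x') \<boxtimes> y = x \<boxtimes> y + x' \<boxtimes> y" "x \<boxtimes> (y + y') = x \<boxtimes> y + x \<boxtimes> y'"
  by (simp_all add: vtens_def bilin_add_left bilin_add_right)

lemma vtens_0 [simp]: "0 \<boxtimes> y = 0" "x \<boxtimes> 0 = 0"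
  by (simp_all add: vtens_def)

lemma htens_hdiag: "htens (hdiag d) (hdiag e) = hdiag (dtens d e)"
  by transfer (simp add: vdiag_def vtens_single)

lemma bilin_vscale:
  "bilin b (vscale c x) y = vscale c (bilin b x y)" "bilin b x (vscale c y) = vscale c (bilin b x y)"
proof -
  show "bilin b (vscale c x) y = vscale c (bilin b x y)"
  proof (induction x rule: lincomb_induct)
    case (single d c')
    show ?case
      by (induction y rule: lincomb_induct)
         (simp_all add: vscale_single bilin_single vscale_vscale bilin_add_right vscale_add_right mult.assoc)
  qed (simp_all add: bilin_add_left vscale_add_right)
  show "bilin b x (vscale c y) = vscale c (bilin b x y)"
  proof (induction x rule: lincomb_induct)
    case (single d c')
    show ?case
      by (induction y rule: lincomb_induct)
         (simp_all add: vscale_single bilin_single vscale_vscale bilin_add_right vscale_add_right mult_ac)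
  qed (simp_all add: bilin_add_left vscale_add_right)
qed

lemma hscale_mult: "hscale c x * y = hscale c (x * y)" "x * hscale c y = hscale c (x * y)"
  by (transfer, simp add: vcomp_def bilin_vscale)+

lemma htens_hscale: "htens (hscale c x) y = hscale c (htens x y)"
  by transfer (simp add: vtens_def bilin_vscale)

lemma htens_add: "htens (x + y) z = htens x z + htens y z"
  by transfer (simp add: vtens_add)

lemma htens_0 [simp]: "htens 0 z = 0"
  by transfer simp

lemma htens_sum: "htens (\<Sum>i\<in>I. f i) z = (\<Sum>i\<in>I. htens (f i) z)"
  by (induction I rule: infinite_finite_induct) (simp_all add: htens_add)

lemma hscale_simps [simp]:
  fixes x :: "'a::field hmor"
  shows "hscale 0 x = 0" "hscale c 0 = 0" "hscale 1 x = x" "hscale c (hscale d x) = hscale (c * d) x"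
proof -
  have "vscale 1 y = y" for y :: "'a lincomb"
    by (rule poly_mapping_eqI) (simp add: lookup_vscale)
  then show "hscale 1 x = x" by transfer simp
qed (transfer, simp add: vscale_vscale)+

lemma hscale_add: "hscale c (x + y) = hscale c x + hscale c y" "hscale (c + d) x = hscale c x + hscale d x"
  by (transfer; simp add: vscale_add_left vscale_add_right)+

lemma hscale_sum: "hscale c (\<Sum>i\<in>I. f i) = (\<Sum>i\<in>I. hscale c (f i))"
  by (induction I rule: infinite_finite_induct) (simp_all add: hscale_add)

text \<open>\<open>word_diag\<close> applies \<open>Abs_diagram\<close> to an arbitrary list of
  slices. Letters in \<open>{1..<r}\<close> keep the list a path from \<open>r\<close> upward
  strands to themselves, so the representation is the expected one.\<close>

lemma Rep_word_diag:
  assumes "set ws \<subseteq> {1..<r}"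
  shows "Rep_diagram (word_diag r ws) = (replicate r Up, map (cross_slice r) ws)"
    "path_end (replicate r Up) (map (cross_slice r) ws) = replicate r Up"
proof -
  have rep: "replicate i Up @ [Up, Up] @ replicate j Up = replicate (i + 2 + j) Up" for i j
    by (simp add: replicate_add numeral_2_eq_2 replicate_app_Cons_same)
  have dom: "sdom (cross_slice r i) = replicate r Up" "scod (cross_slice r i) = replicate r Up"
    if "i \<in> {1..<r}" for i
    using that rep [of "i - 1" "r - i - 1"] by (simp_all add: cross_slice_def)
  have *: "is_path (replicate r Up) (map (cross_slice r) ws) \<and>
      path_end (replicate r Up) (map (cross_slice r) ws) = replicate r Up"
    using assms by (induction ws) (simp_all add: dom)
  then show "path_end (replicate r Up) (map (cross_slice r) ws) = replicate r Up" ..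
  show "Rep_diagram (word_diag r ws) = (replicate r Up, map (cross_slice r) ws)"
    unfolding word_diag_def by (rule Abs_diagram_inverse) (use * in simp)
qed

lemma diagram_eqI: "Rep_diagram d = Rep_diagram e \<Longrightarrow> d = e"
  by (simp add: Rep_diagram_inject)

lemma word_diag_dom:
  assumes "set ws \<subseteq> {1..<r}"
  shows "ddom (word_diag r ws) = replicate r Up" "dcod (word_diag r ws) = replicate r Up"
  using Rep_word_diag [OF assms] by (simp_all add: ddom.rep_eq dcod.rep_eq)

section \<open>Crossing words and the relations of the symmetric group\<close>

definition wmor :: "nat \<Rightarrow> nat list \<Rightarrow> 'k::field hmor" where
  "wmor r ws = hdiag (word_diag r ws)"

text \<open>Words are read from bottom to top while \<open>*\<close> composes from right to left, so
  the order reverses.\<close>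

lemma wmor_append:
  assumes "set ws \<subseteq> {1..<r}" "set vs \<subseteq> {1..<r}"
  shows "wmor r (ws @ vs) = (wmor r vs * wmor r ws :: 'k::field hmor)"
proof -
  have "word_diag r (ws @ vs) = dcomp (word_diag r vs) (word_diag r ws)"
    by (rule diagram_eqI) (use assms in \<open>simp add: dcomp.rep_eq Rep_word_diag\<close>)
  then show ?thesis
    by (simp add: wmor_def hdiag_mult word_diag_dom [OF assms(1)] word_diag_dom [OF assms(2)])
qed

lemma wmor_Nil: "wmor r [] = hdiag (did (replicate r Up))"
  unfolding wmor_def
  by (rule arg_cong [where f = hdiag], rule diagram_eqI) (simp add: Rep_word_diag did.rep_eq)

text \<open>The relations are given on two or three strands; padding moves them to any position
  among \<open>r\<close> strands.\<close>

definition pad :: "nat \<Rightarrow> nat \<Rightarrow> 'k::field hmor \<Rightarrow> 'k hmor" where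
  "pad i j x = htens (hdiag (did (replicate i Up))) (htens x (hdiag (did (replicate j Up))))"

lemma widen_Nil [simp]: "widen [] [] l = l"
  by (cases l) simp

lemma widen_widen [simp]: "widen p q (widen p' q' l) = widen (p @ p') (q' @ q) l"
  by (cases l) simp

lemma widen_cross_slice:
  "k \<in> {1..<s} \<Longrightarrow> widen (replicate i Up) (replicate j Up) (cross_slice s k) = cross_slice (i + s + j) (i + k)"
  by (simp add: cross_slice_def flip: replicate_add)

lemma pad_wmor:
  assumes "set ws \<subseteq> {1..<s}"
  shows "pad i j (wmor s ws) = (wmor (i + s + j) (map ((+) i) ws) :: 'k::field hmor)"
proof -
  have v: "set (map ((+) i) ws) \<subseteq> {1..<i + s + j}" using assms by auto
  have "map (widen (replicate i Up) (replicate j Up) \<circ> cross_slice s) ws =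
      map (cross_slice (i + s + j) \<circ> (+) i) ws"
    using assms widen_cross_slice by (intro map_cong refl) auto
  then have "dtens (did (replicate i Up)) (dtens (word_diag s ws) (did (replicate j Up))) =
      word_diag (i + s + j) (map ((+) i) ws)"
    by (intro diagram_eqI)
       (simp add: dtens.rep_eq did.rep_eq Rep_word_diag [OF assms] Rep_word_diag [OF v] comp_def replicate_add)
  then show ?thesis by (simp add: pad_def wmor_def htens_hdiag)
qed

lemma wmor_cross: "wmor 2 [1] = hdiag (dgen Cross)"
proof -
  have "word_diag 2 [1] = dgen Cross"
    by (rule diagram_eqI) (simp add: Rep_word_diag dgen.rep_eq cross_slice_def numeral_2_eq_2)
  then show ?thesis by (simp add: wmor_def)
qed

lemma wmor_cross_pads:
  "htens (hdiag (dgen Cross)) (hdiag (did [Up])) = wmor 3 [1]"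
  "htens (hdiag (did [Up])) (hdiag (dgen Cross)) = wmor 3 [2]"
proof -
  have "dtens (dgen Cross) (did [Up]) = word_diag 3 [1]" "dtens (did [Up]) (dgen Cross) = word_diag 3 [2]"
    by (rule diagram_eqI, simp add: Rep_word_diag dtens.rep_eq dgen.rep_eq did.rep_eq cross_slice_def numeral_2_eq_2 numeral_3_eq_3)+
  then show "htens (hdiag (dgen Cross)) (hdiag (did [Up])) = wmor 3 [1]"
    "htens (hdiag (did [Up])) (hdiag (dgen Cross)) = wmor 3 [2]"
    by (simp_all add: wmor_def htens_hdiag)
qed

lemma abs_hmor_simps:
  "abs_hmor (x \<boxdot> y) = abs_hmor x * abs_hmor y" "abs_hmor (x \<boxtimes> y) = htens (abs_hmor x) (abs_hmor y)"
  "abs_hmor (vdiag d) = hdiag d"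
  by (simp_all add: times_hmor.abs_eq htens.abs_eq hdiag.abs_eq)

lemma wmor_2_involution: "wmor 2 [1, 1] = (wmor 2 [] :: 'k::field hmor)"
proof -
  have "wmor 2 [1, 1] = wmor 2 [1] * (wmor 2 [1] :: 'k hmor)"
    using wmor_append [of "[1]" 2 "[1]", where ?'k = 'k] by simp
  also have "\<dots> = abs_hmor (vgen Cross \<boxdot> vgen Cross)"
    unfolding wmor_cross by (simp add: abs_hmor_simps)
  also have "\<dots> = abs_hmor (vid [Up, Up])" by (rule abs_hmor_rel [OF heis_rel.involution])
  also have "\<dots> = wmor 2 []" by (simp add: abs_hmor_simps wmor_Nil numeral_2_eq_2)
  finally show ?thesis .
qed

lemma wmor_3_braid: "wmor 3 [1, 2, 1] = (wmor 3 [2, 1, 2] :: 'k::field hmor)"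
proof -
  have "wmor 3 [1, 2, 1] = wmor 3 [1] * (wmor 3 [2] * (wmor 3 [1] :: 'k hmor))"
    using wmor_append [of "[1]" 3 "[2]", where ?'k = 'k] wmor_append [of "[1, 2]" 3 "[1]", where ?'k = 'k]
    by simp
  also have "\<dots> = abs_hmor ((vgen Cross \<boxtimes> vid [Up]) \<boxdot> (vid [Up] \<boxtimes> vgen Cross) \<boxdot> (vgen Cross \<boxtimes> vid [Up]))"
    by (simp add: abs_hmor_simps wmor_cross_pads)
  also have "\<dots> = abs_hmor ((vid [Up] \<boxtimes> vgen Cross) \<boxdot> (vgen Cross \<boxtimes> vid [Up]) \<boxdot> (vid [Up] \<boxtimes> vgen Cross))"
    by (rule abs_hmor_rel [OF heis_rel.braid])
  also have "\<dots> = wmor 3 [2] * (wmor 3 [1] * wmor 3 [2])"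
    by (simp add: abs_hmor_simps wmor_cross_pads)
  also have "\<dots> = wmor 3 [2, 1, 2]"
    using wmor_append [of "[2]" 3 "[1]", where ?'k = 'k] wmor_append [of "[2, 1]" 3 "[2]", where ?'k = 'k]
    by (simp add: mult.assoc)
  finally show ?thesis .
qed

lemma wmor_involution:
  assumes "i \<in> {1..<r}"
  shows "wmor r [i, i] = (wmor r [] :: 'k::field hmor)"
proof -
  have e: "i - 1 + 2 + (r - i - 1) = r" using assms by auto
  have "wmor r (map ((+) (i - 1)) [1, 1]) = (wmor r (map ((+) (i - 1)) []) :: 'k hmor)"
    using pad_wmor [of "[1, 1]" 2 "i - 1" "r - i - 1", where ?'k = 'k, unfolded e]
      pad_wmor [of "[]" 2 "i - 1" "r - i - 1", where ?'k = 'k, unfolded e] wmor_2_involution [where ?'k = 'k]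
    by simp
  then show ?thesis using assms by simp
qed

lemma wmor_braid:
  assumes "1 \<le> i" "Suc i < r"
  shows "wmor r [i, Suc i, i] = (wmor r [Suc i, i, Suc i] :: 'k::field hmor)"
proof -
  have e: "i - 1 + 3 + (r - i - 2) = r" using assms by auto
  have "wmor r (map ((+) (i - 1)) [1, 2, 1]) = (wmor r (map ((+) (i - 1)) [2, 1, 2]) :: 'k hmor)"
    using pad_wmor [of "[1, 2, 1]" 3 "i - 1" "r - i - 2", where ?'k = 'k, unfolded e]
      pad_wmor [of "[2, 1, 2]" 3 "i - 1" "r - i - 2", where ?'k = 'k, unfolded e] wmor_3_braid [where ?'k = 'k]
    by simp
  then show ?thesis using assms by simp
qed

text \<open>Cutting the strands after position \<open>Suc i\<close> puts the two crossings into
  different tensor factors. The two heights in the exchange relation are then the two words.\<close>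

lemma wmor_commute:
  assumes "1 \<le> i" "Suc i < j" "j < r"
  shows "wmor r [i, j] = (wmor r [j, i] :: 'k::field hmor)"
proof -
  let ?d = "word_diag (Suc i) [i]" and ?e = "word_diag (r - Suc i) [j - Suc i]"
  have v: "set [i] \<subseteq> {1..<Suc i}" "set [j - Suc i] \<subseteq> {1..<r - Suc i}" "set [i, j] \<subseteq> {1..<r}" "set [j, i] \<subseteq> {1..<r}"
    using assms by auto
  have r: "replicate (Suc i) Up @ replicate (r - Suc i) Up = replicate r Up"
    by (subst replicate_add [symmetric]) (use assms in simp)
  have wi: "widen [] (replicate (r - Suc i) Up) (cross_slice (Suc i) i) = cross_slice r i"
    using widen_cross_slice [of i "Suc i" 0 "r - Suc i"] assms by simp
  have "j - Suc i \<in> {1..<r - Suc i}" using assms by auto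
  then have wj: "widen (replicate (Suc i) Up) [] (cross_slice (r - Suc i) (j - Suc i)) = cross_slice r j"
    using widen_cross_slice [of "j - Suc i" "r - Suc i" "Suc i" 0] assms by (simp del: replicate_Suc)
  have "dtens ?d ?e = word_diag r [i, j]"
    by (rule diagram_eqI)
       (use Rep_word_diag(2) [OF v(1)] in
         \<open>simp only: dtens.rep_eq Rep_word_diag [OF v(1)] Rep_word_diag [OF v(2)] Rep_word_diag [OF v(3)] prod.case r list.map wi wj append.simps\<close>)
  moreover have "dtens' ?d ?e = word_diag r [j, i]"
    by (rule diagram_eqI)
       (use Rep_word_diag(2) [OF v(2)] in
         \<open>simp only: dtens'.rep_eq Rep_word_diag [OF v(1)] Rep_word_diag [OF v(2)] Rep_word_diag [OF v(4)] prod.case r list.map wi wj append.simps\<close>)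
  moreover have "hdiag (dtens ?d ?e) = (hdiag (dtens' ?d ?e) :: 'k hmor)"
    using abs_hmor_rel [OF heis_rel.exchange [of ?d ?e], where ?'a = 'k] by (simp add: abs_hmor_simps)
  ultimately show ?thesis by (simp add: wmor_def)
qed

section \<open>The word problem\<close>

lemma word_perm_Nil [simp]: "word_perm [] = id"
  by (simp add: word_perm_def)

lemma word_perm_append: "word_perm (ws @ vs) = word_perm vs \<circ> word_perm ws"
proof -
  have "fold (\<lambda>i \<sigma>. transpose i (i + 1) \<circ> \<sigma>) vs \<tau> = fold (\<lambda>i \<sigma>. transpose i (i + 1) \<circ> \<sigma>) vs id \<circ> \<tau>" for \<tau> :: "nat \<Rightarrow> nat"
  proof (induction vs arbitrary: \<tau>)
    case (Cons i vs)
    show ?case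
      using Cons [of "transpose i (i + 1) \<circ> \<tau>"] Cons [of "transpose i (i + 1) \<circ> id"] by (simp add: o_assoc)
  qed simp
  from this [of "word_perm ws"] show ?thesis by (simp add: word_perm_def)
qed

lemma word_perm_single [simp]: "word_perm [i] = transpose i (Suc i)"
  by (simp add: word_perm_def)

lemma word_perm_Cons: "word_perm (i # ws) = word_perm ws \<circ> transpose i (Suc i)"
  using word_perm_append [of "[i]" ws] by simp

lemma word_perm_permutes: "set ws \<subseteq> {1..<r} \<Longrightarrow> word_perm ws permutes {1..r}"
proof (induction ws)
  case (Cons i ws)
  have "transpose i (Suc i) permutes {1..r}" using Cons.prems by (intro permutes_swap_id) auto
  then show ?case
    unfolding word_perm_Cons by (rule permutes_compose) (use Cons in auto)
qed (simp add: permutes_id)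

text \<open>Equality of morphisms and of permutations is tracked together, so that one rewriting
  yields both. The \<open>itself\<close> argument fixes the field, which the two words do not
  determine.\<close>

definition weq :: "'k::field itself \<Rightarrow> nat \<Rightarrow> nat list \<Rightarrow> nat list \<Rightarrow> bool" where
  "weq _ r ws vs \<longleftrightarrow> set ws \<subseteq> {1..<r} \<and> set vs \<subseteq> {1..<r} \<and>
     wmor r ws = (wmor r vs :: 'k hmor) \<and> word_perm ws = word_perm vs"

lemma weq_refl: "set ws \<subseteq> {1..<r} \<Longrightarrow> weq K r ws ws"
  by (simp add: weq_def)

lemma weq_sym: "weq K r ws vs \<Longrightarrow> weq K r vs ws"
  by (simp add: weq_def)

lemma weq_trans [trans]: "weq K r us vs \<Longrightarrow> weq K r vs ws \<Longrightarrow> weq K r us ws"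
  by (simp add: weq_def)

lemma weq_append: "weq K r ws vs \<Longrightarrow> weq K r ws' vs' \<Longrightarrow> weq K r (ws @ ws') (vs @ vs')"
  by (simp add: weq_def wmor_append word_perm_append)

lemma weq_involution: "i \<in> {1..<r} \<Longrightarrow> weq K r [i, i] []"
  by (simp add: weq_def wmor_involution word_perm_Cons)

lemma weq_commute:
  assumes "1 \<le> i" "Suc i < j" "j < r"
  shows "weq K r [i, j] [j, i]"
proof -
  have "transpose j (Suc j) \<circ> transpose i (Suc i) = transpose i (Suc i) \<circ> transpose j (Suc j)"
    using assms by (auto simp: fun_eq_iff transpose_def)
  then show ?thesis using assms by (auto simp: weq_def wmor_commute [OF assms] word_perm_Cons)
qed

lemma weq_braid:
  assumes "1 \<le> i" "Suc i < r"
  shows "weq K r [i, Suc i, i] [Suc i, i, Suc i]"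
proof -
  have "transpose i (Suc i) \<circ> transpose (Suc i) (Suc (Suc i)) \<circ> transpose i (Suc i) =
      transpose (Suc i) (Suc (Suc i)) \<circ> transpose i (Suc i) \<circ> transpose (Suc i) (Suc (Suc i))"
    by (auto simp: fun_eq_iff transpose_def)
  then show ?thesis using assms by (auto simp: weq_def wmor_braid [OF assms] word_perm_Cons o_assoc)
qed

text \<open>The descending run k, k-1, ..., j, empty for \<open>j = Suc k\<close>. It carries the
  point \<open>Suc k\<close> to \<open>j\<close>, so these runs represent the cosets of S_k in
  S_(k+1).\<close>

definition desc :: "nat \<Rightarrow> nat \<Rightarrow> nat list" where
  "desc k j = rev [j..<Suc k]"

lemma set_desc: "set (desc k j) = {j..k}"
  by (auto simp: desc_def)

lemma desc_snoc: "j \<le> k \<Longrightarrow> desc k j = desc k (Suc j) @ [j]"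
  unfolding desc_def by (subst upt_conv_Cons) auto

lemma desc_split: "j \<le> i \<Longrightarrow> i \<le> k \<Longrightarrow> desc k j = desc k (Suc i) @ desc i j"
  unfolding desc_def using upt_add_eq_append [of j "Suc i" "k - i"] by simp

lemma weq_commute_list:
  assumes "1 \<le> i" "\<And>x. x \<in> set xs \<Longrightarrow> (1 \<le> x \<and> Suc x < i \<or> Suc i < x) \<and> x < r" "i < r"
  shows "weq K r (xs @ [i]) (i # xs)"
  using assms(2)
proof (induction xs)
  case Nil
  then show ?case using assms by (simp add: weq_refl)
next
  case (Cons x xs)
  have x: "1 \<le> x \<and> Suc x < i \<or> Suc i < x" "x < r" using Cons.prems by auto
  have xs: "set xs \<subseteq> {1..<r}"
  proof
    fix y assume "y \<in> set xs"
    then have "(1 \<le> y \<and> Suc y < i \<or> Suc i < y) \<and> y < r" by (intro Cons.prems) simp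
    then show "y \<in> {1..<r}" by auto
  qed
  have a1: "weq K r ([x] @ (xs @ [i])) ([x] @ (i # xs))"
  proof (rule weq_append)
    show "weq K r [x] [x]" using x assms by (auto intro: weq_refl)
    show "weq K r (xs @ [i]) (i # xs)" by (rule Cons.IH) (rule Cons.prems, simp)
  qed
  have a2: "weq K r ([x, i] @ xs) ([i, x] @ xs)"
  proof (intro weq_append weq_refl xs)
    show "weq K r [x, i] [i, x]"
      using x assms weq_commute [of x i r K] weq_sym [OF weq_commute [of i x r K]] by auto
  qed
  show ?case using weq_trans [OF a1, of "[i, x] @ xs"] a2 by simp
qed

text \<open>Letters are appended one at a time to a normal form. A new letter commutes to the left,
  lengthens the run, cancels its last letter, or passes through the run with its index lowered by
  one.\<close>

lemma weq_normal_form: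
  assumes "set ws \<subseteq> {1..k}" "k < r"
  shows "\<exists>j vs. 1 \<le> j \<and> j \<le> Suc k \<and> set vs \<subseteq> {1..<k} \<and> weq K r ws (vs @ desc k j)"
  using assms(1)
proof (induction ws rule: rev_induct)
  case Nil
  have "weq K r [] ([] @ desc k (Suc k))" by (simp add: desc_def weq_refl)
  then show ?case by (intro exI [of _ "Suc k"] exI [of _ "[]"]) auto
next
  case (snoc i ws)
  then obtain j vs where j: "1 \<le> j" "j \<le> Suc k" and vs: "set vs \<subseteq> {1..<k}" and eq: "weq K r ws (vs @ desc k j)"
    by auto
  have i: "1 \<le> i" "i \<le> k" using snoc.prems by auto
  have val: "set vs \<subseteq> {1..<r}" "set (desc k a) \<subseteq> {1..<r}" if "1 \<le> a" for a
    using vs assms(2) that by (auto simp: set_desc)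
  have "weq K r (ws @ [i]) ((vs @ desc k j) @ [i])"
    by (intro weq_append eq weq_refl) (use i assms(2) in auto)
  then have step: "weq K r (ws @ [i]) (vs @ (desc k j @ [i]))" by simp
  consider "Suc i < j" | "Suc i = j" | "i = j" | "j < i" by linarith
  then show ?case
  proof cases
    case 1
    have "weq K r (desc k j @ [i]) (i # desc k j)"
      using 1 i assms(2) by (intro weq_commute_list) (auto simp: set_desc)
    then have "weq K r (vs @ (desc k j @ [i])) (vs @ (i # desc k j))"
      using val(1) by (intro weq_append weq_refl) auto
    then have "weq K r (ws @ [i]) ((vs @ [i]) @ desc k j)" using weq_trans [OF step] by simp
    moreover have "set (vs @ [i]) \<subseteq> {1..<k}" using vs i 1 j by auto
    ultimately show ?thesis using j by blast
  next
    case 2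
    then have "weq K r (ws @ [i]) (vs @ desc k i)" using step desc_snoc [of i k] i by simp
    then show ?thesis using vs i by (intro exI [of _ i] exI [of _ vs]) auto
  next
    case 3
    have "weq K r ((vs @ desc k (Suc j)) @ [j, j]) ((vs @ desc k (Suc j)) @ [])"
      using 3 i assms(2) val(1) val(2) [of "Suc j"] by (intro weq_append weq_refl weq_involution) auto
    then have "weq K r (vs @ (desc k j @ [i])) (vs @ desc k (Suc j))"
      using desc_snoc [of j k] 3 i by simp
    then have "weq K r (ws @ [i]) (vs @ desc k (Suc j))" using weq_trans [OF step] by blast
    then show ?thesis using vs i 3 by (intro exI [of _ "Suc j"] exI [of _ vs]) auto
  next
    case 4
    \<comment> \<open>Here \<open>i\<close> is an interior letter of the run: it commutes past the
      letters below \<open>p\<close>, the braid relation turns \<open>i, p, i\<close> into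
      \<open>p, i, p\<close>, and the first \<open>p\<close> commutes past the letters above
      \<open>i\<close>.\<close>
    define p where "p = i - 1"
    have p: "i = Suc p" "j \<le> p" using 4 by (auto simp: p_def)
    have d1: "desc k j = desc k (Suc i) @ [i, p] @ desc_rest" if "desc_rest = rev [j..<p]" for desc_rest
    proof -
      have "desc k j = desc k (Suc i) @ desc i j" using 4 i by (intro desc_split) auto
      also have "desc i j = [i, p] @ desc_rest" using p that by (simp add: desc_def)
      finally show ?thesis .
    qed
    define rest where "rest = rev [j..<p]"
    note d = d1 [OF rest_def]
    have vr: "set rest \<subseteq> {1..<r}" using p i assms(2) j by (auto simp: rest_def)
    have dr: "set (desc k (Suc i)) \<subseteq> {1..<r}" using val(2) by simp
    have a1: "weq K r (desc k (Suc i) @ ([i, p] @ (rest @ [i]))) (desc k (Suc i) @ ([i, p] @ (i # rest)))"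
      using p i assms(2) j dr by (intro weq_append weq_refl weq_commute_list) (auto simp: rest_def)
    have a2: "weq K r (desc k (Suc i) @ ([i, p, i] @ rest)) (desc k (Suc i) @ ([p, i, p] @ rest))"
    proof (intro weq_append weq_refl vr dr)
      show "weq K r [i, p, i] [p, i, p]"
        using weq_sym [OF weq_braid [of p r K]] p i j assms(2) by simp
    qed
    have a: "weq K r (desc k j @ [i]) ((desc k (Suc i) @ [p]) @ ([i, p] @ rest))"
      using weq_trans [OF a1, of "desc k (Suc i) @ ([p, i, p] @ rest)"] a2 by (simp add: d)
    have "weq K r ((desc k (Suc i) @ [p]) @ ([i, p] @ rest)) ((p # desc k (Suc i)) @ ([i, p] @ rest))"
      using p i assms(2) j vr by (intro weq_append weq_refl weq_commute_list) (auto simp: set_desc)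
    then have "weq K r (desc k j @ [i]) (p # desc k j)" using weq_trans [OF a] by (simp add: d)
    then have "weq K r (vs @ (desc k j @ [i])) (vs @ (p # desc k j))"
      using val(1) by (intro weq_append weq_refl) auto
    then have "weq K r (ws @ [i]) ((vs @ [p]) @ desc k j)" using weq_trans [OF step] by simp
    moreover have "set (vs @ [p]) \<subseteq> {1..<k}" using vs i p j by auto
    ultimately show ?thesis using j by blast
  qed
qed

lemma word_perm_desc: "1 \<le> j \<Longrightarrow> j \<le> Suc k \<Longrightarrow> word_perm (desc k j) (Suc k) = j"
proof (induction "Suc k - j" arbitrary: j)
  case 0
  then show ?case by (simp add: desc_def)
next
  case (Suc d)
  then have "word_perm (desc k (Suc j)) (Suc k) = Suc j" by (intro Suc.hyps(1)) auto
  then show ?case using desc_snoc [of j k] Suc.hyps(2) by (simp add: word_perm_append)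
qed

lemma word_perm_last: "set ws \<subseteq> {1..<k} \<Longrightarrow> word_perm ws (Suc k) = Suc k"
  by (rule permutes_not_in [OF word_perm_permutes [of ws k]]) auto

lemma bij_word_perm: "0 \<notin> set ws \<Longrightarrow> bij (word_perm ws)"
proof -
  assume "0 \<notin> set ws"
  then have "set ws \<subseteq> {1..<Suc (Max (insert 0 (set ws)))}"
    by (auto simp: Suc_le_eq less_Suc_eq_le intro: gr0I)
  from permutes_bij [OF word_perm_permutes [OF this]] show ?thesis .
qed

text \<open>Faithfulness of the presentation by adjacent transpositions. Both words are normalized;
  the prefix fixes the last point, so the permutation reveals \<open>j\<close>. Cancelling the
  common run leaves prefixes with one generator fewer, to which induction applies.\<close>

lemma wmor_word_perm:
  assumes "set ws \<subseteq> {1..k}" "set vs \<subseteq> {1..k}" "k < r" "word_perm ws = word_perm vs"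
  shows "wmor r ws = (wmor r vs :: 'k::field hmor)"
  using assms
proof (induction k arbitrary: ws vs)
  case 0
  then show ?case by simp
next
  case (Suc k)
  let ?K = "TYPE('k)"
  obtain j us where j: "1 \<le> j" "j \<le> Suc (Suc k)" "set us \<subseteq> {1..<Suc k}" "weq ?K r ws (us @ desc (Suc k) j)"
    using weq_normal_form [OF Suc.prems(1,3)] by blast
  obtain j' us' where j': "1 \<le> j'" "j' \<le> Suc (Suc k)" "set us' \<subseteq> {1..<Suc k}" "weq ?K r vs (us' @ desc (Suc k) j')"
    using weq_normal_form [OF Suc.prems(2,3)] by blast
  have eq: "word_perm (desc (Suc k) j) \<circ> word_perm us = word_perm (desc (Suc k) j') \<circ> word_perm us'"
    using j(4) j'(4) Suc.prems(4) by (simp add: weq_def word_perm_append)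
  have "j = j'"
    using fun_cong [OF eq, of "Suc (Suc k)"] j j' by (simp add: word_perm_last word_perm_desc)
  then have "word_perm us = word_perm us'"
    using eq bij_is_inj [OF bij_word_perm, of "desc (Suc k) j"] j(1)
    by (simp add: set_desc fun.inj_map_strong inj_compose fun_eq_iff inj_eq)
  then have "wmor r us = (wmor r us' :: 'k hmor)"
    using j(3) j'(3) Suc.prems(3) by (intro Suc.IH) auto
  moreover have "set us \<subseteq> {1..<r}" "set us' \<subseteq> {1..<r}" "set (desc (Suc k) j) \<subseteq> {1..<r}"
    using j j' Suc.prems(3) by (auto simp: set_desc)
  ultimately show ?case
    using j(4) j'(4) \<open>j = j'\<close> by (simp add: weq_def wmor_append)
qed

text \<open>A run sends the last point to its image; undoing it leaves a permutation of fewer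
  points.\<close>

lemma word_exists: "\<sigma> permutes {1..r} \<Longrightarrow> \<exists>ws. set ws \<subseteq> {1..<r} \<and> word_perm ws = \<sigma>"
proof (induction r arbitrary: \<sigma>)
  case 0
  then show ?case by (intro exI [of _ "[]"]) simp
next
  case (Suc r)
  let ?j = "\<sigma> (Suc r)" and ?d = "desc r (\<sigma> (Suc r))"
  have j: "1 \<le> ?j" "?j \<le> Suc r" using permutes_in_image [OF Suc.prems, of "Suc r"] by auto
  have dv: "set ?d \<subseteq> {1..<Suc r}" using j by (auto simp: set_desc)
  note dp = word_perm_permutes [OF dv]
  define \<tau> where "\<tau> = inv_into UNIV (word_perm ?d) \<circ> \<sigma>"
  have "\<tau> permutes {1..Suc r}" unfolding \<tau>_def by (intro permutes_compose Suc.prems permutes_inv dp)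
  then have "\<tau> permutes {1..r}"
    by (rule permutes_fix_last)
       (use permutes_inverses(2) [OF dp, of "Suc r"] in \<open>simp add: \<tau>_def word_perm_desc [OF j]\<close>)
  then obtain vs where vs: "set vs \<subseteq> {1..<r}" "word_perm vs = \<tau>" using Suc.IH by auto
  have "word_perm (vs @ ?d) = \<sigma>"
    using permutes_inverses(1) [OF dp] by (simp add: word_perm_append vs \<tau>_def fun_eq_iff)
  moreover have "set (vs @ ?d) \<subseteq> {1..<Suc r}" using vs dv by auto
  ultimately show ?case by blast
qed

lemma hdiag_perm_diag:
  assumes "set ws \<subseteq> {1..<r}"
  shows "hdiag (perm_diag r (word_perm ws)) = (wmor r ws :: 'k::field hmor)"
proof -
  define vs where "vs = (SOME vs. set vs \<subseteq> {1..<r} \<and> word_perm vs = word_perm ws)"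
  have vs: "set vs \<subseteq> {1..<r} \<and> word_perm vs = word_perm ws"
    unfolding vs_def by (rule someI [of _ ws]) (use assms in simp)
  have "wmor r vs = (wmor r ws :: 'k hmor)"
  \<comment> \<open>The bound \<open>r - 1 < r\<close> used for the general case fails for the empty
    diagram, where both words are empty.\<close>
  proof (cases "r = 0")
    case True
    then show ?thesis using vs assms by simp
  next
    case False
    then have e: "{1..<r} = {1..r - 1}" by auto
    show ?thesis
      using vs assms False unfolding e by (intro wmor_word_perm [where k = "r - 1"]) simp_all
  qed
  then show ?thesis by (simp add: perm_diag_def wmor_def vs_def)
qed

section \<open>The action of the group algebra on strands\<close>

definition pmor :: "nat \<Rightarrow> sperm \<Rightarrow> 'k::field hmor" where
  "pmor r g = hdiag (perm_diag r (pfun g))"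

text \<open>\<open>perm_diag\<close> chooses a word separately for each number of strands. A single
  word valid for all \<open>r' \<ge> r\<close> is what lets diagrams on \<open>r\<close> and
  \<open>Suc r\<close> strands be compared.\<close>

lemma pmor_word:
  assumes "g \<in> symg r"
  shows "\<exists>ws. set ws \<subseteq> {1..<r} \<and> word_perm ws = pfun g \<and>
    (\<forall>r'\<ge>r. pmor r' g = (wmor r' ws :: 'k::field hmor))"
proof -
  obtain ws where ws: "set ws \<subseteq> {1..<r}" "word_perm ws = pfun g"
    using word_exists assms unfolding symg_def by blast
  have "pmor r' g = (wmor r' ws :: 'k hmor)" if "r \<le> r'" for r'
    unfolding pmor_def ws(2) [symmetric] using ws(1) that by (intro hdiag_perm_diag) auto
  with ws show ?thesis by blast
qed

lemma pmor_mult: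
  assumes "g \<in> symg r" "h \<in> symg r"
  shows "pmor r (g + h) = (pmor r g * pmor r h :: 'k::field hmor)"
proof -
  obtain ws where ws: "set ws \<subseteq> {1..<r}" "word_perm ws = pfun g" "pmor r g = (wmor r ws :: 'k hmor)"
    using pmor_word [OF assms(1), where ?'k = 'k] by blast
  obtain vs where vs: "set vs \<subseteq> {1..<r}" "word_perm vs = pfun h" "pmor r h = (wmor r vs :: 'k hmor)"
    using pmor_word [OF assms(2), where ?'k = 'k] by blast
  have "pmor r (g + h) = (hdiag (perm_diag r (word_perm (vs @ ws))) :: 'k hmor)"
    by (simp add: pmor_def pfun_plus word_perm_append ws vs)
  also have "\<dots> = wmor r (vs @ ws)" using ws vs by (intro hdiag_perm_diag) auto
  finally show ?thesis using ws vs by (simp add: wmor_append)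
qed

lemma pmor_tens:
  assumes "g \<in> symg r"
  shows "htens (pmor r g) (hdiag (did [Up])) = (pmor (Suc r) g :: 'k::field hmor)"
proof -
  obtain ws where ws: "set ws \<subseteq> {1..<r}" "\<And>r'. r \<le> r' \<Longrightarrow> pmor r' g = (wmor r' ws :: 'k hmor)"
    using pmor_word [OF assms, where ?'k = 'k] by blast
  have "dtens (word_diag r ws) (did [Up]) = word_diag (Suc r) ws"
  proof (rule diagram_eqI)
    have "set ws \<subseteq> {1..<Suc r}" using ws(1) by auto
    moreover have "map (widen [] [Up] \<circ> cross_slice r) ws = map (cross_slice (Suc r)) ws"
      using ws(1) widen_cross_slice [of _ r 0 1] by (intro map_cong refl) fastforce
    ultimately show "Rep_diagram (dtens (word_diag r ws) (did [Up])) = Rep_diagram (word_diag (Suc r) ws)"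
      using ws(1) by (simp add: dtens.rep_eq did.rep_eq Rep_word_diag replicate_append_same)
  qed
  then show ?thesis by (simp add: ws(2) wmor_def htens_hdiag)
qed

text \<open>Coefficients outside \<open>symg r\<close> are ignored, so multiplicativity is stated
  for elements supported there.\<close>

definition act :: "nat \<Rightarrow> 'k::field sga \<Rightarrow> 'k hmor" where
  "act r x = (\<Sum>g\<in>symg r. hscale (coeff x g) (pmor r g))"

lemma act_emb: "act r (emb r x) = galg_map r x"
  unfolding act_def galg_map_def sum_permutes_eq_symg pmor_def
  by (rule sum.cong) (simp_all add: coeff_emb)

lemma act_add: "act r (x + y) = act r x + act r y"
  by (simp add: act_def lookup_add hscale_add sum.distrib)

lemma act_smul: "act r (c \<cdot> x) = hscale c (act r x)"
  by (simp add: act_def hscale_sum)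

lemma act_0 [simp]: "act r 0 = 0"
  by (simp add: act_def)

lemma act_sum: "act r (\<Sum>i\<in>I. f i) = (\<Sum>i\<in>I. act r (f i))"
  by (induction I rule: infinite_finite_induct) (simp_all add: act_add)

lemma act_perm_elt: "g \<in> symg r \<Longrightarrow> act r (perm_elt g) = pmor r g"
proof -
  assume "g \<in> symg r"
  moreover have "act r (perm_elt g) = (\<Sum>h\<in>symg r. if h = g then pmor r h else 0)"
    unfolding act_def by (rule sum.cong) (auto simp: lookup_single when_def)
  ultimately show ?thesis by simp
qed

lemma act_mult:
  assumes "supp x \<subseteq> symg r" "supp y \<subseteq> symg r"
  shows "act r (x * y) = act r x * act r y"
proof -
  have "act r (x * y) = act r ((\<Sum>g\<in>symg r. coeff x g \<cdot> perm_elt g) * (\<Sum>h\<in>symg r. coeff y h \<cdot> perm_elt h))"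
    using sga_eq_sum_perm_elt [OF assms(1)] sga_eq_sum_perm_elt [OF assms(2)] by simp
  also have "\<dots> = (\<Sum>g\<in>symg r. \<Sum>h\<in>symg r. hscale (coeff x g * coeff y h) (pmor r (g + h)))"
    unfolding sum_product act_sum
    by (intro sum.cong refl) (simp add: act_smul act_perm_elt perm_elt_mult mult.commute)
  also have "\<dots> = (\<Sum>g\<in>symg r. \<Sum>h\<in>symg r. hscale (coeff x g) (pmor r g) * hscale (coeff y h) (pmor r h))"
    by (intro sum.cong refl) (simp add: pmor_mult hscale_mult mult.commute)
  also have "\<dots> = act r x * act r y"
    unfolding act_def sum_product ..
  finally show ?thesis .
qed

text \<open>Adding a strand on the right realizes the inclusion of k[S_r] in k[S_(r+1)], which
  changes nothing in the element itself.\<close>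

lemma act_tens:
  assumes "supp x \<subseteq> symg r"
  shows "htens (act r x) (hdiag (did [Up])) = act (Suc r) x"
proof -
  have "htens (act r x) (hdiag (did [Up])) = (\<Sum>g\<in>symg r. hscale (coeff x g) (pmor (Suc r) g))"
    by (simp add: act_def htens_sum htens_hscale pmor_tens)
  also have "\<dots> = act (Suc r) x"
    unfolding act_def
  proof (rule sum.mono_neutral_left)
    have "coeff x g = 0" if "g \<notin> symg r" for g
      using assms that by (meson in_keys_iff subsetD)
    then show "\<forall>g\<in>symg (Suc r) - symg r. hscale (coeff x g) (pmor (Suc r) g) = 0" by simp
    show "symg r \<subseteq> symg (Suc r)" by (rule symg_mono) simp
  qed simp
  finally show ?thesis .
qed

section \<open>Membership in the hom-spaces\<close>

lemma hom_set_hdiag: "ddom d = a \<Longrightarrow> dcod d = b \<Longrightarrow> hdiag d \<in> hom_set a b"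
  unfolding hom_set_def by (intro image_eqI [where x = "vdiag d"]) (simp_all add: hdiag.abs_eq vdiag_def)

lemma hom_set_0: "0 \<in> hom_set a b"
  unfolding hom_set_def by (intro image_eqI [where x = 0]) (simp_all add: zero_hmor.abs_eq)

lemma hom_set_add: "x \<in> hom_set a b \<Longrightarrow> y \<in> hom_set a b \<Longrightarrow> x + y \<in> hom_set a b"
  unfolding hom_set_def
proof clarify
  fix x y :: "'a lincomb"
  assume *: "\<forall>d\<in>Poly_Mapping.keys x. ddom d = a \<and> dcod d = b" "\<forall>d\<in>Poly_Mapping.keys y. ddom d = a \<and> dcod d = b"
  show "abs_hmor x + abs_hmor y \<in> abs_hmor ` {x. \<forall>d\<in>Poly_Mapping.keys x. ddom d = a \<and> dcod d = b}"
    using * keys_add [of x y]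
    by (intro image_eqI [where x = "x + y"]) (auto simp: plus_hmor.abs_eq)
qed

lemma hom_set_hscale: "x \<in> hom_set a b \<Longrightarrow> hscale c x \<in> hom_set a b"
  unfolding hom_set_def
proof clarify
  fix x :: "'a lincomb"
  assume *: "\<forall>d\<in>Poly_Mapping.keys x. ddom d = a \<and> dcod d = b"
  show "hscale c (abs_hmor x) \<in> abs_hmor ` {x. \<forall>d\<in>Poly_Mapping.keys x. ddom d = a \<and> dcod d = b}"
    using * by (intro image_eqI [where x = "vscale c x"]) (auto simp: hscale.abs_eq in_keys_iff lookup_vscale)
qed

lemma hom_set_act: "act r x \<in> hom_set (replicate r Up) (replicate r Up)"
proof -
  have p: "pmor r g \<in> hom_set (replicate r Up) (replicate r Up)" if g: "g \<in> symg r" for g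
    using pmor_word [OF g] by (metis hom_set_hdiag order_refl wmor_def word_diag_dom)
  have "A \<subseteq> symg r \<Longrightarrow> (\<Sum>g\<in>A. hscale (coeff x g) (pmor r g)) \<in> hom_set (replicate r Up) (replicate r Up)" for A
    by (induction A rule: infinite_finite_induct) (auto intro!: hom_set_0 hom_set_add hom_set_hscale p)
  then show ?thesis by (simp add: act_def)
qed

section \<open>Matrices of group algebra elements\<close>

text \<open>All morphisms involved are matrices over the image of one \<open>act n\<close>, so that
  their identities reduce to sums of products in the group algebra.\<close>

definition amat :: "nat \<Rightarrow> nat \<Rightarrow> nat \<Rightarrow> (nat \<Rightarrow> nat \<Rightarrow> 'k::field sga) \<Rightarrow> 'k hmor mat" where
  "amat n nr nc h = mat nr nc (\<lambda>(i, j). act n (h i j))"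

definition amat1 :: "nat \<Rightarrow> 'k::field sga \<Rightarrow> 'k hmor mat" where
  "amat1 n x = amat n 1 1 (\<lambda>_ _. x)"

lemma amat_cong: "(\<And>i j. i < nr \<Longrightarrow> j < nc \<Longrightarrow> h i j = h' i j) \<Longrightarrow> amat n nr nc h = amat n nr nc h'"
  by (rule eq_matI) (simp_all add: amat_def)

lemma amat_mult:
  assumes "\<And>i l. i < nr \<Longrightarrow> l < k \<Longrightarrow> supp (h i l) \<subseteq> symg n"
    and "\<And>l j. l < k \<Longrightarrow> j < nc \<Longrightarrow> supp (h' l j) \<subseteq> symg n"
  shows "amat n nr k h * amat n k nc h' = amat n nr nc (\<lambda>i j. \<Sum>l<k. h i l * h' l j)"
proof (rule eq_matI)
  fix i j assume "i < dim_row (amat n nr nc (\<lambda>i j. \<Sum>l<k. h i l * h' l j))"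
    "j < dim_col (amat n nr nc (\<lambda>i j. \<Sum>l<k. h i l * h' l j))"
  then have ij: "i < nr" "j < nc" by (simp_all add: amat_def)
  then have "(amat n nr k h * amat n k nc h') $$ (i, j) = (\<Sum>l<k. act n (h i l) * act n (h' l j))"
    by (simp add: amat_def scalar_prod_def lessThan_atLeast0)
  also have "\<dots> = (\<Sum>l<k. act n (h i l * h' l j))"
    using assms ij by (intro sum.cong refl act_mult [symmetric]) auto
  also have "\<dots> = amat n nr nc (\<lambda>i j. \<Sum>l<k. h i l * h' l j) $$ (i, j)"
    using ij by (simp add: amat_def act_sum)
  finally show "(amat n nr k h * amat n k nc h') $$ (i, j) =
    amat n nr nc (\<lambda>i j. \<Sum>l<k. h i l * h' l j) $$ (i, j)" .
qed (simp_all add: amat_def)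

lemma amat1_mult:
  "supp x \<subseteq> symg n \<Longrightarrow> supp y \<subseteq> symg n \<Longrightarrow> amat1 n x * amat1 n y = amat1 n (x * y)"
  unfolding amat1_def by (subst amat_mult) simp_all

lemma mor1_act: "mor1 (act n x) = amat1 n x"
  by (rule eq_matI) (simp_all add: mor1_def amat1_def amat_def)

lemma galg_mor_eq: "galg_mor n x = amat1 n (emb n x)"
  by (simp add: galg_mor_def mor1_act flip: act_emb)

lemma perm_mor_eq: "g \<in> symg n \<Longrightarrow> perm_mor n (pfun g) = amat1 n (perm_elt g :: 'k::field sga)"
  by (simp add: perm_mor_def act_perm_elt pmor_def flip: mor1_act)

lemma Idm_Upow_1: "Idm (Upow 1) = mor1 (hdiag (did [Up]))"
  by (rule eq_matI) (simp_all add: Idm_def Upow_def mor1_def)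

lemma tens_mor_amat1:
  "supp x \<subseteq> symg m \<Longrightarrow> tens_mor (amat1 m x) (Idm (Upow 1)) = amat1 (Suc m) x"
  unfolding Idm_Upow_1
  by (rule eq_matI) (simp_all add: tens_mor_def amat1_def amat_def mor1_def act_tens)

lemma young_mor_eq: "young_mor lam = amat1 (sum_list lam) (young_elt lam)"
  by (simp add: young_mor_def galg_mor_eq young_elt_def)

lemma amat_Hom:
  assumes "length X = nc" "length Y = nr" "\<And>x. x \<in> set X \<union> set Y \<Longrightarrow> x = replicate n Up"
  shows "amat n nr nc h \<in> Hom X Y"
proof -
  have "X ! i = replicate n Up" if "i < nc" for i using that assms nth_mem [of i X] by blast
  moreover have "Y ! i = replicate n Up" if "i < nr" for i using that assms nth_mem [of i Y] by blast
  ultimately show ?thesis using assms(1,2) by (simp add: Hom_def amat_def hom_set_act)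
qed

lemma amat1_Hom: "amat1 n x \<in> Hom (Upow n) (Upow n)"
  unfolding amat1_def by (rule amat_Hom) (auto simp: Upow_def)

text \<open>Permutations of a single row lie in the row group, whose elements the Young idempotent
  absorbs from the left. When \<open>s\<close> is the new row of \<open>rho\<close>, its strand set
  in \<open>lam\<close> is empty and the symmetrizer is the identity.\<close>

lemma row_sym_young_mor:
  assumes "1 \<le> s"
  shows "row_sym lam s * young_mor lam = (young_mor lam :: 'k::field_char_0 hmor mat)"
proof -
  let ?n = "sum_list lam" and ?G = "{\<sigma>. \<sigma> permutes row_strands lam s}"
  have sub: "row_strands lam s \<subseteq> {1..?n}" using row_strands_eq [OF assms] by auto
  have "emb ?n (symmetrizer ?G) * young_elt lam = (young_elt lam :: 'k sga)"
  proof (rule emb_symmetrizer_absorb)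
    show "\<sigma> permutes {1..?n}" if "\<sigma> \<in> ?G" for \<sigma>
      using that sub permutes_subset by blast
    show "?G \<noteq> {}" using permutes_id by blast
    fix g assume "pfun g \<in> ?G"
    then have p: "pfun g permutes row_strands lam s" by simp
    have "rw lam (pfun g x) = rw lam x" for x
    proof (cases "x \<in> row_strands lam s")
      case True
      then have "pfun g x \<in> row_strands lam s" using permutes_in_image [OF p] by simp
      then show ?thesis using True row_strands_eq [OF assms, of lam] by simp
    qed (simp add: permutes_not_in [OF p])
    moreover have "g \<in> symg ?n"
      unfolding symg_def mem_Collect_eq by (rule permutes_subset [OF p sub])
    ultimately have "g \<in> rowg lam" by (simp add: rowg_def)
    then show "perm_elt g * young_elt lam = (young_elt lam :: 'k sga)" by (rule perm_elt_young_elt)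
  qed
  then show ?thesis
    unfolding row_sym_def galg_mor_eq young_mor_eq by (simp add: amat1_mult supp_emb supp_young_elt)
qed

section \<open>Inclusions and projections as images of group algebra elements\<close>

context
  fixes lam :: "nat list" and m :: nat
  assumes lam: "is_partition lam m"
begin

private lemma n: "sum_list lam = m"
  using lam by (simp add: is_partition_def)

private lemma supp_young_elt_Suc: "supp (young_elt lam :: 'k::field sga) \<subseteq> symg (Suc m)"
  using supp_young_elt [of lam, where ?'k = 'k] symg_mono [of m "Suc m"] n by auto

lemma tens_young_mor: "tens_mor (young_mor lam) (Idm (Upow 1)) = (amat1 (Suc m) (young_elt lam) :: 'k::field hmor mat)"
  unfolding young_mor_eq n using supp_young_elt [of lam, where ?'k = 'k] by (intro tens_mor_amat1) (simp add: n)

lemma P_tens_P_eq: "P_tens_P lam = (Upow (Suc m), amat1 (Suc m) (young_elt lam))"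
  unfolding P_tens_P_def Ktens_def schur_obj_def Kincl_def fst_conv snd_conv tens_young_mor n
  by (simp add: tens_obj_def Upow_def replicate_append_same)

context
  fixes s :: nat
  assumes s: "s \<in> addable lam"
begin

private lemma supp_mu: "supp (young_elt (add_box lam s) :: 'k::field sga) \<subseteq> symg (Suc m)"
  using supp_young_elt [of "add_box lam s", where ?'k = 'k] sum_add_box [OF lam s] by simp

lemma schur_obj_add_box: "schur_obj (add_box lam s) = (Upow (Suc m), amat1 (Suc m) (young_elt (add_box lam s)))"
  by (simp add: schur_obj_def young_mor_eq sum_add_box [OF lam s])

lemma iota_eq: "iota lam s = (amat1 (Suc m) (iota_elt lam s) :: 'k::field_char_0 hmor mat)"
proof -
  let ?n = "Suc m" and ?mu = "add_box lam s"
  have w: "w_elt lam s \<in> symg ?n" by (rule w_elt_symg [OF lam s])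
  have T: "tens_mor (young_mor lam) (Idm (Upow 1)) * perm_mor (sum_list lam + 1) (w_perm lam s) =
      (amat1 ?n (young_elt lam * perm_elt (w_elt lam s)) :: 'k hmor mat)"
    unfolding tens_young_mor using perm_mor_eq [OF w, where ?'k = 'k]
    by (simp add: n pfun_w_elt [OF lam s] amat1_mult supp_young_elt_Suc w)
  have c: "amat1 ?n (young_elt lam * perm_elt (w_elt lam s)) \<in> carrier_mat 1 1" 
    "row_sym ?mu s \<in> carrier_mat 1 1" "young_mor ?mu \<in> carrier_mat 1 1"
    by (simp_all add: amat1_def amat_def row_sym_def galg_mor_eq young_mor_eq)
  have "iota lam s = amat1 ?n (young_elt lam * perm_elt (w_elt lam s)) * (row_sym ?mu s * (young_mor ?mu :: 'k hmor mat))"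
    unfolding iota_def T by (rule assoc_mult_mat [OF c])
  also have "\<dots> = amat1 ?n (iota_elt lam s)"
    unfolding row_sym_young_mor [OF s_bounds(1) [OF lam s]]
    using supp_mult_symg [OF supp_young_elt_Suc supp_perm_elt_symg [OF w], where ?'k = 'k]
    by (simp add: young_mor_eq sum_add_box [OF lam s] amat1_mult supp_mu iota_elt_def [OF lam s])
  finally show ?thesis .
qed

lemma rho_eq: "rho lam s = (amat1 (Suc m) (rho_elt lam s) :: 'k::field_char_0 hmor mat)"
proof -
  let ?n = "Suc m" and ?mu = "add_box lam s"
  have w: "- w_elt lam s \<in> symg ?n" using w_elt_symg [OF lam s] by simp
  have p: "perm_mor (sum_list lam + 1) (inv_into UNIV (w_perm lam s)) = amat1 ?n (perm_elt (- w_elt lam s))"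
    using perm_mor_eq [OF w] by (simp add: n pfun_uminus pfun_w_elt [OF lam s])
  show ?thesis
    unfolding rho_def row_sym_young_mor [OF s_bounds(1) [OF lam s]] tens_young_mor p
    using supp_mult_symg [OF supp_mu supp_perm_elt_symg [OF w], where ?'k = 'k]
    by (simp add: young_mor_eq sum_add_box [OF lam s] amat1_mult supp_mu supp_young_elt_Suc w_elt_symg [OF lam s]
        rho_elt_def [OF lam s])
qed

lemma iota_elt_absorb: "young_elt lam * iota_elt lam s = (iota_elt lam s :: 'k::field_char_0 sga)"
  "iota_elt lam s * young_elt (add_box lam s) = (iota_elt lam s :: 'k sga)"
  unfolding iota_elt_def [OF lam s]
  by (simp add: young_elt_square [OF lam] flip: mult.assoc)
     (simp add: young_elt_square [OF is_partition_add_box [OF lam s]] mult.assoc)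

lemma rho_elt_absorb: "rho_elt lam s * young_elt lam = (rho_elt lam s :: 'k::field_char_0 sga)"
  "young_elt (add_box lam s) * rho_elt lam s = (rho_elt lam s :: 'k sga)"
  unfolding rho_elt_def [OF lam s]
  by (simp add: young_elt_square [OF lam] mult.assoc)
     (simp add: young_elt_square [OF is_partition_add_box [OF lam s]] flip: mult.assoc)

lemma is_kobj_add_box: "is_kobj (schur_obj (add_box lam s) :: 'k::field_char_0 kobj)"
  unfolding is_kobj_def schur_obj_add_box fst_conv snd_conv
  by (simp add: amat1_Hom amat1_mult supp_mu young_elt_square [OF is_partition_add_box [OF lam s]])

lemma iota_KHom: "iota lam s \<in> KHom (schur_obj (add_box lam s)) (P_tens_P lam :: 'k::field_char_0 kobj)"
  unfolding KHom_def schur_obj_add_box P_tens_P_eq iota_eq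
  by (simp add: amat1_Hom amat1_mult supp_mu supp_young_elt_Suc supp_iota_elt [OF lam s] iota_elt_absorb)

lemma rho_KHom: "rho lam s \<in> KHom (P_tens_P lam) (schur_obj (add_box lam s) :: 'k::field_char_0 kobj)"
  unfolding KHom_def schur_obj_add_box P_tens_P_eq rho_eq
  by (simp add: amat1_Hom amat1_mult supp_mu supp_young_elt_Suc supp_rho_elt [OF lam s] rho_elt_absorb)

end

lemma is_kobj_P_tens_P: "is_kobj (P_tens_P lam :: 'k::field_char_0 kobj)"
  unfolding is_kobj_def P_tens_P_eq fst_conv snd_conv
  by (simp add: amat1_Hom amat1_mult supp_young_elt_Suc young_elt_square [OF lam])

lemma rho_elt_iota_elt_delta:
  assumes "s \<in> addable lam" "r \<in> addable lam"
  shows "rho_elt lam s * iota_elt lam r = (if s = r then young_elt (add_box lam s) else (0 :: 'k::field_char_0 sga))"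
  using rho_elt_iota_elt [OF lam, of s] rho_elt_iota_elt_0 [OF lam, of s r] assms by auto

lemma rho_iota:
  assumes s: "s \<in> addable lam" and r: "r \<in> addable lam"
  shows "rho lam s * iota lam r =
    (if s = r then KId (schur_obj (add_box lam s) :: 'k::field_char_0 kobj)
     else Kzero (schur_obj (add_box lam r)) (schur_obj (add_box lam s)))"
proof -
  have "rho lam s * iota lam r = amat1 (Suc m) (if s = r then young_elt (add_box lam s) else (0 :: 'k sga))"
    unfolding rho_eq [OF s] iota_eq [OF r]
    by (simp only: amat1_mult supp_rho_elt [OF lam s] supp_iota_elt [OF lam r] rho_elt_iota_elt_delta [OF assms])
  moreover have "amat1 (Suc m) 0 = (0\<^sub>m 1 1 :: 'k hmor mat)"
    by (rule eq_matI) (simp_all add: amat1_def amat_def)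
  ultimately show ?thesis
    by (simp add: KId_def Kzero_def schur_obj_add_box s r Upow_def)
qed

lemma sum_iota_rho:
  "KId (P_tens_P lam :: 'k::field_char_0 kobj) =
    Ksum (P_tens_P lam) (P_tens_P lam) (\<lambda>s. iota lam s * rho lam s) (addable lam)"
proof -
  have "iota lam s * rho lam s = (amat1 (Suc m) (box_idem lam s) :: 'k hmor mat)" if "s \<in> addable lam" for s
    unfolding rho_eq [OF that] iota_eq [OF that] box_idem_def
    by (simp add: amat1_mult supp_rho_elt [OF lam that] supp_iota_elt [OF lam that])
  then have "(\<Sum>s\<in>addable lam. (iota lam s * rho lam s) $$ (0, 0)) = act (Suc m) (young_elt lam :: 'k sga)"
    unfolding young_elt_eq_sum_box_idem [OF lam] act_sum by (intro sum.cong refl) (simp add: amat1_def amat_def)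
  then show ?thesis
    unfolding KId_def Ksum_def sum_mor_def P_tens_P_eq
    by (intro eq_matI) (simp_all add: amat1_def amat_def Upow_def)
qed

lemma diag_block_mat_mor1:
  "diag_block_mat (map mor1 xs) = mat (length xs) (length xs) (\<lambda>(i, j). if i = j then xs ! i else 0)"
proof (induction xs)
  case Nil
  show ?case by (rule eq_matI) simp_all
next
  case (Cons x xs)
  show ?case
    unfolding list.map diag_block_mat.simps Let_def Cons
    by (rule eq_matI) (auto simp: mor1_def four_block_mat_def Let_def nth_Cons split: nat.splits)
qed

text \<open>The isomorphism \<open>F\<close> is the column of the \<open>rho\<close> and its inverse
  \<open>G\<close> the row of the \<open>iota\<close>. Then \<open>G * F\<close> is the completeness
  sum and \<open>F * G\<close> the matrix of the delta relation.\<close>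

lemma Kiso_covers:
  assumes mus: "distinct mus" "set mus = covers lam"
  shows "Kiso (P_tens_P lam :: 'k::field_char_0 kobj) (Kdsum (map schur_obj mus))"
proof -
  let ?n = "Suc m" and ?N = "length mus"
  have "\<exists>s. s \<in> addable lam \<and> mus ! i = add_box lam s" if "i < ?N" for i
    using nth_mem [OF that] mus(2) by (auto simp: covers_def)
  \<comment> \<open>\<open>b\<close> lists the addable rows in the order prescribed by
    \<open>mus\<close>; distinctness of \<open>mus\<close> makes it a bijection, so sums over
    positions become sums over addable rows.\<close>
  then obtain b where b: "\<And>i. i < ?N \<Longrightarrow> b i \<in> addable lam" "\<And>i. i < ?N \<Longrightarrow> mus ! i = add_box lam (b i)"
    by metis
  have b_eq: "b i = b j \<longleftrightarrow> i = j" if "i < ?N" "j < ?N" for i j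
    using b(2) that mus(1) by (metis nth_eq_iff_index_eq)
  have bij: "bij_betw b {..<?N} (addable lam)"
  proof (rule bij_betw_imageI)
    show "inj_on b {..<?N}" using b_eq by (auto simp: inj_on_def)
    show "b ` {..<?N} = addable lam"
    proof (intro equalityI subsetI)
      fix s assume s: "s \<in> addable lam"
      then have "add_box lam s \<in> set mus" using mus(2) by (auto simp: covers_def)
      then obtain i where i: "i < ?N" "mus ! i = add_box lam s" by (auto simp: in_set_conv_nth)
      then have "b i = s" using add_box_inject [OF lam b(1) s] b(2) by metis
      then show "s \<in> b ` {..<?N}" using i by auto
    qed (use b(1) in auto)
  qed
  note supps = supp_iota_elt [OF lam b(1), where ?'k = 'k] supp_rho_elt [OF lam b(1), where ?'k = 'k]
  let ?D = "\<lambda>i j. if i = j then young_elt (add_box lam (b i)) else (0 :: 'k sga)"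
  have objs: "map schur_obj mus = (map (\<lambda>mu. (Upow ?n, mor1 (act ?n (young_elt mu)))) mus :: 'k kobj list)"
    using mus(2) by (auto simp: covers_def schur_obj_add_box mor1_act)
  have B: "Kdsum (map schur_obj mus) = (replicate ?N (replicate ?n Up), amat ?n ?N ?N ?D)"
  proof -
    have "concat (map (\<lambda>_. [replicate ?n Up]) xs) = replicate (length xs) (replicate ?n Up)" for xs :: "nat list list"
      by (induction xs) simp_all
    then have "concat (map fst (map schur_obj mus :: 'k kobj list)) = replicate ?N (replicate ?n Up)"
      unfolding objs by (simp add: comp_def Upow_def)
    moreover have "diag_block_mat (map snd (map schur_obj mus)) = amat ?n ?N ?N ?D"
    proof -
      have "diag_block_mat (map snd (map schur_obj mus)) = diag_block_mat (map mor1 (map (\<lambda>mu. act ?n (young_elt mu :: 'k sga)) mus))"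
        unfolding objs by (simp add: comp_def)
      also have "\<dots> = amat ?n ?N ?N ?D"
        unfolding diag_block_mat_mor1 by (rule eq_matI) (auto simp: amat_def b(2))
      finally show ?thesis .
    qed
    ultimately show ?thesis by (simp add: Kdsum_def)
  qed
  have suppD: "supp (?D i j) \<subseteq> symg ?n" if "i < ?N" for i j
    using supp_young_elt [of "add_box lam (b i)", where ?'k = 'k] sum_add_box [OF lam b(1) [OF that]]
    by (cases "i = j") auto
  have sq: "young_elt (add_box lam (b i)) * young_elt (add_box lam (b i)) = (young_elt (add_box lam (b i)) :: 'k sga)" if "i < ?N" for i
    by (rule young_elt_square [OF is_partition_add_box [OF lam b(1) [OF that]]])
  have delta: "(\<Sum>l<?N. ?D i l * h l) = ?D i i * h i" "(\<Sum>l<?N. h l * ?D l i) = h i * ?D i i" if "i < ?N" for i h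
  proof -
    have "(\<Sum>l<?N. ?D i l * h l) = (\<Sum>l<?N. if l = i then ?D i i * h i else 0)" by (rule sum.cong) auto
    then show "(\<Sum>l<?N. ?D i l * h l) = ?D i i * h i" using that by simp
    have "(\<Sum>l<?N. h l * ?D l i) = (\<Sum>l<?N. if l = i then h i * ?D i i else 0)" by (rule sum.cong) auto
    then show "(\<Sum>l<?N. h l * ?D l i) = h i * ?D i i" using that by simp
  qed
  define F where "F = (amat ?n ?N 1 (\<lambda>i _. rho_elt lam (b i)) :: 'k hmor mat)"
  define G where "G = (amat ?n 1 ?N (\<lambda>_ i. iota_elt lam (b i)) :: 'k hmor mat)"
  have "is_kobj (Kdsum (map schur_obj mus) :: 'k kobj)"
  proof -
    have "amat ?n ?N ?N ?D * amat ?n ?N ?N ?D = amat ?n ?N ?N (\<lambda>i j. \<Sum>l<?N. ?D i l * ?D l j)"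
      by (intro amat_mult suppD)
    also have "\<dots> = amat ?n ?N ?N ?D"
      by (rule amat_cong) (simp add: delta sq)
    finally show ?thesis
      unfolding is_kobj_def B fst_conv snd_conv by (intro conjI amat_Hom) auto
  qed
  moreover have "F \<in> KHom (P_tens_P lam) (Kdsum (map schur_obj mus))"
  proof -
    have "amat ?n ?N ?N ?D * F = amat ?n ?N 1 (\<lambda>i j. \<Sum>l<?N. ?D i l * rho_elt lam (b l))"
      unfolding F_def using suppD supps by (intro amat_mult)
    also have "\<dots> = F"
      unfolding F_def by (rule amat_cong) (simp only: delta rho_elt_absorb [OF b(1)] simp_thms if_True)
    finally have 1: "amat ?n ?N ?N ?D * F = F" .
    have "F * amat1 ?n (young_elt lam) = amat ?n ?N 1 (\<lambda>i j. \<Sum>l<1::nat. rho_elt lam (b i) * young_elt lam)"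
      unfolding F_def amat1_def using supps supp_young_elt_Suc by (intro amat_mult)
    also have "\<dots> = F"
      unfolding F_def by (rule amat_cong) (simp add: rho_elt_absorb [OF b(1)])
    finally have 2: "F * amat1 ?n (young_elt lam) = F" .
    have "F \<in> Hom (Upow ?n) (replicate ?N (replicate ?n Up))"
      unfolding F_def by (rule amat_Hom) (auto simp: Upow_def)
    then show ?thesis
      unfolding KHom_def P_tens_P_eq B fst_conv snd_conv using 1 2 by blast
  qed
  moreover have "G \<in> KHom (Kdsum (map schur_obj mus)) (P_tens_P lam)"
  proof -
    have "G * amat ?n ?N ?N ?D = amat ?n 1 ?N (\<lambda>i j. \<Sum>l<?N. iota_elt lam (b l) * ?D l j)"
      unfolding G_def using suppD supps by (intro amat_mult)
    also have "\<dots> = G"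
      unfolding G_def by (rule amat_cong) (simp only: delta iota_elt_absorb [OF b(1)] simp_thms if_True)
    finally have 1: "G * amat ?n ?N ?N ?D = G" .
    have "amat1 ?n (young_elt lam) * G = amat ?n 1 ?N (\<lambda>i j. \<Sum>l<1::nat. young_elt lam * iota_elt lam (b j))"
      unfolding G_def amat1_def using supps supp_young_elt_Suc by (intro amat_mult)
    also have "\<dots> = G"
      unfolding G_def by (rule amat_cong) (simp add: iota_elt_absorb [OF b(1)])
    finally have 2: "amat1 ?n (young_elt lam) * G = G" .
    have "G \<in> Hom (replicate ?N (replicate ?n Up)) (Upow ?n)"
      unfolding G_def by (rule amat_Hom) (auto simp: Upow_def)
    then show ?thesis
      unfolding KHom_def P_tens_P_eq B fst_conv snd_conv using 1 2 by blast
  qed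
  moreover have "G * F = KId (P_tens_P lam)"
  proof -
    have "G * F = amat ?n 1 1 (\<lambda>i j. \<Sum>l<?N. iota_elt lam (b l) * rho_elt lam (b l))"
      unfolding F_def G_def using supps by (intro amat_mult)
    also have "(\<Sum>l<?N. iota_elt lam (b l) * rho_elt lam (b l)) = (\<Sum>s\<in>addable lam. box_idem lam s :: 'k sga)"
      unfolding box_idem_def by (rule sum.reindex_bij_betw [OF bij])
    finally show ?thesis by (simp add: KId_def P_tens_P_eq amat1_def young_elt_eq_sum_box_idem [OF lam, symmetric])
  qed
  moreover have "F * G = KId (Kdsum (map schur_obj mus))"
  proof -
    have "F * G = amat ?n ?N ?N (\<lambda>i j. \<Sum>l<1::nat. rho_elt lam (b i) * iota_elt lam (b j))"
      unfolding F_def G_def using supps by (intro amat_mult)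
    also have "\<dots> = amat ?n ?N ?N ?D"
      by (rule amat_cong) (simp add: rho_elt_iota_elt_delta b(1) b_eq)
    finally show ?thesis by (simp add: KId_def B)
  qed
  ultimately show ?thesis
    unfolding Kiso_def using is_kobj_P_tens_P by blast
qed

end

theorem proposition4p10:
  fixes lam :: "nat list" and n :: nat
  assumes "n \<ge> 1" and "is_partition lam (n - 1)"
  shows "is_kobj (P_tens_P lam :: 'k::field_char_0 kobj) \<and>
    (\<forall>s\<in>addable lam.
       is_kobj (schur_obj (add_box lam s) :: 'k kobj) \<and>
       iota lam s \<in> KHom (schur_obj (add_box lam s)) (P_tens_P lam :: 'k kobj) \<and>
       rho lam s \<in> KHom (P_tens_P lam) (schur_obj (add_box lam s) :: 'k kobj)) \<and>
    (\<forall>s\<in>addable lam. \<forall>r\<in>addable lam.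
       rho lam s * iota lam r =
         (if s = r then KId (schur_obj (add_box lam s) :: 'k kobj)
          else Kzero (schur_obj (add_box lam r)) (schur_obj (add_box lam s)))) \<and>
    KId (P_tens_P lam :: 'k kobj) =
      Ksum (P_tens_P lam) (P_tens_P lam) (\<lambda>s. iota lam s * rho lam s) (addable lam) \<and>
    (\<forall>mus. distinct mus \<and> set mus = covers lam \<longrightarrow>
       Kiso (P_tens_P lam :: 'k kobj) (Kdsum (map schur_obj mus)))"
  by (intro conjI ballI allI impI is_kobj_P_tens_P [OF assms(2)] is_kobj_add_box [OF assms(2)]
      iota_KHom [OF assms(2)] rho_KHom [OF assms(2)] rho_iota [OF assms(2)] sum_iota_rho [OF assms(2)]
      Kiso_covers [OF assms(2)]; simp)

end
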